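(* Let $m,s\ge2$ be integers, let $t\in\{0,1,\ldots,m-1\}$, and let $\mathfrak{v}=t\cdots t$ be the constant word of length $s-1$. Then the group $\mathfrak{K}(\mathfrak{v})$ does not admit a maximal subgroup of infinite index.
   Context: Let $T$ be the $m$-adic rooted tree, with vertex set the free monoid $X^*$ on $X=\{0,\dots,m-1\}$ (root the empty word, $u$ joined to $ux$ for $x\in X$). $\operatorname{Aut}T$ acts on the right and products are composed from left to right. For $f\in\operatorname{Aut}T$ and $u\in X^*$ the section $f_u\in\operatorname{Aut}T$ is defined by $(uv)f=(uf)(vf_u)$ for all $v\in X^*$. We write $f=(f_0,\dots,f_{m-1})\sigma_f$, where $f_x$ is the section at $x\in X$ and $\sigma_f\in\operatorname{Sym}(X)$ is the action of $f$ on the first level; $\sigma_f$ is omitted if trivial. Let $\sigma=(0\;1\;\cdots\;m-1)$, i.e. $x\mapsto x+1\bmod m$. For a word $\mathfrak{v}=x_0\cdots x_{s-2}$ over $X$, $\mathfrak{K}(\mathfrak{v})=\langle a_0,\dots,a_{s-1}\rangle\le\operatorname{Aut}T$ where $a_0=(1,\dots,1,a_{s-1})\sigma$ and, for $0\le i\le s-2$, $a_{i+1}=(1,\dots,1,a_i,1,\dots,1)$ with $a_i$ in coordinate $x_i$ (coordinates indexed by $0,\dots,m-1$). *)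

theory Defs
  imports "HOL-Algebra.Algebra"
begin

section \<open>The rooted tree and its automorphism group\<close>

definition tree_words :: "nat \<Rightarrow> nat list set" where
  "tree_words m = lists {0..<m}"

definition tree_adj :: "nat \<Rightarrow> nat list \<Rightarrow> nat list \<Rightarrow> bool" where
  "tree_adj m u v \<longleftrightarrow> u \<in> tree_words m \<and> v \<in> tree_words m \<and>
     (\<exists>x<m. v = u @ [x] \<or> u = v @ [x])"

text \<open>
  Automorphisms of the rooted tree are the root-preserving graph automorphisms. They are
  represented as extensional functions (undefined outside the vertex set), so that equality
  in the carrier is equality of automorphisms. They act on the right: the product of
  \<open>f\<close> and \<open>g\<close> is ``first \<open>f\<close>, then \<open>g\<close>'', the opposite of the convention of
  \<^const>\<open>BijGroup\<close>.
\<close>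

definition AutT :: "nat \<Rightarrow> (nat list \<Rightarrow> nat list) monoid" where
  "AutT m = \<lparr>carrier = {f \<in> Bij (tree_words m). f [] = [] \<and>
       (\<forall>u\<in>tree_words m. \<forall>v\<in>tree_words m. tree_adj m (f u) (f v) \<longleftrightarrow> tree_adj m u v)},
     monoid.mult = (\<lambda>f g. compose (tree_words m) g f),
     monoid.one = (\<lambda>w\<in>tree_words m. w)\<rparr>"

text \<open>
  Since automorphisms preserve length and prefixes, the section at \<open>u\<close> is obtained by
  deleting the first \<open>length u\<close> letters of the image of \<open>u @ v\<close>; see \<open>section_eq\<close> below.
\<close>

definition tree_section ::
    "nat \<Rightarrow> (nat list \<Rightarrow> nat list) \<Rightarrow> nat list \<Rightarrow> nat list \<Rightarrow> nat list" where
  "tree_section m f u = (\<lambda>v\<in>tree_words m. drop (length u) (f (u @ v)))"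

text \<open>\<open>f = (F 0, \<dots>, F (m - 1)) p\<close>\<close>

definition wreath_form ::
    "nat \<Rightarrow> (nat list \<Rightarrow> nat list) \<Rightarrow> (nat \<Rightarrow> nat list \<Rightarrow> nat list) \<Rightarrow> (nat \<Rightarrow> nat) \<Rightarrow> bool" where
  "wreath_form m f F p \<longleftrightarrow> (\<forall>x<m. tree_section m f [x] = F x \<and> f [x] = [p x])"


section \<open>The groups \<open>K(v)\<close>\<close>

text \<open>
  The generators \<open>a\<^sub>0, \<dots>, a\<^sub>s\<^sub>-\<^sub>1\<close>, where \<open>s = length v + 1\<close>, are given by the wreath recursion
  unfolded to an explicit action on words; \<open>kgen_wreath_0\<close>, \<open>kgen_wreath_Suc\<close> and
  \<open>kgen_unique\<close> below show that they are the only automorphisms satisfying that recursion.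
\<close>

fun kact :: "nat \<Rightarrow> nat list \<Rightarrow> nat \<Rightarrow> nat list \<Rightarrow> nat list" where
  "kact m v i [] = []"
| "kact m v 0 (x # w) = (x + 1) mod m # (if x = m - 1 then kact m v (length v) w else w)"
| "kact m v (Suc i) (x # w) = x # (if x = v ! i then kact m v i w else w)"

definition kgen :: "nat \<Rightarrow> nat list \<Rightarrow> nat \<Rightarrow> nat list \<Rightarrow> nat list" where
  "kgen m v i = (\<lambda>w\<in>tree_words m. kact m v i w)"

definition KGroup :: "nat \<Rightarrow> nat list \<Rightarrow> (nat list \<Rightarrow> nat list) monoid" where
  "KGroup m v = (AutT m)\<lparr>carrier := generate (AutT m) (kgen m v ` {0..length v})\<rparr>"


section \<open>Maximal subgroups\<close>

definition maximal_subgroup :: "'a set \<Rightarrow> ('a, 'b) monoid_scheme \<Rightarrow> bool" where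
  "maximal_subgroup M G \<longleftrightarrow> subgroup M G \<and> M \<noteq> carrier G \<and>
     (\<forall>H. subgroup H G \<and> M \<subseteq> H \<longrightarrow> H = M \<or> H = carrier G)"

definition infinite_index :: "'a set \<Rightarrow> ('a, 'b) monoid_scheme \<Rightarrow> bool" where
  "infinite_index H G \<longleftrightarrow> infinite (rcosets\<^bsub>G\<^esub> H)"


section \<open>Adequacy of the definitions\<close>

lemma tree_words_simps [simp]:
  "[] \<in> tree_words m"
  "x # w \<in> tree_words m \<longleftrightarrow> x < m \<and> w \<in> tree_words m"
  "u @ w \<in> tree_words m \<longleftrightarrow> u \<in> tree_words m \<and> w \<in> tree_words m"
  by (auto simp: tree_words_def)

lemma AutT_D:
  assumes "f \<in> carrier (AutT m)"
  shows "bij_betw f (tree_words m) (tree_words m)" "f \<in> extensional (tree_words m)" "f [] = []"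
    "\<And>u v. u \<in> tree_words m \<Longrightarrow> v \<in> tree_words m \<Longrightarrow> tree_adj m (f u) (f v) \<longleftrightarrow> tree_adj m u v"
  using assms by (auto simp: AutT_def Bij_def)

lemma AutT_I:
  assumes "bij_betw f (tree_words m) (tree_words m)" "f \<in> extensional (tree_words m)" "f [] = []"
    "\<And>u v. u \<in> tree_words m \<Longrightarrow> v \<in> tree_words m \<Longrightarrow> tree_adj m (f u) (f v) \<longleftrightarrow> tree_adj m u v"
  shows "f \<in> carrier (AutT m)"
  using assms by (auto simp: AutT_def Bij_def)

lemma AutT_words:
  assumes "f \<in> carrier (AutT m)" "u \<in> tree_words m"
  shows "f u \<in> tree_words m"
  using AutT_D(1)[OF assms(1)] assms(2) by (auto simp: bij_betw_def)

lemma AutT_inj: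
  assumes "f \<in> carrier (AutT m)" "u \<in> tree_words m" "w \<in> tree_words m"
  shows "f u = f w \<longleftrightarrow> u = w"
  using AutT_D(1)[OF assms(1)] assms(2,3) by (auto simp: bij_betw_def inj_on_def)

lemma group_AutT: "group (AutT m)"
proof (rule groupI)
  show "\<one>\<^bsub>AutT m\<^esub> \<in> carrier (AutT m)"
    by (auto simp: AutT_def Bij_def bij_betw_def inj_on_def)
next
  fix f g assume f: "f \<in> carrier (AutT m)" and g: "g \<in> carrier (AutT m)"
  have "compose (tree_words m) g f \<in> carrier (AutT m)"
  proof (rule AutT_I)
    show "bij_betw (compose (tree_words m) g f) (tree_words m) (tree_words m)"
      using AutT_D(1)[OF f] AutT_D(1)[OF g] bij_betw_compose by blast
  qed (use AutT_D[OF f] AutT_D[OF g] AutT_words[OF f] in \<open>auto simp: compose_def\<close>)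
  then show "f \<otimes>\<^bsub>AutT m\<^esub> g \<in> carrier (AutT m)"
    by (simp add: AutT_def)
next
  fix f g h
  assume f: "f \<in> carrier (AutT m)" and g: "g \<in> carrier (AutT m)" and h: "h \<in> carrier (AutT m)"
  show "f \<otimes>\<^bsub>AutT m\<^esub> g \<otimes>\<^bsub>AutT m\<^esub> h = f \<otimes>\<^bsub>AutT m\<^esub> (g \<otimes>\<^bsub>AutT m\<^esub> h)"
    using AutT_words[OF f] by (auto simp: AutT_def compose_def fun_eq_iff)
next
  fix f assume f: "f \<in> carrier (AutT m)"
  show "\<one>\<^bsub>AutT m\<^esub> \<otimes>\<^bsub>AutT m\<^esub> f = f"
    using AutT_D(2)[OF f] by (auto simp: AutT_def compose_def fun_eq_iff extensional_def)
next
  fix f assume f: "f \<in> carrier (AutT m)"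
  let ?W = "tree_words m"
  let ?g = "\<lambda>x\<in>?W. inv_into ?W f x"
  have fb: "f \<in> Bij ?W" using f by (simp add: AutT_def)
  have gb: "?g \<in> Bij ?W" by (rule restrict_inv_into_Bij[OF fb])
  have gw: "?g x \<in> ?W" if "x \<in> ?W" for x using gb that by (auto simp: Bij_def bij_betw_def)
  have fg: "f (?g x) = x" if "x \<in> ?W" for x
    using that AutT_D(1)[OF f] by (auto simp: bij_betw_def f_inv_into_f)
  have "?g \<in> carrier (AutT m)"
  proof (rule AutT_I)
    show "?g [] = []"
      using fg[of "[]"] AutT_inj[OF f gw, of "[]" "[]"] AutT_D(3)[OF f] by simp
    show "tree_adj m (?g u) (?g v) \<longleftrightarrow> tree_adj m u v" if "u \<in> ?W" "v \<in> ?W" for u v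
      using AutT_D(4)[OF f gw[OF that(1)] gw[OF that(2)]] fg[OF that(1)] fg[OF that(2)] by simp
  qed (use gb in \<open>auto simp: Bij_def\<close>)
  moreover have "?g \<otimes>\<^bsub>AutT m\<^esub> f = \<one>\<^bsub>AutT m\<^esub>"
    using fg by (auto simp: AutT_def compose_def fun_eq_iff)
  ultimately show "\<exists>g\<in>carrier (AutT m). g \<otimes>\<^bsub>AutT m\<^esub> f = \<one>\<^bsub>AutT m\<^esub>" by blast
qed

lemma AutT_snoc:
  assumes f: "f \<in> carrier (AutT m)"
  shows "u @ [x] \<in> tree_words m \<Longrightarrow> \<exists>y<m. f (u @ [x]) = f u @ [y]"
proof (induction u arbitrary: x rule: rev_induct)
  case Nil
  then have "tree_adj m (f []) (f [x])"
    using AutT_D(4)[OF f, of "[]" "[x]"] by (auto simp: tree_adj_def)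
  then show ?case using AutT_D(3)[OF f] by (auto simp: tree_adj_def)
next
  case (snoc z u)
  let ?u = "u @ [z]"
  have w: "?u \<in> tree_words m" "?u @ [x] \<in> tree_words m" "u \<in> tree_words m" "x < m"
    using snoc.prems by auto
  then have "tree_adj m (f ?u) (f (?u @ [x]))"
    using AutT_D(4)[OF f w(1) w(2)] by (auto simp: tree_adj_def)
  moreover obtain y' where "f ?u = f u @ [y']" using snoc.IH w by blast
  moreover have "f u \<noteq> f (?u @ [x])" using AutT_inj[OF f w(3) w(2)] by auto
  ultimately show ?case by (auto simp: tree_adj_def)
qed

lemma AutT_length:
  assumes f: "f \<in> carrier (AutT m)"
  shows "u \<in> tree_words m \<Longrightarrow> length (f u) = length u"
proof (induction u rule: rev_induct)
  case Nil
  then show ?case using AutT_D(3)[OF f] by simp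
next
  case (snoc x u)
  then obtain y where "f (u @ [x]) = f u @ [y]" using AutT_snoc[OF f] by blast
  then show ?case using snoc by simp
qed

lemma AutT_prefix:
  assumes f: "f \<in> carrier (AutT m)"
  shows "u @ v \<in> tree_words m \<Longrightarrow> \<exists>w. f (u @ v) = f u @ w"
proof (induction v rule: rev_induct)
  case Nil
  then show ?case by simp
next
  case (snoc x v)
  then obtain w where "f (u @ v) = f u @ w" by auto
  moreover obtain y where "f ((u @ v) @ [x]) = f (u @ v) @ [y]"
    using AutT_snoc[OF f, of "u @ v" x] snoc.prems by auto
  ultimately show ?case by simp
qed

lemma section_eq:
  assumes f: "f \<in> carrier (AutT m)" and "u \<in> tree_words m" "v \<in> tree_words m"
  shows "f (u @ v) = f u @ tree_section m f u v"
  using AutT_prefix[OF f, of u v] AutT_length[OF f, of u] assms(2,3)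
  by (auto simp: tree_section_def)

lemma tree_adj_append:
  assumes "u \<in> tree_words m"
  shows "tree_adj m (u @ v) (u @ w) \<longleftrightarrow> tree_adj m v w"
  using assms by (auto simp: tree_adj_def)

lemma section_in_AutT:
  assumes f: "f \<in> carrier (AutT m)" and u: "u \<in> tree_words m"
  shows "tree_section m f u \<in> carrier (AutT m)"
proof (rule AutT_I)
  let ?W = "tree_words m" and ?g = "tree_section m f u"
  note eq = section_eq[OF f u]
  have fu: "f u \<in> ?W" by (rule AutT_words[OF f u])
  have gw: "?g v \<in> ?W" if "v \<in> ?W" for v
    using AutT_words[OF f, of "u @ v"] eq[OF that] u that by simp
  show "bij_betw ?g ?W ?W"
    unfolding bij_betw_def
  proof (intro conjI equalityI subsetI)
    show "inj_on ?g ?W"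
    proof (rule inj_onI)
      fix v w assume "v \<in> ?W" "w \<in> ?W" "?g v = ?g w"
      then show "v = w" using eq[of v] eq[of w] AutT_inj[OF f, of "u @ v" "u @ w"] u by simp
    qed
  next
    fix y assume "y \<in> ?g ` ?W"
    then show "y \<in> ?W" using gw by auto
  next
    fix y assume y: "y \<in> ?W"
    then have "f u @ y \<in> f ` ?W" using fu AutT_D(1)[OF f] by (simp add: bij_betw_def)
    then obtain z where z: "z \<in> ?W" "f z = f u @ y" by auto
    define z1 z2 where "z1 = take (length u) z" and "z2 = drop (length u) z"
    have zz: "z = z1 @ z2" by (simp add: z1_def z2_def)
    have zw: "z1 \<in> ?W" "z2 \<in> ?W" using z(1) zz by auto
    have "length u \<le> length z"
      using AutT_length[OF f z(1)] AutT_length[OF f u] z(2) by simp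
    then have "length (f z1) = length (f u)"
      using AutT_length[OF f zw(1)] AutT_length[OF f u] by (simp add: z1_def)
    moreover have "f z1 @ tree_section m f z1 z2 = f u @ y"
      using section_eq[OF f zw] z(2) zz by simp
    ultimately have e: "f z1 = f u" "tree_section m f z1 z2 = y" by auto
    then have "z1 = u" using AutT_inj[OF f zw(1) u] by simp
    then show "y \<in> ?g ` ?W" using e(2) zw(2) by auto
  qed
  show "?g \<in> extensional ?W" by (simp add: tree_section_def)
  show "?g [] = []" using eq[of "[]"] by simp
  show "tree_adj m (?g v) (?g w) \<longleftrightarrow> tree_adj m v w" if "v \<in> ?W" "w \<in> ?W" for v w
    using AutT_D(4)[OF f, of "u @ v" "u @ w"] u that eq[OF that(1)] eq[OF that(2)]
    by (simp add: tree_adj_append fu)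
qed

lemma kact_length [simp]: "length (kact m v i w) = length w"
  by (induction m v i w rule: kact.induct) auto

lemma kact_words: "w \<in> tree_words m \<Longrightarrow> kact m v i w \<in> tree_words m"
  by (induction m v i w rule: kact.induct) auto

lemma kact_prefix: "\<exists>y. kact m v i (u @ w) = kact m v i u @ y"
  by (induction m v i u rule: kact.induct) auto

lemma succ_mod_inj:
  fixes x y m :: nat
  assumes "x < m" "y < m" "(x + 1) mod m = (y + 1) mod m"
  shows "x = y"
  using assms by (auto simp: mod_if split: if_splits)

lemma kact_inj:
  "u \<in> tree_words m \<Longrightarrow> w \<in> tree_words m \<Longrightarrow> kact m v i u = kact m v i w \<Longrightarrow> u = w"
proof (induction u arbitrary: i w)
  case Nil
  then show ?case using kact_length[of m v i w] by simp
next
  case (Cons x u)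
  obtain y w' where w: "w = y # w'"
    using Cons.prems(3) kact_length[of m v i w] kact_length[of m v i "x # u"] by (cases w) auto
  show ?case
    using Cons succ_mod_inj[of x m y] unfolding w by (cases i) (auto split: if_splits)
qed

lemma kact_surj: "w \<in> tree_words m \<Longrightarrow> \<exists>u\<in>tree_words m. kact m v i u = w"
proof (induction w arbitrary: i)
  case Nil
  show ?case by (intro bexI[of _ "[]"]) auto
next
  case (Cons y w)
  then have y: "y < m" and w: "w \<in> tree_words m" by auto
  show ?case
  proof (cases i)
    case 0
    obtain x where x: "x < m" "(x + 1) mod m = y"
    proof (cases y)
      case 0
      then show thesis using y that[of "m - 1"] by simp
    next
      case (Suc k)
      then show thesis using y that[of k] by simp
    qed
    obtain u where "u \<in> tree_words m" "kact m v (length v) u = w" using Cons.IH w by blast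
    then show ?thesis
      using 0 x w by (intro bexI[of _ "x # (if x = m - 1 then u else w)"]) auto
  next
    case (Suc j)
    obtain u where "u \<in> tree_words m" "kact m v j u = w" using Cons.IH w by blast
    then show ?thesis
      using Suc y w by (intro bexI[of _ "y # (if y = v ! j then u else w)"]) auto
  qed
qed

lemma kgen_in_AutT: "kgen m v i \<in> carrier (AutT m)"
proof (rule AutT_I)
  let ?W = "tree_words m" and ?f = "kgen m v i"
  show "bij_betw ?f ?W ?W"
    unfolding bij_betw_def
  proof (intro conjI equalityI subsetI)
    show "inj_on ?f ?W" using kact_inj by (auto simp: inj_on_def kgen_def)
  next
    fix y assume "y \<in> ?f ` ?W"
    then show "y \<in> ?W" using kact_words by (auto simp: kgen_def)
  next
    fix y assume "y \<in> ?W"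
    then show "y \<in> ?f ` ?W" using kact_surj[of y m v i] by (auto simp: kgen_def image_iff)
  qed
  have parent: "(\<exists>x<m. ?f w = ?f u @ [x]) \<longleftrightarrow> (\<exists>x<m. w = u @ [x])"
    if u: "u \<in> ?W" and w: "w \<in> ?W" for u w
  proof
    assume "\<exists>x<m. w = u @ [x]"
    then obtain x where x: "x < m" "w = u @ [x]" by blast
    obtain y where y: "kact m v i w = kact m v i u @ y" using kact_prefix x by blast
    then have "length y = 1" using kact_length[of m v i w] x by simp
    then obtain z where "y = [z]" by (auto simp: length_Suc_conv)
    then show "\<exists>x<m. ?f w = ?f u @ [x]" using y u w kact_words[OF w, of v i] by (auto simp: kgen_def)
  next
    assume "\<exists>x<m. ?f w = ?f u @ [x]"
    then obtain x where x: "x < m" "kact m v i w = kact m v i u @ [x]"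
      using u w by (auto simp: kgen_def)
    then have "w \<noteq> []" by auto
    then obtain w' z where w': "w = w' @ [z]" by (cases w rule: rev_cases) auto
    obtain y where "kact m v i w = kact m v i w' @ y" using kact_prefix w' by blast
    moreover have "length w = length u + 1"
      using arg_cong[OF x(2), of length] by simp
    ultimately have "kact m v i w' = kact m v i u" using x(2) w' by simp
    then have "w' = u" using kact_inj u w w' by fastforce
    then show "\<exists>x<m. w = u @ [x]" using w w' by auto
  qed
  show "tree_adj m (?f u) (?f w) \<longleftrightarrow> tree_adj m u w" if "u \<in> ?W" "w \<in> ?W" for u w
  proof -
    have "?f u \<in> ?W" "?f w \<in> ?W" using that kact_words by (auto simp: kgen_def)
    then show ?thesis
      using parent[OF that] parent[OF that(2) that(1)] that unfolding tree_adj_def by blast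
  qed
qed (auto simp: kgen_def)

theorem kgen_wreath_0:
  "wreath_form m (kgen m v 0)
     (\<lambda>x. if x = m - 1 then kgen m v (length v) else \<one>\<^bsub>AutT m\<^esub>) (\<lambda>x. (x + 1) mod m)"
  by (auto simp: wreath_form_def tree_section_def kgen_def AutT_def fun_eq_iff)

theorem kgen_wreath_Suc:
  "wreath_form m (kgen m v (Suc i))
     (\<lambda>x. if x = v ! i then kgen m v i else \<one>\<^bsub>AutT m\<^esub>) (\<lambda>x. x)"
  by (auto simp: wreath_form_def tree_section_def kgen_def AutT_def fun_eq_iff)

theorem kgen_unique:
  assumes b: "\<And>i. i \<le> length v \<Longrightarrow> b i \<in> carrier (AutT m)"
    and b0: "wreath_form m (b 0)
      (\<lambda>x. if x = m - 1 then b (length v) else \<one>\<^bsub>AutT m\<^esub>) (\<lambda>x. (x + 1) mod m)"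
    and bS: "\<And>i. i < length v \<Longrightarrow>
      wreath_form m (b (Suc i)) (\<lambda>x. if x = v ! i then b i else \<one>\<^bsub>AutT m\<^esub>) (\<lambda>x. x)"
    and i: "i \<le> length v"
  shows "b i = kgen m v i"
proof -
  have eq: "b i w = kact m v i w" if "w \<in> tree_words m" "i \<le> length v" for w i
    using that
  proof (induction w arbitrary: i)
    case Nil
    then show ?case using AutT_D(3)[OF b] by simp
  next
    case (Cons x w)
    then have x: "x < m" and w: "w \<in> tree_words m" by auto
    have s: "b i (x # w) = b i [x] @ tree_section m (b i) [x] w"
      using section_eq[OF b[OF Cons.prems(2)], of "[x]" w] x w by simp
    have one: "\<one>\<^bsub>AutT m\<^esub> w = w" using w by (simp add: AutT_def)
    show ?case
    proof (cases i)
      case 0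
      then show ?thesis using s x b0 one Cons.IH[OF w, of "length v"]
        by (simp add: wreath_form_def)
    next
      case (Suc j)
      then show ?thesis using s x bS[of j] one Cons.IH[OF w, of j] Cons.prems(2)
        by (simp add: wreath_form_def)
    qed
  qed
  show ?thesis
  proof
    fix w
    show "b i w = kgen m v i w"
      using eq[OF _ i, of w] AutT_D(2)[OF b[OF i]]
      by (cases "w \<in> tree_words m") (auto simp: kgen_def extensional_def)
  qed
qed

lemma KGroup_subgroup: "subgroup (carrier (KGroup m v)) (AutT m)"
  using group.generate_is_subgroup[OF group_AutT, of "kgen m v ` {0..length v}" m] kgen_in_AutT
  by (auto simp: KGroup_def)

lemma group_KGroup: "group (KGroup m v)"
  using subgroup.subgroup_is_group[OF KGroup_subgroup[of m v] group_AutT]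
  by (simp add: KGroup_def)

end

theory Submission
  imports Defs
begin

text \<open>
  Write \<open>G\<close> for the group and \<open>D\<close> for its derived subgroup, and let \<open>M\<close> be a maximal subgroup of
  infinite index. The proof derives a contradiction in three stages.

  \<^emph>\<open>M contains no nontrivial normal subgroup of G.\<close> Copies of \<open>D\<close> below the vertices of the first
  level lie in \<open>D\<close> again (\<open>emb_D\<close>), and copies of the third term of the lower central series lie in
  \<open>D' = [D, D]\<close> (\<open>emb_\<gamma>3\<close>). A nontrivial normal subgroup contains the copies of \<open>D'\<close> below all vertices
  of some level (\<open>normal_contains_powX_D'\<close>). So proper quotients of \<open>G\<close> are virtually nilpotent of
  class two, and in such finitely generated groups maximal subgroups have finite index
  (\<open>maximal_in_virtually_nilpotent\<close>). In other words, \<open>M\<close> is core-free, and \<open>MN = G\<close> for each nontrivial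
  normal subgroup \<open>N\<close>.

  \<^emph>\<open>Sections inherit this.\<close> If \<open>M\<close> is maximal and core-free, then so is the group \<open>proj M x\<close> of the
  sections at a vertex \<open>x\<close> of the first level (\<open>core_free_maximal_proj\<close>). The main point is that \<open>M\<close>
  contains a nontrivial element that acts only below a single vertex of the first level
  (\<open>rigid_nontrivial\<close>). If \<open>proj M x\<close> were \<open>G\<close>, then the elements of this kind in \<open>D\<close> would generate a
  nontrivial normal subgroup of \<open>G\<close> inside \<open>M\<close>.

  \<^emph>\<open>The sections at the vertices t, tt, ttt, ... collect simple words.\<close> As \<open>MD = G\<close>, every
  vector of signs is the vector of exponent sums of a word whose value \<open>g\<close> is in \<open>M\<close>. Then \<open>g\<close> permutes
  the first level cyclically. The section of \<open>g\<^sup>m\<close> at \<open>t\<close> is given by a word that is not longer and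
  whose exponent sums are rotated, and it is shorter if \<open>a\<^sub>0\<close> occurs more than once (\<open>reduce_word\<close>). So
  after some steps there appears a word in which every generator occurs exactly once, with the given
  sign. On the other hand, simple words, in which no generator occurs twice, survive the passage from
  \<open>M\<close> to \<open>proj M t\<close> up to a rotation of the indices (\<open>simple_shift_in_proj\<close>). There are only finitely many
  of them, so one may assume that \<open>M\<close> has as many as possible. Then \<open>M\<close> and \<open>proj M t\<close> have the same
  simple words up to rotation, and for all choices of signs \<open>M\<close> contains a word as above.

  Such a word is a closed path in the coset graph of \<open>M\<close>. Whether it is at the base point just before
  or after a given letter depends only on the letter, not on the word (\<open>prefix_in_iff\<close>, \<open>edge_ends\<close>).
  So the paths run through the same edges, each of them once, and the sign of each edge can be chosen
  freely. A closed path leaves the base point as often as it enters it. Comparing two paths that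
  differ in the direction of one edge shows that an edge that starts at the base point is a loop.
  Hence all generators are in \<open>M\<close> (\<open>not_rich\<close>), which is absurd.

  All this takes place in a group of automorphisms of the tree of all words over \<^typ>\<open>nat\<close>. Restriction
  to the \<open>m\<close>-adic tree maps it onto the group of the theorem, and a maximal subgroup of infinite
  index has a preimage of the same kind.
\<close>

section \<open>Groups\<close>

class group_mult = monoid_mult + inverse +
  assumes inverse_mult_left: "inverse a * a = 1"
begin

lemma inverse_mult_cancel_left: "inverse a * (a * b) = b"
  by (simp add: inverse_mult_left mult.assoc[symmetric])

lemma mult_cancel_left_iff: "a * b = a * c \<longleftrightarrow> b = c"
  by (metis inverse_mult_cancel_left)

lemma inverse_mult_right: "a * inverse a = 1"
  by (metis inverse_mult_cancel_left inverse_mult_left mult_1_right)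

lemma mult_inverse_cancel_left: "a * (inverse a * b) = b"
  by (simp add: inverse_mult_right mult.assoc[symmetric])

lemma inverse_unique_left: "a * b = 1 \<Longrightarrow> inverse a = b"
  by (metis inverse_mult_cancel_left mult_1_right)

lemma inverse_of_inverse: "inverse (inverse a) = a"
  by (rule inverse_unique_left) (rule inverse_mult_left)

lemma inverse_of_mult: "inverse (a * b) = inverse b * inverse a"
  by (rule inverse_unique_left) (simp add: mult.assoc mult_inverse_cancel_left inverse_mult_right)

lemma inverse_of_one: "inverse 1 = 1"
  by (rule inverse_unique_left) simp

lemmas group_simps = mult.assoc inverse_mult_left inverse_mult_right inverse_mult_cancel_left
  mult_inverse_cancel_left inverse_of_inverse inverse_of_mult inverse_of_one

lemma mult_inverse_eq_1_iff: "a * inverse b = 1 \<longleftrightarrow> a = b"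
  by (metis inverse_mult_right inverse_unique_left inverse_of_inverse)

lemma inverse_eq_1_iff: "inverse a = 1 \<longleftrightarrow> a = 1"
  by (metis inverse_of_inverse inverse_of_one)

definition conjug :: "'a \<Rightarrow> 'a \<Rightarrow> 'a" where
  "conjug g k = inverse k * g * k"

definition commut :: "'a \<Rightarrow> 'a \<Rightarrow> 'a" where
  "commut g h = inverse g * inverse h * g * h"

definition subgrp :: "'a set \<Rightarrow> bool" where
  "subgrp H \<longleftrightarrow> 1 \<in> H \<and> (\<forall>g\<in>H. \<forall>h\<in>H. g * h \<in> H) \<and> (\<forall>g\<in>H. inverse g \<in> H)"

definition invariant_under :: "'a set \<Rightarrow> 'a set \<Rightarrow> bool" where
  "invariant_under N G \<longleftrightarrow> (\<forall>n\<in>N. \<forall>g\<in>G. conjug n g \<in> N)"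

definition normal_in :: "'a set \<Rightarrow> 'a set \<Rightarrow> bool" where
  "normal_in N G \<longleftrightarrow> subgrp N \<and> N \<subseteq> G \<and> invariant_under N G"

end

inductive_set gen_by :: "'a::group_mult set \<Rightarrow> 'a set" for E where
  gen_one: "1 \<in> gen_by E"
| gen_base: "e \<in> E \<Longrightarrow> e \<in> gen_by E"
| gen_mult: "g \<in> gen_by E \<Longrightarrow> h \<in> gen_by E \<Longrightarrow> g * h \<in> gen_by E"
| gen_inverse: "g \<in> gen_by E \<Longrightarrow> inverse g \<in> gen_by E"

definition commut_subgrp :: "'a::group_mult set \<Rightarrow> 'a set \<Rightarrow> 'a set" where
  "commut_subgrp A B = gen_by {commut a b |a b. a \<in> A \<and> b \<in> B}"

subsection \<open>Subgroups\<close>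

lemma subgrpI:
  assumes "1 \<in> H" "\<And>g h. g \<in> H \<Longrightarrow> h \<in> H \<Longrightarrow> g * h \<in> H" "\<And>g. g \<in> H \<Longrightarrow> inverse g \<in> H"
  shows "subgrp H"
  using assms by (auto simp: subgrp_def)

lemma subgrp_one: "subgrp H \<Longrightarrow> 1 \<in> H"
  and subgrp_mult: "subgrp H \<Longrightarrow> g \<in> H \<Longrightarrow> h \<in> H \<Longrightarrow> g * h \<in> H"
  and subgrp_inverse: "subgrp H \<Longrightarrow> g \<in> H \<Longrightarrow> inverse g \<in> H"
  by (auto simp: subgrp_def)

lemma subgrp_power: "subgrp H \<Longrightarrow> g \<in> H \<Longrightarrow> g ^ n \<in> H"
  by (induction n) (auto simp: subgrp_one subgrp_mult)

lemma subgrp_prod_list: "subgrp H \<Longrightarrow> set xs \<subseteq> H \<Longrightarrow> prod_list xs \<in> H"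
  by (induction xs) (auto simp: subgrp_one subgrp_mult)

lemma subgrp_conjug: "subgrp H \<Longrightarrow> g \<in> H \<Longrightarrow> k \<in> H \<Longrightarrow> conjug g k \<in> H"
  by (simp add: conjug_def subgrp_mult subgrp_inverse)

lemma subgrp_commut: "subgrp H \<Longrightarrow> g \<in> H \<Longrightarrow> h \<in> H \<Longrightarrow> commut g h \<in> H"
  by (simp add: commut_def subgrp_mult subgrp_inverse)

lemmas subgrp_intros = subgrp_one subgrp_mult subgrp_inverse subgrp_conjug subgrp_commut

lemma subgrp_mult_right_iff: "subgrp H \<Longrightarrow> h \<in> H \<Longrightarrow> g * h \<in> H \<longleftrightarrow> g \<in> H"
  using subgrp_mult[of H "g * h" "inverse h"] subgrp_mult[of H g h] subgrp_inverse[of H h]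
  by (auto simp: group_simps)

lemma subgrp_mult_left_iff: "subgrp H \<Longrightarrow> h \<in> H \<Longrightarrow> h * g \<in> H \<longleftrightarrow> g \<in> H"
  using subgrp_mult[of H "inverse h" "h * g"] subgrp_mult[of H h g] subgrp_inverse[of H h]
  by (auto simp: group_simps)

lemma subgrp_inverse_iff: "subgrp H \<Longrightarrow> inverse g \<in> H \<longleftrightarrow> g \<in> H"
  by (metis subgrp_inverse inverse_of_inverse)

lemma subgrp_Int: "subgrp H \<Longrightarrow> subgrp K \<Longrightarrow> subgrp (H \<inter> K)"
  by (auto simp: subgrp_def)

lemma subgrp_gen_by: "subgrp (gen_by E)"
  by (rule subgrpI) (auto intro: gen_one gen_mult gen_inverse)

lemma gen_by_subset: 
  assumes "subgrp H" "E \<subseteq> H"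
  shows "gen_by E \<subseteq> H"
proof
  fix x assume "x \<in> gen_by E"
  then show "x \<in> H" by induction (use assms in \<open>auto simp: subgrp_intros\<close>)
qed

lemma gen_by_superset: "E \<subseteq> gen_by E"
  by (auto intro: gen_base)

lemma gen_by_mono: "E \<subseteq> F \<Longrightarrow> gen_by E \<subseteq> gen_by F"
  using gen_by_superset[of F] by (intro gen_by_subset subgrp_gen_by) auto

subsection \<open>Conjugation and normal subgroups\<close>

lemma conjug_one [simp]: "conjug 1 k = 1" "conjug g 1 = g"
  by (simp_all add: conjug_def group_simps)

lemma conjug_mult: "conjug (g * h) k = conjug g k * conjug h k"
  by (simp add: conjug_def group_simps)

lemma conjug_inverse: "conjug (inverse g) k = inverse (conjug g k)"
  by (simp add: conjug_def group_simps)

lemma conjug_conjug: "conjug (conjug g k) l = conjug g (k * l)"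
  by (simp add: conjug_def group_simps)

lemma conjug_inverse_cancel [simp]: "conjug (conjug g k) (inverse k) = g"
  "conjug (conjug g (inverse k)) k = g"
  by (simp_all add: conjug_def group_simps)

lemma conjug_eq_1_iff: "conjug g k = 1 \<longleftrightarrow> g = 1"
  by (metis conjug_inverse_cancel(1) conjug_one(1))

lemma conjug_commut: "conjug (commut g h) k = commut (conjug g k) (conjug h k)"
  by (simp add: conjug_def commut_def group_simps)

lemma conjug_as_commut: "conjug g k = g * commut g k"
  by (simp add: conjug_def commut_def group_simps)

lemma commut_one [simp]: "commut 1 h = 1" "commut g 1 = 1"
  by (simp_all add: commut_def group_simps)

lemma commut_self [simp]: "commut g g = 1"
  by (simp add: commut_def group_simps)

lemma inverse_commut: "inverse (commut g h) = commut h g"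
  by (simp add: commut_def group_simps)

lemma commut_eq_1_iff: "commut g h = 1 \<longleftrightarrow> g * h = h * g"
proof -
  have "commut g h = inverse (h * g) * (g * h)" by (simp add: commut_def group_simps)
  then show ?thesis
    by (metis inverse_mult_left mult_cancel_left_iff)
qed

lemma commut_mult_right: "commut g (h * k) = commut g k * conjug (commut g h) k"
  by (simp add: conjug_def commut_def group_simps)

lemma commut_mult_left: "commut (g * h) k = conjug (commut g k) h * commut h k"
  by (simp add: conjug_def commut_def group_simps)

lemma commut_inverse_right: "commut g (inverse h) = conjug (inverse (commut g h)) (inverse h)"
  by (simp add: conjug_def commut_def group_simps)

lemma commut_inverse_left: "commut (inverse g) h = conjug (inverse (commut g h)) (inverse g)"
  by (simp add: conjug_def commut_def group_simps)

lemma Hall_Witt: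
  fixes x y z :: "'a::group_mult"
  shows "conjug (commut (commut x (inverse y)) z) y * conjug (commut (commut y (inverse z)) x) z *
    conjug (commut (commut z (inverse x)) y) x = 1"
  by (simp add: conjug_def commut_def group_simps)

lemma invariant_underD: "invariant_under N G \<Longrightarrow> n \<in> N \<Longrightarrow> g \<in> G \<Longrightarrow> conjug n g \<in> N"
  by (simp add: invariant_under_def)

lemma normal_inD:
  assumes "normal_in N G"
  shows "subgrp N" "N \<subseteq> G" "\<And>n g. n \<in> N \<Longrightarrow> g \<in> G \<Longrightarrow> conjug n g \<in> N"
  using assms by (auto simp: normal_in_def invariant_under_def)

lemma normal_inI:
  assumes "subgrp N" "N \<subseteq> G" "\<And>n g. n \<in> N \<Longrightarrow> g \<in> G \<Longrightarrow> conjug n g \<in> N"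
  shows "normal_in N G"
  using assms by (auto simp: normal_in_def invariant_under_def)

lemma normal_in_commut:
  assumes "normal_in N G" "subgrp G" "n \<in> N" "g \<in> G"
  shows "commut n g \<in> N" "commut g n \<in> N"
proof -
  have "commut n g = inverse n * conjug n g" by (simp add: commut_def conjug_def group_simps)
  then show "commut n g \<in> N" using assms normal_inD[OF assms(1)] by (simp add: subgrp_intros)
  then show "commut g n \<in> N"
    using normal_inD(1)[OF assms(1)] subgrp_inverse inverse_commut by metis
qed

lemma normal_in_self: "subgrp G \<Longrightarrow> normal_in G G"
  by (auto intro: normal_inI subgrp_conjug)

lemma normal_in_Int: "normal_in N G \<Longrightarrow> normal_in K G \<Longrightarrow> normal_in (N \<inter> K) G"
  by (auto simp: normal_in_def invariant_under_def subgrp_Int)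

lemma conjug_gen_by:
  assumes "x \<in> gen_by E" "\<And>e. e \<in> E \<Longrightarrow> conjug e k \<in> gen_by E"
  shows "conjug x k \<in> gen_by E"
  using assms by (induction) (auto simp: conjug_mult conjug_inverse intro: gen_by.intros)

lemma commut_subgrp_base: "a \<in> A \<Longrightarrow> b \<in> B \<Longrightarrow> commut a b \<in> commut_subgrp A B"
  unfolding commut_subgrp_def by (rule gen_base) auto

lemma subgrp_commut_subgrp: "subgrp (commut_subgrp A B)"
  by (simp add: commut_subgrp_def subgrp_gen_by)

lemma commut_subgrp_least:
  assumes "subgrp H" "\<And>a b. a \<in> A \<Longrightarrow> b \<in> B \<Longrightarrow> commut a b \<in> H"
  shows "commut_subgrp A B \<subseteq> H"
  unfolding commut_subgrp_def by (rule gen_by_subset) (use assms in auto)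

lemma commut_subgrp_mono: "A \<subseteq> A' \<Longrightarrow> B \<subseteq> B' \<Longrightarrow> commut_subgrp A B \<subseteq> commut_subgrp A' B'"
  by (rule commut_subgrp_least) (auto intro: subgrp_commut_subgrp commut_subgrp_base)

lemma normal_in_commut_subgrp:
  assumes "normal_in A G" "normal_in B G" "subgrp G"
  shows "normal_in (commut_subgrp A B) G"
proof (rule normal_inI[OF subgrp_commut_subgrp])
  show "commut_subgrp A B \<subseteq> G"
    using assms normal_inD(2) by (intro commut_subgrp_least) (auto intro!: subgrp_commut)
  show "conjug n g \<in> commut_subgrp A B" if "n \<in> commut_subgrp A B" "g \<in> G" for n g
    using that(1) unfolding commut_subgrp_def
  proof (rule conjug_gen_by)
    fix e assume "e \<in> {commut a b |a b. a \<in> A \<and> b \<in> B}"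
    then show "conjug e g \<in> gen_by {commut a b |a b. a \<in> A \<and> b \<in> B}"
      using commut_subgrp_base[of _ A _ B] normal_inD(3)[OF assms(1) _ that(2)]
        normal_inD(3)[OF assms(2) _ that(2)]
      by (auto simp: conjug_commut commut_subgrp_def)
  qed
qed

text \<open>Centralizers modulo a normal subgroup are subgroups, so that commutator conditions only
  have to be tested on generators.\<close>

lemma subgrp_commut_right:
  assumes "normal_in B G" "subgrp G" "g \<in> G"
  shows "subgrp {h \<in> G. commut g h \<in> B}"
  using assms normal_inD[OF assms(1)]
  by (intro subgrpI) (auto simp: subgrp_intros commut_mult_right commut_inverse_right)

lemma subgrp_commut_left:
  assumes "normal_in B G" "subgrp G" "h \<in> G"
  shows "subgrp {g \<in> G. commut g h \<in> B}"
  using assms normal_inD[OF assms(1)]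
  by (intro subgrpI) (auto simp: subgrp_intros commut_mult_left commut_inverse_left)

lemma commut_subgrp_gen_by:
  assumes B: "normal_in B G" and G: "G = gen_by E"
    and E: "\<And>a b. a \<in> E \<Longrightarrow> b \<in> E \<Longrightarrow> commut a b \<in> B"
  shows "commut_subgrp G G \<subseteq> B"
proof -
  have sG: "subgrp G" by (simp add: G subgrp_gen_by)
  have EG: "E \<subseteq> G" by (simp add: G gen_by_superset)
  have 1: "commut a h \<in> B" if a: "a \<in> E" and h: "h \<in> G" for a h
  proof -
    have "gen_by E \<subseteq> {h \<in> G. commut a h \<in> B}"
      using subgrp_commut_right[OF B sG] a E EG by (intro gen_by_subset) auto
    then show ?thesis using h G by auto
  qed
  have "commut g h \<in> B" if g: "g \<in> G" and h: "h \<in> G" for g h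
  proof -
    have "gen_by E \<subseteq> {g \<in> G. commut g h \<in> B}"
      using subgrp_commut_left[OF B sG] h EG 1 by (intro gen_by_subset) auto
    then show ?thesis using g G by auto
  qed
  then show ?thesis using normal_inD(1)[OF B] by (intro commut_subgrp_least)
qed

subsection \<open>Finite index\<close>

definition right_coset :: "'a::group_mult set \<Rightarrow> 'a \<Rightarrow> 'a set" where
  "right_coset H g = (\<lambda>h. h * g) ` H"

definition finite_index :: "'a::group_mult set \<Rightarrow> 'a set \<Rightarrow> bool" where
  "finite_index H G \<longleftrightarrow> finite (right_coset H ` G)"

lemma right_coset_eq_iff:
  assumes "subgrp H"
  shows "right_coset H g = right_coset H h \<longleftrightarrow> g * inverse h \<in> H"
proof
  assume "right_coset H g = right_coset H h"
  moreover have "g \<in> right_coset H g"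
    using assms by (auto simp: right_coset_def image_iff subgrp_one intro: bexI[of _ 1])
  ultimately obtain k where "k \<in> H" "g = k * h" by (auto simp: right_coset_def)
  then show "g * inverse h \<in> H" by (simp add: group_simps)
next
  assume a: "g * inverse h \<in> H"
  have "k * g \<in> right_coset H h" if "k \<in> H" for k
    using that a assms unfolding right_coset_def
    by (intro image_eqI[of _ _ "k * (g * inverse h)"]) (auto simp: group_simps intro: subgrp_mult)
  moreover have "k * h \<in> right_coset H g" if "k \<in> H" for k
    using that subgrp_inverse[OF assms a] assms unfolding right_coset_def
    by (intro image_eqI[of _ _ "k * inverse (g * inverse h)"]) (auto simp: group_simps subgrp_mult)
  ultimately show "right_coset H g = right_coset H h" by (auto simp: right_coset_def)
qed

lemma finite_indexI:
  assumes "subgrp H" "finite (f ` G)"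
    and "\<And>g h. g \<in> G \<Longrightarrow> h \<in> G \<Longrightarrow> f g = f h \<Longrightarrow> g * inverse h \<in> H"
  shows "finite_index H G"
proof -
  have "right_coset H g = right_coset H (inv_into G f (f g))" if "g \<in> G" for g
    using assms(3)[OF that, of "inv_into G f (f g)"] that
    by (simp add: right_coset_eq_iff[OF assms(1)] f_inv_into_f inv_into_into)
  then have "right_coset H ` G \<subseteq> (\<lambda>y. right_coset H (inv_into G f y)) ` f ` G" by auto
  then show ?thesis unfolding finite_index_def using assms(2) finite_surj by blast
qed

lemma finite_index_reps:
  assumes "subgrp H" "finite_index H G"
  obtains R where "finite R" "R \<subseteq> G" "\<And>g. g \<in> G \<Longrightarrow> \<exists>r\<in>R. g * inverse r \<in> H"
proof -
  obtain R where "R \<subseteq> G" "finite R" "right_coset H ` G = right_coset H ` R"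
    using assms(2) finite_subset_image[of "right_coset H ` G" "right_coset H" G]
    by (auto simp: finite_index_def)
  moreover have "\<exists>r\<in>R. g * inverse r \<in> H" if "g \<in> G" for g
  proof -
    have "right_coset H g \<in> right_coset H ` R"
      using that \<open>right_coset H ` G = right_coset H ` R\<close> by blast
    then show ?thesis using right_coset_eq_iff[OF assms(1)] by blast
  qed
  ultimately show thesis using that by blast
qed

lemma finite_index_of_reps:
  assumes H: "subgrp H" and R: "finite R" "\<And>g. g \<in> G \<Longrightarrow> \<exists>r\<in>R. g * inverse r \<in> H"
  shows "finite_index H G"
proof -
  have "right_coset H ` G \<subseteq> right_coset H ` R"
    using R(2) right_coset_eq_iff[OF H] by blast
  then show ?thesis using R(1) finite_surj unfolding finite_index_def by blast
qed

lemma finite_index_subset: "finite_index H G \<Longrightarrow> K \<subseteq> G \<Longrightarrow> finite_index H K"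
  unfolding finite_index_def by (meson finite_subset image_mono)

lemma finite_index_mono:
  assumes "subgrp H" "subgrp K" "finite_index H G" "H \<subseteq> K"
  shows "finite_index K G"
proof -
  obtain R where "finite R" "\<And>g. g \<in> G \<Longrightarrow> \<exists>r\<in>R. g * inverse r \<in> H"
    using finite_index_reps[OF assms(1,3)] by metis
  then show ?thesis using finite_index_of_reps[OF assms(2), of R G] assms(4) by blast
qed

section \<open>Maximal subgroups of virtually nilpotent groups\<close>

definition maximal_in :: "'a::group_mult set \<Rightarrow> 'a set \<Rightarrow> bool" where
  "maximal_in M G \<longleftrightarrow> subgrp M \<and> M \<subset> G \<and> (\<forall>H. subgrp H \<longrightarrow> M \<subseteq> H \<longrightarrow> H \<subseteq> G \<longrightarrow> H = M \<or> H = G)"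

lemma maximal_inD:
  assumes "maximal_in M G"
  shows "subgrp M" "M \<subseteq> G" "M \<noteq> G"
    "\<And>H. subgrp H \<Longrightarrow> M \<subseteq> H \<Longrightarrow> H \<subseteq> G \<Longrightarrow> H = M \<or> H = G"
  using assms by (auto simp: maximal_in_def)

lemma subgrp_product:
  assumes "subgrp M" "subgrp A" "invariant_under A M"
  shows "subgrp {m * a |m a. m \<in> M \<and> a \<in> A}"
proof (rule subgrpI)
  show "1 \<in> {m * a |m a. m \<in> M \<and> a \<in> A}"
    using assms subgrp_one by force
next
  fix g h assume "g \<in> {m * a |m a. m \<in> M \<and> a \<in> A}" "h \<in> {m * a |m a. m \<in> M \<and> a \<in> A}"
  then obtain m a n b where *: "g = m * a" "h = n * b" "m \<in> M" "a \<in> A" "n \<in> M" "b \<in> A" by auto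
  then have "g * h = (m * n) * (conjug a n * b)" by (simp add: conjug_def group_simps)
  then show "g * h \<in> {m * a |m a. m \<in> M \<and> a \<in> A}"
    using * assms invariant_underD[OF assms(3)] subgrp_mult by blast
next
  fix g assume "g \<in> {m * a |m a. m \<in> M \<and> a \<in> A}"
  then obtain m a where *: "g = m * a" "m \<in> M" "a \<in> A" by auto
  then have "inverse g = inverse m * conjug (inverse a) (inverse m)"
    by (simp add: conjug_def group_simps)
  then show "inverse g \<in> {m * a |m a. m \<in> M \<and> a \<in> A}"
    using * assms invariant_underD[OF assms(3)] subgrp_inverse by blast
qed

lemma maximal_in_product:
  assumes M: "maximal_in M G" and G: "subgrp G" and A: "subgrp A" "A \<subseteq> G" "invariant_under A M"
    and AM: "\<not> A \<subseteq> M" and g: "g \<in> G"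
  obtains m a where "m \<in> M" "a \<in> A" "g = m * a"
proof -
  let ?H = "{m * a |m a. m \<in> M \<and> a \<in> A}"
  note sM = maximal_inD(1,2)[OF M]
  have "subgrp ?H" by (rule subgrp_product[OF sM(1) A(1,3)])
  moreover have "M \<subseteq> ?H" "A \<subseteq> ?H"
    using subgrp_one[OF A(1)] subgrp_one[OF sM(1)] by force+
  moreover have "?H \<subseteq> G" using A sM G by (auto intro!: subgrp_mult)
  ultimately have "?H = M \<or> ?H = G" by (intro maximal_inD(4)[OF M]) auto
  moreover have "?H \<noteq> M" using \<open>A \<subseteq> ?H\<close> AM by auto
  ultimately have "?H = G" by simp
  then show thesis using g that by blast
qed

text \<open>
  Since \<open>G = MN\<close>, representatives of \<open>M \<inter> N\<close> in \<open>N\<close> are representatives of \<open>M\<close> in \<open>G\<close>.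
\<close>

lemma finite_index_maximal:
  assumes M: "maximal_in M G" and G: "subgrp G" and N: "normal_in N G" and NM: "\<not> N \<subseteq> M"
    and fin: "finite_index (M \<inter> N) N"
  shows "finite_index M G"
proof -
  note sM = maximal_inD(1)[OF M]
  have sT: "subgrp (M \<inter> N)" using sM normal_inD[OF N] by (intro subgrp_Int)
  note MG = maximal_inD(2)[OF M]
  obtain R where R: "finite R" "\<And>g. g \<in> N \<Longrightarrow> \<exists>r\<in>R. g * inverse r \<in> M \<inter> N"
    using finite_index_reps[OF sT fin] by metis
  have "\<exists>r\<in>R. g * inverse r \<in> M" if gG: "g \<in> G" for g
  proof -
    have iu: "invariant_under N M" using N MG by (auto simp: normal_in_def invariant_under_def)
    obtain m a where ma: "m \<in> M" "a \<in> N" "g = m * a"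
      by (rule maximal_in_product[OF M G normal_inD(1,2)[OF N] iu NM gG])
    obtain r where "r \<in> R" "a * inverse r \<in> M" using R(2)[OF ma(2)] by auto
    then have "g * inverse r \<in> M" using ma subgrp_mult[OF sM] by (simp add: mult.assoc)
    then show ?thesis using \<open>r \<in> R\<close> by blast
  qed
  then show ?thesis by (rule finite_index_of_reps[OF sM R(1)])
qed

lemma gen_by_insert: "gen_by (T \<union> insert f F) = gen_by (gen_by (insert f T) \<union> F)"
proof
  have "insert f T \<subseteq> gen_by (insert f T)" by (rule gen_by_superset)
  then show "gen_by (T \<union> insert f F) \<subseteq> gen_by (gen_by (insert f T) \<union> F)"
    by (intro gen_by_mono) auto
  show "gen_by (gen_by (insert f T) \<union> F) \<subseteq> gen_by (T \<union> insert f F)"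
    using gen_by_mono[of "insert f T" "T \<union> insert f F"] gen_by_superset[of "T \<union> insert f F"]
    by (intro gen_by_subset subgrp_gen_by) auto
qed

lemma normal_in_of_commut:
  assumes "subgrp S" "subgrp T" "T \<subseteq> S" "\<And>x y. x \<in> S \<Longrightarrow> y \<in> S \<Longrightarrow> commut x y \<in> T"
  shows "normal_in T S"
  using assms by (intro normal_inI) (auto simp: conjug_as_commut intro!: subgrp_mult)

text \<open>
  For \<open>P\<close> the powers of \<open>f\<close> this is the subgroup generated by \<open>T\<close> and \<open>f\<close>. From \<open>x * p \<in> T\<close> and
  \<open>y * q \<in> T\<close> one gets \<open>x * y * (q * p) \<in> T\<close> because \<open>T\<close> is normal.
\<close>

lemma subgrp_cyclic_extension:
  assumes S: "subgrp S" and T: "normal_in T S" and P: "subgrp P" "P \<subseteq> S"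
    and comm: "\<And>p q. p \<in> P \<Longrightarrow> q \<in> P \<Longrightarrow> p * q = q * p"
  shows "subgrp {x \<in> S. \<exists>p\<in>P. x * p \<in> T}"
proof (rule subgrpI)
  note nT = normal_inD[OF T]
  show "1 \<in> {x \<in> S. \<exists>p\<in>P. x * p \<in> T}"
    using S P nT by (auto simp: subgrp_one intro: bexI[of _ 1])
next
  note nT = normal_inD[OF T]
  fix g h assume "g \<in> {x \<in> S. \<exists>p\<in>P. x * p \<in> T}" "h \<in> {x \<in> S. \<exists>p\<in>P. x * p \<in> T}"
  then obtain p q where *: "g \<in> S" "h \<in> S" "p \<in> P" "q \<in> P" "g * p \<in> T" "h * q \<in> T" by auto
  have "(g * h) * (q * p) = (g * p) * conjug (h * q) p"
    by (simp add: conjug_def group_simps)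
  moreover have "conjug (h * q) p \<in> T" using nT(3) * P by auto
  ultimately have "(g * h) * (q * p) \<in> T" using * subgrp_mult[OF nT(1)] by simp
  then show "g * h \<in> {x \<in> S. \<exists>p\<in>P. x * p \<in> T}"
    using * S P by (auto intro!: bexI[of _ "q * p"] subgrp_mult)
next
  note nT = normal_inD[OF T]
  fix g assume "g \<in> {x \<in> S. \<exists>p\<in>P. x * p \<in> T}"
  then obtain p where *: "g \<in> S" "p \<in> P" "g * p \<in> T" by auto
  have "inverse g * inverse p = conjug (inverse (g * p)) (inverse p)"
    by (simp add: conjug_def group_simps)
  moreover have "conjug (inverse (g * p)) (inverse p) \<in> T"
    using * P nT subgrp_inverse by blast
  ultimately show "inverse g \<in> {x \<in> S. \<exists>p\<in>P. x * p \<in> T}"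
    using * S P by (auto intro!: bexI[of _ "inverse p"] subgrp_inverse)
qed

text \<open>
  The powers with integer exponents, written as quotients of powers with natural exponents.
\<close>

definition cyclic_powers :: "'a::group_mult \<Rightarrow> 'a set" where
  "cyclic_powers f = {f ^ n * inverse (f ^ k) |n k. True}"

lemma inverse_commute: "(a::'a::group_mult) * b = b * a \<Longrightarrow> a * inverse b = inverse b * a"
  by (metis inverse_mult_cancel_left inverse_mult_right mult.assoc mult_1_right)

lemma cyclic_powers_mult:
  fixes f :: "'a::group_mult"
  shows "(f ^ n * inverse (f ^ k)) * (f ^ n' * inverse (f ^ k')) = f ^ (n + n') * inverse (f ^ (k + k'))"
proof -
  have "f ^ n' * f ^ k = f ^ k * f ^ n'" by (simp only: power_add[symmetric] add.commute)
  then have c: "inverse (f ^ k) * f ^ n' = f ^ n' * inverse (f ^ k)" by (simp only: inverse_commute)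
  have "inverse (f ^ k) * (f ^ n' * inverse (f ^ k')) = f ^ n' * (inverse (f ^ k) * inverse (f ^ k'))"
    unfolding mult.assoc[symmetric] c ..
  moreover have "inverse (f ^ k) * inverse (f ^ k') = inverse (f ^ (k + k'))"
    by (simp only: inverse_of_mult[symmetric] power_add[symmetric] add.commute)
  ultimately show ?thesis by (simp only: power_add mult.assoc)
qed

lemma subgrp_cyclic_powers: "subgrp (cyclic_powers f)"
  and cyclic_powers_commute: "p \<in> cyclic_powers f \<Longrightarrow> q \<in> cyclic_powers f \<Longrightarrow> p * q = q * p"
proof -
  show "subgrp (cyclic_powers f)"
  proof (rule subgrpI)
    show "1 \<in> cyclic_powers f"
      unfolding cyclic_powers_def by (auto simp: group_simps intro!: exI[of _ 0])
    show "g * h \<in> cyclic_powers f" if "g \<in> cyclic_powers f" "h \<in> cyclic_powers f" for g h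
      using that unfolding cyclic_powers_def by clarsimp (metis cyclic_powers_mult)
    show "inverse g \<in> cyclic_powers f" if "g \<in> cyclic_powers f" for g
      using that unfolding cyclic_powers_def by (clarsimp simp: group_simps) blast
  qed
  show "p \<in> cyclic_powers f \<Longrightarrow> q \<in> cyclic_powers f \<Longrightarrow> p * q = q * p"
    unfolding cyclic_powers_def by (auto simp: cyclic_powers_mult add.commute)
qed

lemma inverse_in_cyclic_powers: "inverse f \<in> cyclic_powers f"
proof -
  have "inverse f = f ^ 0 * inverse (f ^ 1)" by simp
  then show ?thesis unfolding cyclic_powers_def by blast
qed

lemma cyclic_powers_subset: "subgrp S \<Longrightarrow> f \<in> S \<Longrightarrow> cyclic_powers f \<subseteq> S"
  by (auto simp: cyclic_powers_def subgrp_power intro!: subgrp_mult subgrp_inverse)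

lemma gen_by_cyclic_extension:
  assumes S: "subgrp S" and T: "normal_in T S" and f: "f \<in> S" and x: "x \<in> gen_by (insert f T)"
  shows "\<exists>n k. x * (f ^ n * inverse (f ^ k)) \<in> T"
proof -
  let ?E = "{x \<in> S. \<exists>p\<in>cyclic_powers f. x * p \<in> T}"
  note nT = normal_inD[OF T]
  have "subgrp ?E"
    by (rule subgrp_cyclic_extension[OF S T subgrp_cyclic_powers cyclic_powers_subset[OF S f]])
       (rule cyclic_powers_commute)
  moreover have "f \<in> ?E"
    using f nT(1) inverse_in_cyclic_powers[of f]
    by (auto simp: inverse_mult_right subgrp_one intro!: bexI[of _ "inverse f"])
  moreover have "T \<subseteq> ?E"
    using nT(2) subgrp_one[OF subgrp_cyclic_powers[of f]] by (auto intro!: bexI[of _ 1])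
  ultimately have "gen_by (insert f T) \<subseteq> ?E" by (intro gen_by_subset) auto
  then have "\<exists>p\<in>cyclic_powers f. x * p \<in> T" using x by auto
  then show ?thesis by (auto simp: cyclic_powers_def)
qed

text \<open>
  A finitely generated abelian group \<open>S/T\<close> of finite exponent is finite: add one generator at a time.
  Each of them contributes at most \<open>r\<^sup>2\<close> representatives \<open>f\<^sup>j f\<^sup>-\<^sup>i\<close>.
\<close>

lemma abelian_finite_exponent:
  assumes "finite F"
  shows "subgrp S \<Longrightarrow> subgrp T \<Longrightarrow> T \<subseteq> S \<Longrightarrow> (\<And>x y. x \<in> S \<Longrightarrow> y \<in> S \<Longrightarrow> commut x y \<in> T)
    \<Longrightarrow> S = gen_by (T \<union> F) \<Longrightarrow> r \<ge> 1 \<Longrightarrow> (\<And>x. x \<in> S \<Longrightarrow> x ^ r \<in> T) \<Longrightarrow> finite_index T S"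
  using assms
proof (induction F arbitrary: T rule: finite_induct)
  case empty
  then have "S = T" using gen_by_subset[of T "T \<union> {}"] gen_by_superset[of "T \<union> {}"] by auto
  then show ?case using empty.prems(2)
    by (intro finite_indexI[where f = "\<lambda>_. ()"]) (auto intro!: subgrp_mult subgrp_inverse)
next
  case (insert f F)
  note S = insert.prems(1) and T = insert.prems(2) and TS = insert.prems(3) and r = insert.prems(6)
  let ?T1 = "gen_by (insert f T)"
  have fS: "f \<in> S" unfolding insert.prems(5) by (rule gen_base) simp
  have nT: "normal_in T S" by (rule normal_in_of_commut[OF S T TS insert.prems(4)])
  have TT1: "T \<subseteq> ?T1" using gen_by_superset[of "insert f T"] by auto
  have T1S: "?T1 \<subseteq> S" using fS TS by (intro gen_by_subset S) auto
  have S_eq: "S = gen_by (?T1 \<union> F)" using insert.prems(5) by (simp only: gen_by_insert)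
  have "finite_index ?T1 S"
    by (rule insert.IH[OF S subgrp_gen_by T1S _ S_eq r]) (use insert.prems(4,7) TT1 in blast)+
  then obtain R where R: "finite R" "R \<subseteq> S" "\<And>g. g \<in> S \<Longrightarrow> \<exists>r\<in>R. g * inverse r \<in> ?T1"
    using finite_index_reps[OF subgrp_gen_by] by metis
  let ?R = "(\<lambda>(i, j, y). f ^ j * inverse (f ^ i) * y) ` ({..<r} \<times> {..<r} \<times> R)"
  have "\<exists>y\<in>?R. g * inverse y \<in> T" if g: "g \<in> S" for g
  proof -
    obtain y where y: "y \<in> R" "g * inverse y \<in> ?T1" using R(3)[OF g] by auto
    then obtain n k where nk: "g * inverse y * (f ^ n * inverse (f ^ k)) \<in> T"
      using gen_by_cyclic_extension[OF S nT fS y(2)] by auto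
    define i j where "i = n mod r" and "j = k mod r"
    have "f ^ n = f ^ i * (f ^ (n div r)) ^ r" "f ^ k = f ^ j * (f ^ (k div r)) ^ r"
      by (simp_all add: i_def j_def power_mult[symmetric] power_add[symmetric] mult.commute)
    then obtain u v where uv: "u \<in> T" "v \<in> T" "f ^ n = f ^ i * u" "f ^ k = f ^ j * v"
      using insert.prems(7)[OF subgrp_power[OF S fS]] by metis
    have fj: "f ^ j \<in> S" by (rule subgrp_power[OF S fS])
    have "g * inverse y * (f ^ i * inverse (f ^ j))
      = (g * inverse y * (f ^ n * inverse (f ^ k))) * conjug (v * inverse u) (inverse (f ^ j))"
      by (simp add: uv conjug_def group_simps)
    moreover have "conjug (v * inverse u) (inverse (f ^ j)) \<in> T"
      using uv T fj S by (intro normal_inD(3)[OF nT]) (auto simp: subgrp_intros)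
    ultimately have "g * inverse y * (f ^ i * inverse (f ^ j)) \<in> T"
      using nk subgrp_mult[OF T] by metis
    then have "g * inverse (f ^ j * inverse (f ^ i) * y) \<in> T" by (simp add: group_simps)
    moreover have "i < r" "j < r" using r by (simp_all add: i_def j_def)
    ultimately show ?thesis using y(1) by (intro bexI) (auto intro!: image_eqI[of _ _ "(i, j, y)"])
  qed
  then show ?case using R(1) by (intro finite_index_of_reps[OF T, of ?R]) auto
qed

text \<open>
  A finitely generated divisible abelian group \<open>S/T\<close> is trivial. By induction the group generated by \<open>T\<close>
  and one generator \<open>f\<close> is everything. Divisibility by 2 makes \<open>f\<close> an even power of itself, so \<open>f\<close> has
  a finite order \<open>r\<close>, and then divisibility by \<open>r\<close> makes the group trivial.
\<close>

lemma abelian_divisible_trivial: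
  assumes "finite F"
  shows "subgrp S \<Longrightarrow> subgrp T \<Longrightarrow> T \<subseteq> S \<Longrightarrow> (\<And>x y. x \<in> S \<Longrightarrow> y \<in> S \<Longrightarrow> commut x y \<in> T)
    \<Longrightarrow> S = gen_by (T \<union> F) \<Longrightarrow> (\<And>r. r \<ge> 1 \<Longrightarrow> S = gen_by (T \<union> (\<lambda>x. x ^ r) ` S)) \<Longrightarrow> S = T"
  using assms
proof (induction F arbitrary: T rule: finite_induct)
  case empty
  then show ?case using gen_by_subset[of T "T \<union> {}"] by auto
next
  case (insert f F)
  note S = insert.prems(1) and T = insert.prems(2) and TS = insert.prems(3)
  let ?T1 = "gen_by (insert f T)"
  have fS: "f \<in> S" unfolding insert.prems(5) by (rule gen_base) simp
  have nT: "normal_in T S" by (rule normal_in_of_commut[OF S T TS insert.prems(4)])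
  have TT1: "T \<subseteq> ?T1" using gen_by_superset[of "insert f T"] by auto
  have T1S: "?T1 \<subseteq> S" using fS TS by (intro gen_by_subset S) auto
  have S_eq: "S = gen_by (?T1 \<union> F)" using insert.prems(5) by (simp only: gen_by_insert)
  have "S = ?T1"
  proof (rule insert.IH[OF S subgrp_gen_by T1S _ S_eq])
    show "commut x y \<in> ?T1" if "x \<in> S" "y \<in> S" for x y
      using insert.prems(4)[OF that] TT1 by auto
    show "S = gen_by (?T1 \<union> (\<lambda>x. x ^ r) ` S)" if "r \<ge> 1" for r
    proof
      show "S \<subseteq> gen_by (?T1 \<union> (\<lambda>x. x ^ r) ` S)"
        using insert.prems(6)[OF that] gen_by_mono[of "T \<union> (\<lambda>x. x ^ r) ` S" "?T1 \<union> (\<lambda>x. x ^ r) ` S"] TT1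
        by auto
      show "gen_by (?T1 \<union> (\<lambda>x. x ^ r) ` S) \<subseteq> S"
        using T1S subgrp_power[OF S] by (intro gen_by_subset[OF S]) auto
    qed
  qed
  have S1: "\<exists>n k. x * (f ^ n * inverse (f ^ k)) \<in> T" if "x \<in> S" for x
    using gen_by_cyclic_extension[OF S nT fS] that \<open>S = ?T1\<close> by auto
  \<comment> \<open>squares are even powers of \<open>f\<close> modulo \<open>T\<close>, and squares generate \<open>S\<close> modulo \<open>T\<close>\<close>
  have ff: "f ^ 2 \<in> S" by (rule subgrp_power[OF S fS])
  let ?E = "{x \<in> S. \<exists>p\<in>cyclic_powers (f ^ 2). x * p \<in> T}"
  have sE: "subgrp ?E"
    by (rule subgrp_cyclic_extension[OF S nT subgrp_cyclic_powers cyclic_powers_subset[OF S ff]])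
       (rule cyclic_powers_commute)
  have "x ^ 2 \<in> ?E" if x: "x \<in> S" for x
  proof -
    obtain n k where nk: "x * (f ^ n * inverse (f ^ k)) \<in> T"
      using S1[OF x] by auto
    let ?p = "f ^ n * inverse (f ^ k)"
    have pS: "?p \<in> S" using fS S by (simp add: subgrp_power subgrp_intros)
    have "x ^ 2 * (?p * ?p) = (x * (x * ?p) * inverse x) * (x * ?p)"
      by (simp add: power2_eq_square group_simps)
    also have "x * (x * ?p) * inverse x = conjug (x * ?p) (inverse x)"
      by (simp add: conjug_def group_simps)
    finally have "x ^ 2 * (?p * ?p) \<in> T"
      using nk x T S normal_inD(3)[OF nT nk] subgrp_inverse subgrp_mult by metis
    moreover have "?p * ?p = (f ^ 2) ^ n * inverse ((f ^ 2) ^ k)"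
      unfolding cyclic_powers_mult by (simp add: power_mult[symmetric] mult_2)
    then have "?p * ?p \<in> cyclic_powers (f ^ 2)" unfolding cyclic_powers_def by blast
    ultimately show ?thesis using x S by (auto simp: subgrp_power)
  qed
  moreover have "T \<subseteq> ?E"
    using TS subgrp_one[OF subgrp_cyclic_powers[of "f ^ 2"]] by (auto intro!: bexI[of _ 1])
  ultimately have "gen_by (T \<union> (\<lambda>x. x ^ 2) ` S) \<subseteq> ?E" by (intro gen_by_subset[OF sE]) auto
  moreover have "S = gen_by (T \<union> (\<lambda>x. x ^ 2) ` S)" by (rule insert.prems(6)) simp
  ultimately have "f \<in> ?E" using fS by blast
  then obtain n k where nk: "f * ((f ^ 2) ^ n * inverse ((f ^ 2) ^ k)) \<in> T"
    unfolding cyclic_powers_def by blast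
  have "f * ((f ^ 2) ^ n * inverse ((f ^ 2) ^ k)) = f ^ (2 * n + 1) * inverse (f ^ (2 * k))"
    by (simp add: power_mult[symmetric] group_simps)
  then have nk': "f ^ (2 * n + 1) * inverse (f ^ (2 * k)) \<in> T" using nk by simp
  obtain r where r: "r \<ge> 1" "f ^ r \<in> T"
  proof (cases "2 * n + 1 > 2 * k")
    case True
    then have "2 * n + 1 = (2 * n + 1 - 2 * k) + 2 * k" by simp
    then have "f ^ (2 * n + 1) = f ^ (2 * n + 1 - 2 * k) * f ^ (2 * k)"
      by (metis power_add)
    then have "f ^ (2 * n + 1 - 2 * k) \<in> T" using nk' by (simp add: group_simps)
    then show thesis using that[of "2 * n + 1 - 2 * k"] True by simp
  next
    case False
    then have "2 * k = (2 * k - (2 * n + 1)) + (2 * n + 1)" by simp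
    then have "f ^ (2 * k) = f ^ (2 * k - (2 * n + 1)) * f ^ (2 * n + 1)"
      by (metis power_add)
    then have "f ^ (2 * n + 1) * inverse (f ^ (2 * k)) = inverse (f ^ (2 * k - (2 * n + 1)))"
      by (simp only: inverse_of_mult mult_inverse_cancel_left)
    then have "inverse (f ^ (2 * k - (2 * n + 1))) \<in> T" using nk' by (simp only:)
    then have "f ^ (2 * k - (2 * n + 1)) \<in> T" using T by (simp only: subgrp_inverse_iff)
    moreover have "2 * k - (2 * n + 1) \<ge> 1" using False by presburger
    ultimately show thesis using that by blast
  qed
  have "x ^ r \<in> T" if x: "x \<in> S" for x
  proof -
    obtain n k where nk: "x * (f ^ n * inverse (f ^ k)) \<in> T"
      using S1[OF x] by auto
    let ?p = "f ^ n * inverse (f ^ k)"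
    have pS: "?p \<in> S" using fS S by (simp add: subgrp_power subgrp_intros)
    have "x ^ i * ?p ^ i \<in> T" for i
    proof (induction i)
      case 0 then show ?case using T by (simp add: subgrp_one)
    next
      case (Suc i)
      have "x ^ Suc i * ?p ^ Suc i = (x * (x ^ i * ?p ^ i) * inverse x) * (x * ?p)"
        by (simp add: group_simps power_commutes)
      also have "x * (x ^ i * ?p ^ i) * inverse x = conjug (x ^ i * ?p ^ i) (inverse x)"
        by (simp add: conjug_def group_simps)
      finally show ?case
        using nk x T S normal_inD(3)[OF nT Suc] subgrp_inverse subgrp_mult by metis
    qed
    moreover have "?p ^ i = f ^ (n * i) * inverse (f ^ (k * i))" for i
      by (induction i) (simp_all add: group_simps cyclic_powers_mult[unfolded mult.assoc])
    ultimately have "x ^ r * (f ^ (n * r) * inverse (f ^ (k * r))) \<in> T" by metis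
    moreover have "f ^ (n * r) \<in> T" "f ^ (k * r) \<in> T"
      using subgrp_power[OF T r(2)] by (simp_all add: power_mult[symmetric] mult.commute)
    ultimately show ?thesis
      using T subgrp_mult_right_iff[of T "f ^ (n * r) * inverse (f ^ (k * r))" "x ^ r"]
      by (simp add: subgrp_mult subgrp_inverse)
  qed
  then have "gen_by (T \<union> (\<lambda>x. x ^ r) ` S) \<subseteq> T" by (intro gen_by_subset[OF T]) auto
  then show ?case using insert.prems(6)[OF r(1)] TS by auto
qed

lemma gen_by_subset_mod:
  assumes T: "subgrp T" and R: "finite R" "\<And>e. e \<in> E \<Longrightarrow> \<exists>f\<in>R. e * inverse f \<in> T"
  shows "gen_by (T \<union> E) \<subseteq> gen_by (T \<union> R)"
proof (rule gen_by_subset[OF subgrp_gen_by], rule subsetI)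
  fix x assume x: "x \<in> T \<union> E"
  show "x \<in> gen_by (T \<union> R)"
  proof (cases "x \<in> T")
    case False
    then obtain f where f: "f \<in> R" "x * inverse f \<in> T" using R(2) x by auto
    then have "x * inverse f \<in> gen_by (T \<union> R)" "f \<in> gen_by (T \<union> R)" by (auto intro: gen_base)
    then have "x * inverse f * f \<in> gen_by (T \<union> R)" by (rule gen_mult)
    then show ?thesis by (simp add: group_simps)
  qed (auto intro: gen_base)
qed

text \<open>
  Write \<open>T = M \<inter> S\<close>. First \<open>S' \<subseteq> M\<close>: otherwise \<open>G = MS'\<close>, so \<open>T\<close> is normal in \<open>G\<close>, and
  \<open>S = TS'\<close> has its commutators in \<open>T\<close> as \<open>S'\<close> is central modulo \<open>T\<close>. Hence \<open>S/T\<close> is abelian, and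
  it is a finitely generated abelian group. For each \<open>r\<close> the powers \<open>S\<^sup>r\<close> generate modulo \<open>T\<close> a
  normal subgroup of \<open>G\<close>, which by maximality is \<open>T\<close> or \<open>S\<close>. If it is always \<open>S\<close>, then \<open>S/T\<close> is
  divisible, hence trivial; otherwise \<open>S/T\<close> has finite exponent, hence is finite.
\<close>

theorem maximal_in_virtually_nilpotent:
  assumes E: "finite E" "G = gen_by E"
    and M: "maximal_in M G" and S: "normal_in S G" and fin: "finite_index S G"
    and nil: "commut_subgrp (commut_subgrp S S) S \<subseteq> M"
  shows "finite_index M G"
proof (cases "S \<subseteq> M")
  case True
  then show ?thesis by (rule finite_index_mono[OF normal_inD(1)[OF S] maximal_inD(1)[OF M] fin])
next
  case SM: False
  have G: "subgrp G" by (simp add: E subgrp_gen_by)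
  note sM = maximal_inD(1)[OF M] and MG = maximal_inD(2)[OF M] and sS = normal_inD(1)[OF S]
    and SG = normal_inD(2)[OF S]
  let ?T = "M \<inter> S" and ?D = "commut_subgrp S S"
  have sT: "subgrp ?T" by (rule subgrp_Int[OF sM sS])
  have D: "normal_in ?D G" by (rule normal_in_commut_subgrp[OF S S G])
  have DS: "?D \<subseteq> S" by (rule commut_subgrp_least[OF sS]) (rule subgrp_commut[OF sS])
  have central: "commut d k \<in> ?T" if "d \<in> ?D" "k \<in> S" for d k
    using nil commut_subgrp_base[OF that] subgrp_commut[OF sS, of d k] that DS by auto
  have inv: "invariant_under N M" if "normal_in N G" for N
    using that MG by (auto simp: normal_in_def invariant_under_def)
  have normal_T: "normal_in ?T G"
    if GMN: "\<And>g. g \<in> G \<Longrightarrow> \<exists>m\<in>M. \<exists>n\<in>N. g = m * n"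
      and N: "N \<subseteq> S" "\<And>k n. k \<in> ?T \<Longrightarrow> n \<in> N \<Longrightarrow> conjug k n \<in> M" for N
  proof (rule normal_inI[OF sT])
    fix k g assume k: "k \<in> ?T" and g: "g \<in> G"
    obtain m n where mn: "m \<in> M" "n \<in> N" "g = m * n" using GMN[OF g] by auto
    have "conjug k m \<in> ?T"
      using k mn(1) MG by (auto intro: subgrp_conjug[OF sM] normal_inD(3)[OF S])
    then have "conjug (conjug k m) n \<in> ?T"
      using N mn(2) by (auto intro: subgrp_conjug[OF sS])
    then show "conjug k g \<in> ?T" by (simp add: mn(3) conjug_conjug)
  qed (use SG in auto)
  have DM: "?D \<subseteq> M"
  proof (rule ccontr)
    assume nDM: "\<not> ?D \<subseteq> M"
    have GMD: "\<exists>m\<in>M. \<exists>d\<in>?D. g = m * d" if g: "g \<in> G" for g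
      using maximal_in_product[OF M G normal_inD(1,2)[OF D] inv[OF D] nDM g] by metis
    have conjM: "conjug k d \<in> M" if "k \<in> ?T" "d \<in> ?D" for k d
    proof -
      have "commut k d = inverse (commut d k)" by (simp add: inverse_commut)
      then have "commut k d \<in> M" using central[OF that(2), of k] that(1) subgrp_inverse[OF sM] by auto
      then show ?thesis using that(1) subgrp_mult[OF sM] by (auto simp: conjug_as_commut)
    qed
    have nT: "normal_in ?T G" by (rule normal_T[OF GMD DS conjM])
    have "commut x y \<in> ?T" if x: "x \<in> S" and y: "y \<in> S" for x y
    proof -
      obtain m d where md: "m \<in> M" "d \<in> ?D" "x = m * d" using GMD x SG by blast
      have "m \<in> S"
        using subgrp_mult_right_iff[OF sS, of d m] md DS x by auto
      then have "commut m y \<in> ?T" using md(1) y SG by (intro normal_in_commut(1)[OF nT G]) auto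
      then have "conjug (commut m y) d \<in> ?T"
        using md(2) DS SG normal_inD(3)[OF nT] by blast
      then show ?thesis
        unfolding md(3) commut_mult_left by (rule subgrp_mult[OF sT _ central[OF md(2) y]])
    qed
    then have "?D \<subseteq> ?T" by (rule commut_subgrp_least[OF sT])
    then show False using nDM by auto
  qed
  have comm: "commut x y \<in> ?T" if "x \<in> S" "y \<in> S" for x y
    using commut_subgrp_base[OF that] DM DS by auto
  have nTS: "normal_in ?T S" by (rule normal_in_of_commut[OF sS sT _ comm]) auto
  have GMS: "\<exists>m\<in>M. \<exists>x\<in>S. g = m * x" if g: "g \<in> G" for g
    using maximal_in_product[OF M G sS SG inv[OF S] SM g] by metis
  have nT: "normal_in ?T G"
    by (rule normal_T[OF GMS]) (use normal_inD(3)[OF nTS] in auto)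
  \<comment> \<open>\<open>S\<close> is finitely generated modulo \<open>T\<close>: take the \<open>S\<close>-parts of the generators of \<open>G\<close>, and
    their conjugates by representatives of \<open>M\<close> modulo \<open>T\<close>\<close>
  obtain \<mu> \<xi> where mx: "\<And>g. g \<in> G \<Longrightarrow> \<mu> g \<in> M \<and> \<xi> g \<in> S \<and> g = \<mu> g * \<xi> g"
    using GMS by metis
  have "finite_index S M" by (rule finite_index_subset[OF fin MG])
  then obtain R where R: "finite R" "R \<subseteq> M" "\<And>m. m \<in> M \<Longrightarrow> \<exists>r\<in>R. m * inverse r \<in> S"
    using finite_index_reps[OF sS] by metis
  have EG: "e \<in> G" if "e \<in> E" for e using that by (simp add: E gen_base)
  let ?C = "{conjug (\<xi> e) m |e m. e \<in> E \<and> m \<in> M}" and ?F = "(\<lambda>(e, m). conjug (\<xi> e) m) ` (E \<times> R)"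
  have conjS: "conjug (\<xi> e) m \<in> S" if "e \<in> E" "m \<in> M" for e m
    using mx[OF EG[OF that(1)]] that(2) MG normal_inD(3)[OF S] by blast
  have fg: "S = gen_by (?T \<union> ?F)"
  proof
    show "gen_by (?T \<union> ?F) \<subseteq> S"
      using conjS R(2) by (intro gen_by_subset[OF sS]) auto
    have CS: "gen_by (?T \<union> ?C) \<subseteq> S"
      using conjS by (intro gen_by_subset[OF sS]) auto
    have iC: "invariant_under (gen_by (?T \<union> ?C)) M"
      unfolding invariant_under_def
    proof (intro ballI)
      fix x m assume x: "x \<in> gen_by (?T \<union> ?C)" and m: "m \<in> M"
      show "conjug x m \<in> gen_by (?T \<union> ?C)"
      proof (rule conjug_gen_by[OF x])
        fix e assume e: "e \<in> ?T \<union> ?C"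
        show "conjug e m \<in> gen_by (?T \<union> ?C)"
        proof (cases "e \<in> ?T")
          case True
          then show ?thesis using m MG normal_inD(3)[OF nT] by (intro gen_base) blast
        next
          case False
          then obtain a n where "a \<in> E" "n \<in> M" "e = conjug (\<xi> a) n" using e by auto
          then have "conjug e m = conjug (\<xi> a) (n * m)" "n * m \<in> M"
            using m by (auto simp: conjug_conjug intro: subgrp_mult[OF sM])
          then show ?thesis using \<open>a \<in> E\<close> by (intro gen_base) blast
        qed
      qed
    qed
    have "E \<subseteq> {m * a |m a. m \<in> M \<and> a \<in> gen_by (?T \<union> ?C)}"
    proof
      fix e assume e: "e \<in> E"
      have "\<xi> e = conjug (\<xi> e) 1" by simp
      then have "\<xi> e \<in> ?C" using e subgrp_one[OF sM] by blast
      then have "\<xi> e \<in> gen_by (?T \<union> ?C)" by (intro gen_base) simp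
      then show "e \<in> {m * a |m a. m \<in> M \<and> a \<in> gen_by (?T \<union> ?C)}" using mx[OF EG[OF e]] by blast
    qed
    then have GC: "G \<subseteq> {m * a |m a. m \<in> M \<and> a \<in> gen_by (?T \<union> ?C)}"
      unfolding E(2) by (rule gen_by_subset[OF subgrp_product[OF sM subgrp_gen_by iC]])
    have "S \<subseteq> gen_by (?T \<union> ?C)"
    proof
      fix x assume x: "x \<in> S"
      then obtain m a where ma: "m \<in> M" "a \<in> gen_by (?T \<union> ?C)" "x = m * a" using GC SG by blast
      then have "m \<in> S" using subgrp_mult_right_iff[OF sS, of a m] CS x by auto
      then have "m \<in> gen_by (?T \<union> ?C)" using ma(1) by (intro gen_base) simp
      then show "x \<in> gen_by (?T \<union> ?C)" unfolding ma(3) using ma(2) by (rule gen_mult)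
    qed
    also have "gen_by (?T \<union> ?C) \<subseteq> gen_by (?T \<union> ?F)"
    proof (rule gen_by_subset_mod[OF sT])
      show "finite ?F" using E(1) R(1) by simp
      fix c assume "c \<in> ?C"
      then obtain e m where em: "e \<in> E" "m \<in> M" "c = conjug (\<xi> e) m" by auto
      obtain r where r: "r \<in> R" "m * inverse r \<in> S" using R(3)[OF em(2)] by auto
      have rM: "r \<in> M" using r R(2) by auto
      define n where "n = conjug (inverse (m * inverse r)) r"
      have "n = inverse m * r" by (simp add: n_def conjug_def group_simps)
      then have eq: "c * inverse (conjug (\<xi> e) r) = conjug (inverse (commut c n)) (inverse c)"
        by (simp add: em(3) conjug_def commut_def group_simps)
      have cS: "c \<in> S" using conjS[OF em(1,2)] em(3) by simp
      have nS: "n \<in> S" unfolding n_def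
        using r(2) rM MG normal_inD(3)[OF S] subgrp_inverse[OF sS] by blast
      have "c * inverse (conjug (\<xi> e) r) \<in> ?T"
        unfolding eq using subgrp_inverse[OF sT comm[OF cS nS]] subgrp_inverse[OF sS cS]
        by (rule normal_inD(3)[OF nTS])
      then show "\<exists>f\<in>?F. c * inverse f \<in> ?T"
        using em(1) r(1) by (intro bexI) (auto intro!: image_eqI[of _ _ "(e, r)"])
    qed
    finally show "S \<subseteq> gen_by (?T \<union> ?F)" .
  qed
  have finF: "finite ?F" using E(1) R(1) by simp
  have "\<exists>r\<ge>1. \<forall>x\<in>S. x ^ r \<in> ?T"
  proof (rule ccontr)
    assume no: "\<not> (\<exists>r\<ge>1. \<forall>x\<in>S. x ^ r \<in> ?T)"
    have div: "S = gen_by (?T \<union> (\<lambda>x. x ^ r) ` S)" (is "S = ?P") if r: "r \<ge> 1" for r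
    proof
      show PS: "?P \<subseteq> S" using subgrp_power[OF sS] by (intro gen_by_subset[OF sS]) auto
      have "conjug (x ^ r) m = conjug x m ^ r" for x m :: 'a
        by (induction r) (simp_all add: conjug_mult)
      then have iP: "invariant_under ?P M"
        unfolding invariant_under_def
      proof (intro ballI, elim conjug_gen_by)
        fix x m e assume m: "m \<in> M" and e: "e \<in> ?T \<union> (\<lambda>x. x ^ r) ` S"
          and pow: "\<And>x m :: 'a. conjug (x ^ r) m = conjug x m ^ r"
        have "conjug e m \<in> ?T \<union> (\<lambda>x. x ^ r) ` S"
          using e m MG normal_inD(3)[OF nT] normal_inD(3)[OF S] pow by blast
        then show "conjug e m \<in> ?P" by (rule gen_base)
      qed
      obtain x where x: "x \<in> S" "x ^ r \<notin> ?T" using no r by auto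
      then have "x ^ r \<notin> M" using subgrp_power[OF sS] by auto
      moreover have "x ^ r \<in> ?P" using x(1) by (intro gen_base) simp
      ultimately have PM: "\<not> ?P \<subseteq> M" by auto
      show "S \<subseteq> ?P"
      proof
        fix y assume y: "y \<in> S"
        then obtain m p where mp: "m \<in> M" "p \<in> ?P" "y = m * p"
          using maximal_in_product[OF M G subgrp_gen_by _ iP PM, of y] PS SG by blast
        then have "m \<in> S" using subgrp_mult_right_iff[OF sS, of p m] PS y by auto
        then have "m \<in> ?P" using mp(1) by (intro gen_base) simp
        then show "y \<in> ?P" unfolding mp(3) using mp(2) by (rule gen_mult)
      qed
    qed
    have "S = ?T" by (rule abelian_divisible_trivial[OF finF sS sT _ comm fg div]) auto
    then show False using SM by auto
  qed
  then obtain r where r: "r \<ge> 1" "\<And>x. x \<in> S \<Longrightarrow> x ^ r \<in> ?T" by auto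
  have "finite_index ?T S" by (rule abelian_finite_exponent[OF finF sS sT _ comm fg r]) auto
  then show ?thesis by (rule finite_index_maximal[OF M G S SM])
qed

section \<open>Automorphisms of the rooted tree\<close>

text \<open>
  An automorphism of the tree of all words over \<^typ>\<open>nat\<close> is given by its portrait, which assigns
  to each vertex a permutation of its children. Any family of permutations is a portrait, so that an
  automorphism with prescribed root permutation and sections exists for free, and two automorphisms
  are equal if they have the same root permutation and the same sections. The \<open>m\<close>-adic tree sits in
  this tree as the subtree of the words over \<open>{0..<m}\<close>.
\<close>

typedef taut = "{P :: nat list \<Rightarrow> nat \<Rightarrow> nat. \<forall>u. bij (P u)}"
  morphisms portrait Taut
  by (rule exI[of _ "\<lambda>_. id"]) simp

definition pm :: "taut \<Rightarrow> nat \<Rightarrow> nat" where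
  "pm g = portrait g []"

definition sec :: "taut \<Rightarrow> nat \<Rightarrow> taut" where
  "sec g x = Taut (\<lambda>u. portrait g (x # u))"

definition mk :: "(nat \<Rightarrow> nat) \<Rightarrow> (nat \<Rightarrow> taut) \<Rightarrow> taut" where
  "mk p F = Taut (case_list p (\<lambda>x. portrait (F x)))"

lemma bij_portrait: "bij (portrait g u)"
  using portrait[of g] by simp

lemma portrait_Taut: "(\<And>u. bij (P u)) \<Longrightarrow> portrait (Taut P) = P"
  by (rule Taut_inverse) simp

lemma bij_pm: "bij (pm g)"
  by (simp add: pm_def bij_portrait)

lemma portrait_Nil: "portrait g [] = pm g"
  by (simp add: pm_def)

lemma portrait_Cons: "portrait g (x # u) = portrait (sec g x) u"
  by (simp add: sec_def portrait_Taut bij_portrait)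

lemma taut_eqI_portrait: "(\<And>u. portrait g u = portrait h u) \<Longrightarrow> g = h"
  using portrait_inject by blast

lemma taut_eqI:
  assumes "pm g = pm h" "\<And>x. sec g x = sec h x"
  shows "g = h"
proof (rule taut_eqI_portrait)
  show "portrait g u = portrait h u" for u
    using assms by (cases u) (simp_all add: portrait_Nil portrait_Cons)
qed

lemma pm_mk: "bij p \<Longrightarrow> pm (mk p F) = p"
  and sec_mk: "bij p \<Longrightarrow> sec (mk p F) x = F x"
proof -
  assume "bij p"
  then have "bij (case_list p (\<lambda>x. portrait (F x)) u)" for u
    by (cases u) (simp_all add: bij_portrait)
  then have "portrait (mk p F) = case_list p (\<lambda>x. portrait (F x))"
    by (simp add: mk_def portrait_Taut)
  then show "pm (mk p F) = p" "sec (mk p F) x = F x"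
    by (simp_all add: pm_def sec_def portrait_inverse)
qed

fun mult_portrait :: "taut \<Rightarrow> taut \<Rightarrow> nat list \<Rightarrow> nat \<Rightarrow> nat" where
  "mult_portrait g h [] = pm h \<circ> pm g"
| "mult_portrait g h (x # u) = mult_portrait (sec g x) (sec h (pm g x)) u"

fun inverse_portrait :: "taut \<Rightarrow> nat list \<Rightarrow> nat \<Rightarrow> nat" where
  "inverse_portrait g [] = inv_into UNIV (pm g)"
| "inverse_portrait g (x # u) = inverse_portrait (sec g (inv_into UNIV (pm g) x)) u"

instantiation taut :: "{one, times, inverse}"
begin

definition one_taut :: taut where "1 = Taut (\<lambda>_. id)"

definition times_taut :: "taut \<Rightarrow> taut \<Rightarrow> taut" where
  "g * h = Taut (mult_portrait g h)"

definition inverse_taut :: "taut \<Rightarrow> taut" where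
  "inverse g = Taut (inverse_portrait g)"

definition divide_taut :: "taut \<Rightarrow> taut \<Rightarrow> taut" where
  "divide g h = g * inverse h" for g h :: taut

instance ..

end

lemma portrait_mult: "portrait (g * h) = mult_portrait g h"
proof -
  have "bij (mult_portrait g h u)" for u
    by (induction u arbitrary: g h) (simp_all add: bij_pm bij_comp)
  then show ?thesis by (simp add: times_taut_def portrait_Taut)
qed

lemma portrait_inverse: "portrait (inverse g) = inverse_portrait g"
proof -
  have "bij (inverse_portrait g u)" for u
    by (induction u arbitrary: g) (simp_all add: bij_pm bij_imp_bij_inv)
  then show ?thesis by (simp add: inverse_taut_def portrait_Taut)
qed

lemma portrait_one: "portrait 1 u = id"
  by (simp add: one_taut_def portrait_Taut)

lemma pm_one [simp]: "pm 1 = id"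
  by (simp add: pm_def portrait_one)

lemma sec_one [simp]: "sec 1 x = 1"
  by (rule taut_eqI_portrait) (simp add: portrait_Cons[symmetric] portrait_one)

lemma pm_mult: "pm (g * h) = pm h \<circ> pm g"
  by (simp add: pm_def portrait_mult)

lemma sec_mult: "sec (g * h) x = sec g x * sec h (pm g x)"
  by (rule taut_eqI_portrait) (simp add: portrait_Cons[symmetric] portrait_mult)

lemma pm_inverse: "pm (inverse g) = inv_into UNIV (pm g)"
  by (simp add: pm_def[of "inverse g"] portrait_inverse)

lemma sec_inverse': "sec (inverse g) x = inverse (sec g (inv_into UNIV (pm g) x))"
  by (rule taut_eqI_portrait) (simp add: portrait_Cons[symmetric] portrait_inverse)

instance taut :: group_mult
proof
  fix a b c :: taut
  show "a * b * c = a * (b * c)"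
  proof (rule taut_eqI_portrait)
    show "portrait (a * b * c) u = portrait (a * (b * c)) u" for u
      by (induction u arbitrary: a b c)
        (simp_all add: portrait_Nil portrait_Cons pm_mult sec_mult comp_assoc)
  qed
  show "1 * a = a"
  proof (rule taut_eqI_portrait)
    show "portrait (1 * a) u = portrait a u" for u
      by (induction u arbitrary: a) (simp_all add: portrait_Nil portrait_Cons pm_mult sec_mult)
  qed
  show "a * 1 = a"
  proof (rule taut_eqI_portrait)
    show "portrait (a * 1) u = portrait a u" for u
      by (induction u arbitrary: a) (simp_all add: portrait_Nil portrait_Cons pm_mult sec_mult)
  qed
  show "inverse a * a = 1"
  proof (rule taut_eqI_portrait)
    show "portrait (inverse a * a) u = portrait 1 u" for u
    proof (induction u arbitrary: a)
      case Nil
      show ?case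
        using bij_is_surj[OF bij_pm[of a]] by (simp add: portrait_Nil pm_mult pm_inverse surj_iff)
    next
      case (Cons x u)
      then show ?case by (simp add: portrait_Cons sec_mult sec_inverse' pm_inverse)
    qed
  qed
qed

lemma pm_inverse_pm [simp]: "pm (inverse g) (pm g x) = x" "pm g (pm (inverse g) x) = x"
  by (simp_all add: pm_inverse bij_pm bij_is_inj bij_is_surj surj_f_inv_f)

lemma sec_inverse: "sec (inverse g) (pm g x) = inverse (sec g x)"
  by (simp add: sec_inverse' bij_pm bij_is_inj)

lemma sec_inverse_fixed: "pm g x = x \<Longrightarrow> sec (inverse g) x = inverse (sec g x)"
  by (metis sec_inverse)

lemma pm_inverse_fixed: "pm g x = x \<Longrightarrow> pm (inverse g) x = x"
  by (metis pm_inverse_pm(1))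

lemma pm_inj: "pm g x = pm g y \<longleftrightarrow> x = y"
  by (metis pm_inverse_pm(1))

lemma pm_conjug: "pm (conjug g k) (pm k x) = pm k (pm g x)"
  by (simp add: conjug_def pm_mult)

lemma sec_conjug: "pm g x = x \<Longrightarrow> sec (conjug g k) (pm k x) = conjug (sec g x) (sec k x)"
  by (simp add: conjug_def pm_mult sec_mult sec_inverse)

lemma pm_conjug_id: "pm g = id \<Longrightarrow> pm (conjug g k) = id"
proof
  fix x assume "pm g = id"
  then show "pm (conjug g k) x = id x" using pm_conjug[of g k "pm (inverse k) x"] by simp
qed

lemma pm_commut_id: "pm g = id \<Longrightarrow> pm h = id \<Longrightarrow> pm (commut g h) = id"
  by (simp add: commut_def pm_mult pm_inverse)

lemma sec_commut: "pm g = id \<Longrightarrow> pm h = id \<Longrightarrow> sec (commut g h) x = commut (sec g x) (sec h x)"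
  by (simp add: commut_def pm_mult sec_mult pm_inverse sec_inverse_fixed)

definition emb :: "nat \<Rightarrow> taut \<Rightarrow> taut" where
  "emb x g = mk id (\<lambda>y. if y = x then g else 1)"

lemma pm_emb [simp]: "pm (emb x g) = id"
  by (simp add: emb_def pm_mk)

lemma sec_emb: "sec (emb x g) y = (if y = x then g else 1)"
  by (simp add: emb_def sec_mk)

lemma emb_one [simp]: "emb x 1 = 1"
  by (rule taut_eqI) (simp_all add: sec_emb)

lemma emb_mult: "emb x (g * h) = emb x g * emb x h"
  by (rule taut_eqI) (simp_all add: sec_emb pm_mult sec_mult)

lemma emb_inverse: "emb x (inverse g) = inverse (emb x g)"
  by (rule taut_eqI) (simp_all add: sec_emb pm_inverse sec_inverse_fixed inverse_of_one fun_eq_iff)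

lemma emb_commut: "emb x (commut g h) = commut (emb x g) (emb x h)"
  by (simp add: commut_def emb_mult emb_inverse)

lemma emb_eq_iff: "emb x g = emb x h \<longleftrightarrow> g = h"
  by (metis sec_emb)

lemma emb_eq_1_iff: "emb x g = 1 \<longleftrightarrow> g = 1"
  by (metis emb_eq_iff emb_one)

lemma emb_commute: "x \<noteq> y \<Longrightarrow> emb x g * emb y h = emb y h * emb x g"
  by (rule taut_eqI) (simp_all add: sec_emb pm_mult sec_mult)

lemma conjug_emb: "conjug (emb x g) k = emb (pm k x) (conjug g (sec k x))"
proof (rule taut_eqI)
  show "pm (conjug (emb x g) k) = pm (emb (pm k x) (conjug g (sec k x)))"
    by (simp add: pm_conjug_id)
  fix y
  have "sec (conjug (emb x g) k) (pm k (pm (inverse k) y))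
      = sec (emb (pm k x) (conjug g (sec k x))) (pm k (pm (inverse k) y))"
    by (subst sec_conjug) (auto simp: sec_emb pm_inj)
  then show "sec (conjug (emb x g) k) y = sec (emb (pm k x) (conjug g (sec k x))) y" by simp
qed

lemma commut_emb_right: "pm k = id \<Longrightarrow> commut k (emb x g) = emb x (commut (sec k x) g)"
  by (rule taut_eqI) (simp_all add: sec_commut pm_commut_id sec_emb)

lemma commut_emb_left: "pm k = id \<Longrightarrow> commut (emb x g) k = emb x (commut g (sec k x))"
  by (rule taut_eqI) (simp_all add: sec_commut pm_commut_id sec_emb)

fun embw :: "nat list \<Rightarrow> taut \<Rightarrow> taut" where
  "embw [] g = g"
| "embw (x # w) g = emb x (embw w g)"

text \<open>An element conjugates what sits below a vertex that it moves to something that sits below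
  another vertex, and the two commute.\<close>

lemma commut_commut_moved:
  assumes "pm k x \<noteq> x"
  shows "commut (commut k (emb x g)) (emb x h) = emb x (commut g h)"
proof -
  define e where "e = emb (pm k x) (conjug (inverse g) (sec k x))"
  have e: "commut k (emb x g) = e * emb x g"
  proof -
    have "e = conjug (inverse (emb x g)) k"
      by (simp add: e_def conjug_emb emb_inverse[symmetric])
    then show ?thesis by (simp add: conjug_def commut_def group_simps)
  qed
  have c: "e * emb x h = emb x h * e"
    unfolding e_def by (rule emb_commute) (use assms in auto)
  have "commut e (emb x h) = 1" using c by (simp add: commut_eq_1_iff)
  then show ?thesis by (simp add: e commut_mult_left emb_commut)
qed

section \<open>Self-similarity and proper quotients of the group\<close>

definition rot :: "nat \<Rightarrow> nat \<Rightarrow> nat" where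
  "rot m x = (if x < m then (x + 1) mod m else x)"

lemma bij_rot: "bij (rot m)"
proof (rule o_bij)
  let ?r = "\<lambda>x. if x < m then (x + (m - 1)) mod m else x"
  show "?r \<circ> rot m = id" "rot m \<circ> ?r = id"
    by (auto simp: fun_eq_iff rot_def mod_if)
qed

text \<open>
  Letters outside \<open>{0..<m}\<close> are fixed, with trivial sections, so that the group is that of the \<open>m\<close>-adic tree.
\<close>

fun kgen_portrait :: "nat \<Rightarrow> nat \<Rightarrow> nat \<Rightarrow> nat \<Rightarrow> nat list \<Rightarrow> nat \<Rightarrow> nat" where
  "kgen_portrait m s t 0 [] = rot m"
| "kgen_portrait m s t (Suc i) [] = id"
| "kgen_portrait m s t 0 (x # u) = (if x = m - 1 then kgen_portrait m s t (s - 1) u else id)"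
| "kgen_portrait m s t (Suc i) (x # u) = (if x = t then kgen_portrait m s t i u else id)"

lemma bij_kgen_portrait: "bij (kgen_portrait m s t i u)"
  by (induction m s t i u rule: kgen_portrait.induct) (auto simp: bij_rot id_def[symmetric])

locale kneading =
  fixes m s t :: nat
  assumes m: "m \<ge> 2" and s: "s \<ge> 2" and t: "t < m"
begin

definition a :: "nat \<Rightarrow> taut" where
  "a i = Taut (kgen_portrait m s t i)"

definition G :: "taut set" where
  "G = gen_by (a ` {..<s})"

lemma portrait_a: "portrait (a i) = kgen_portrait m s t i"
  by (simp add: a_def portrait_Taut bij_kgen_portrait)

lemma pm_a_0: "pm (a 0) = rot m"
  and pm_a_Suc: "pm (a (Suc i)) = id"
  by (simp_all add: pm_def portrait_a)

lemma sec_a_0: "sec (a 0) x = (if x = m - 1 then a (s - 1) else 1)"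
  by (rule taut_eqI_portrait) (simp add: portrait_Cons[symmetric] portrait_a portrait_one)

lemma sec_a_Suc: "sec (a (Suc i)) x = (if x = t then a i else 1)"
  by (rule taut_eqI_portrait) (simp add: portrait_Cons[symmetric] portrait_a portrait_one)

lemma a_Suc: "a (Suc i) = emb t (a i)"
  by (rule taut_eqI) (simp_all add: pm_a_Suc sec_a_Suc sec_emb)

lemma subgrp_G: "subgrp G"
  by (simp add: G_def subgrp_gen_by)

lemma a_in_G: "i < s \<Longrightarrow> a i \<in> G"
  unfolding G_def by (rule gen_base) simp

text \<open>
  What is needed on the first level for an induction over the generators: \<open>G\<close> acts there by powers
  of an \<open>m\<close>-cycle, is self-similar, and does nothing outside the \<open>m\<close>-adic tree.
\<close>

definition tame :: "taut \<Rightarrow> bool" where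
  "tame g \<longleftrightarrow> (\<exists>k. \<forall>x<m. pm g x = (x + k) mod m) \<and> (\<forall>x<m. sec g x \<in> G) \<and>
    (\<forall>x\<ge>m. pm g x = x \<and> sec g x = 1)"

lemma pm_less_of_tame: "tame g \<Longrightarrow> x < m \<Longrightarrow> pm g x < m"
  unfolding tame_def using m by (metis mod_less_divisor not_numeral_le_zero zero_less_iff_neq_zero)

lemma tame_mult:
  assumes "tame g" "tame h"
  shows "tame (g * h)"
proof -
  obtain k l where kl: "\<And>x. x < m \<Longrightarrow> pm g x = (x + k) mod m" "\<And>x. x < m \<Longrightarrow> pm h x = (x + l) mod m"
    using assms by (auto simp: tame_def)
  have lt: "(x + k) mod m < m" for x using m by simp
  have "pm (g * h) x = (x + (k + l)) mod m" if "x < m" for x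
    using kl(1)[OF that] kl(2)[OF lt[of x]] by (simp add: pm_mult mod_add_left_eq add.assoc)
  moreover have "sec (g * h) x \<in> G" if "x < m" for x
    using that assms subgrp_mult[OF subgrp_G] kl(1)[OF that] lt by (auto simp: sec_mult tame_def)
  ultimately show ?thesis using assms by (auto simp: tame_def pm_mult sec_mult)
qed

lemma tame_inverse:
  assumes "tame g"
  shows "tame (inverse g)"
proof -
  obtain k where k: "\<And>x. x < m \<Longrightarrow> pm g x = (x + k) mod m" using assms by (auto simp: tame_def)
  define l where "l = m - k mod m"
  have pre: "pm g ((y + l) mod m) = y" "(y + l) mod m < m" if "y < m" for y
  proof -
    show lt: "(y + l) mod m < m" using m by simp
    have "(y + l + k) mod m = (y + l + k mod m) mod m" by (simp add: mod_add_right_eq)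
    also have "y + l + k mod m = y + m"
      using m mod_less_divisor[of m k] by (simp add: l_def del: mod_less_divisor)
    finally have "(y + l + k) mod m = y" using that by simp
    then show "pm g ((y + l) mod m) = y" by (simp add: k[OF lt] mod_add_left_eq)
  qed
  have "pm (inverse g) y = (y + l) mod m" if "y < m" for y
    using pre(1)[OF that] by (metis pm_inverse_pm(1))
  moreover have "sec (inverse g) y \<in> G" if "y < m" for y
    using pre[OF that] sec_inverse[of g "(y + l) mod m"] assms subgrp_inverse[OF subgrp_G]
    by (auto simp: tame_def)
  moreover have "pm (inverse g) y = y" "sec (inverse g) y = 1" if "y \<ge> m" for y
  proof -
    have "pm g y = y" "sec g y = 1" using that assms by (auto simp: tame_def)
    then show "pm (inverse g) y = y" "sec (inverse g) y = 1"
      by (simp_all add: pm_inverse_fixed sec_inverse_fixed inverse_of_one)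
  qed
  ultimately show ?thesis by (auto simp: tame_def)
qed

lemma tame_one: "tame 1"
  by (auto simp: tame_def subgrp_one[OF subgrp_G] intro!: exI[of _ 0])

lemma tame: "g \<in> G \<Longrightarrow> tame g"
  unfolding G_def
proof (induction rule: gen_by.induct)
  case (gen_base e)
  then obtain i where i: "i < s" "e = a i" by auto
  show ?case
  proof (cases i)
    case 0
    then show ?thesis using i m s a_in_G[of "s - 1"]
      by (auto simp: tame_def pm_a_0 sec_a_0 rot_def subgrp_one[OF subgrp_G] intro!: exI[of _ 1])
  next
    case (Suc j)
    then show ?thesis using i t a_in_G[of j]
      by (auto simp: tame_def pm_a_Suc sec_a_Suc subgrp_one[OF subgrp_G] intro!: exI[of _ 0])
  qed
qed (auto intro: tame_mult tame_inverse tame_one)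

lemma pm_shift: "g \<in> G \<Longrightarrow> \<exists>k. \<forall>x<m. pm g x = (x + k) mod m"
  using tame by (simp add: tame_def)

lemma sec_in_G: "g \<in> G \<Longrightarrow> x < m \<Longrightarrow> sec g x \<in> G"
  using tame by (auto simp: tame_def)

lemma pm_less: "g \<in> G \<Longrightarrow> x < m \<Longrightarrow> pm g x < m"
  using tame pm_less_of_tame by blast

lemma outside: "g \<in> G \<Longrightarrow> x \<ge> m \<Longrightarrow> pm g x = x" "g \<in> G \<Longrightarrow> x \<ge> m \<Longrightarrow> sec g x = 1"
  using tame by (auto simp: tame_def)

text \<open>The action on the first level is by powers of an \<open>m\<close>-cycle, so it is free.\<close>

lemma pm_id_of_fixed:
  assumes g: "g \<in> G" and x: "x < m" "pm g x = x"
  shows "pm g = id"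
proof
  fix y
  obtain k where k: "\<forall>x<m. pm g x = (x + k) mod m" using pm_shift[OF g] by blast
  have "(x + k) mod m = x mod m" using k x by simp
  then have "m dvd k" using mod_eq_dvd_iff_nat[of x "x + k" m] by simp
  then have "(y + k) mod m = y mod m" by auto
  then show "pm g y = id y" using k outside(1)[OF g, of y] by (cases "y < m") auto
qed

subsection \<open>Sections of vertex stabilizers are onto\<close>

lemma a_0_power:
  "x < m \<Longrightarrow> k \<le> m \<Longrightarrow> pm (a 0 ^ k) x = (x + k) mod m \<and> sec (a 0 ^ k) x = (if x + k < m then 1 else a (s - 1))"
proof (induction k)
  case (Suc k)
  then have IH: "pm (a 0 ^ k) x = (x + k) mod m"
    "sec (a 0 ^ k) x = (if x + k < m then 1 else a (s - 1))" by auto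
  have lt: "(x + k) mod m < m" using m by simp
  have "rot m ((x + k) mod m) = (x + Suc k) mod m"
    using lt by (simp add: rot_def mod_Suc_eq)
  moreover have "(x + k) mod m = m - 1 \<longleftrightarrow> x + k = m - 1"
    using Suc.prems m by (auto simp: mod_if)
  ultimately show ?case using IH Suc.prems
    by (auto simp: power_Suc2 pm_mult sec_mult pm_a_0 sec_a_0 simp del: power_Suc)
qed (auto simp: pm_one sec_one)

lemma pm_a_0_power_m: "pm (a 0 ^ m) = id"
proof
  fix x
  show "pm (a 0 ^ m) x = id x"
    using a_0_power[of x m] outside(1)[OF subgrp_power[OF subgrp_G a_in_G[of 0], of m], of x] s
    by (cases "x < m") auto
qed

lemma sec_a_0_power_m: "x < m \<Longrightarrow> sec (a 0 ^ m) x = a (s - 1)"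
  using a_0_power[of x m] by auto

lemma emb_rot:
  assumes "Suc x < m"
  shows "conjug (emb x g) (a 0) = emb (Suc x) g"
  using assms by (auto simp: conjug_emb pm_a_0 sec_a_0 rot_def)

text \<open>
  Conjugate by \<open>a\<^sub>0\<close> to move from \<open>t\<close> up to \<open>x\<close>, and by its inverse to move down. On neither way is
  there a step between \<open>m - 1\<close> and \<open>0\<close>, which are the only steps where \<open>a\<^sub>0\<close> has a nontrivial section.
\<close>

lemma emb_in_G:
  assumes "emb t g \<in> G" "x < m"
  shows "emb x g \<in> G"
proof -
  have a0: "a 0 \<in> G" using a_in_G s by simp
  have up: "emb (t + k) g \<in> G" if "t + k < m" for k
    using that
  proof (induction k)
    case (Suc k)
    then have "conjug (emb (t + k) g) (a 0) \<in> G"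
      by (intro subgrp_conjug[OF subgrp_G]) (auto simp: a0)
    then show ?case using Suc.prems by (simp add: emb_rot)
  qed (simp add: assms(1))
  have down: "emb (t - k) g \<in> G" if "k \<le> t" for k
    using that
  proof (induction k)
    case (Suc k)
    have "emb (t - k) g = conjug (emb (t - Suc k) g) (a 0)"
      using emb_rot[of "t - Suc k" g] Suc.prems t by (simp add: Suc_diff_Suc)
    then have "emb (t - Suc k) g = conjug (emb (t - k) g) (inverse (a 0))" by simp
    also have "\<dots> \<in> G" using Suc by (intro subgrp_conjug[OF subgrp_G] subgrp_inverse[OF subgrp_G] a0) auto
    finally show ?case .
  qed (simp add: assms(1))
  show ?thesis
    using up[of "x - t"] down[of "t - x"] assms(2) t by (cases "x \<ge> t") auto
qed

lemma emb_a_in_G: "i < s - 1 \<Longrightarrow> x < m \<Longrightarrow> emb x (a i) \<in> G"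
  using emb_in_G[of "a i" x] a_in_G[of "Suc i"] by (simp add: a_Suc)

text \<open>
  The generators other than \<open>a\<^sub>s\<^sub>-\<^sub>1\<close> are in \<open>G\<close> when placed below \<open>x\<close>, and \<open>a\<^sub>s\<^sub>-\<^sub>1\<close> is the section of
  \<open>a\<^sub>0\<^sup>m\<close> at every vertex of the first level.
\<close>

lemma fractal:
  assumes "h \<in> G" "x < m"
  obtains k where "k \<in> G" "pm k = id" "sec k x = h"
proof -
  let ?H = "{h. \<exists>k\<in>G. pm k = id \<and> sec k x = h}"
  have "subgrp ?H"
  proof (rule subgrpI)
    show "1 \<in> ?H" using subgrp_one[OF subgrp_G] by force
    show "g * h \<in> ?H" if gh: "g \<in> ?H" "h \<in> ?H" for g h
    proof -
      obtain k l where "k \<in> G" "pm k = id" "sec k x = g" "l \<in> G" "pm l = id" "sec l x = h"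
        using gh by auto
      then show ?thesis
        using subgrp_mult[OF subgrp_G, of k l]
        by (intro CollectI bexI[of _ "k * l"]) (auto simp: pm_mult sec_mult)
    qed
    show "inverse g \<in> ?H" if gH: "g \<in> ?H" for g
    proof -
      obtain k where "k \<in> G" "pm k = id" "sec k x = g" using gH by auto
      then show ?thesis
        using subgrp_inverse[OF subgrp_G, of k]
        by (intro CollectI bexI[of _ "inverse k"]) (auto simp: pm_inverse sec_inverse_fixed)
    qed
  qed
  moreover have "a i \<in> ?H" if "i < s" for i
  proof (cases "i = s - 1")
    case True
    then show ?thesis
      using pm_a_0_power_m sec_a_0_power_m[OF assms(2)] subgrp_power[OF subgrp_G a_in_G[of 0], of m] s
      by (intro CollectI bexI[of _ "a 0 ^ m"]) auto
  next
    case False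
    then show ?thesis using emb_a_in_G[of i x] that assms(2)
      by (intro CollectI bexI[of _ "emb x (a i)"]) (auto simp: sec_emb)
  qed
  ultimately have "G \<subseteq> ?H" unfolding G_def by (intro gen_by_subset) auto
  then show thesis using assms(1) that by auto
qed

lemma fractal_transitive:
  assumes "h \<in> G" "x < m" "y < m"
  obtains k where "k \<in> G" "pm k x = y" "sec k x = h"
proof -
  define j where "j = (y + (m - x)) mod m"
  have j: "j \<le> m" "(x + j) mod m = y"
    using assms by (auto simp: j_def mod_add_right_eq less_imp_le)
  have b: "a 0 ^ j \<in> G" using s by (intro subgrp_power[OF subgrp_G a_in_G]) simp
  have "h * inverse (sec (a 0 ^ j) x) \<in> G"
    using assms(1,2) sec_in_G[OF b] by (intro subgrp_mult[OF subgrp_G] subgrp_inverse[OF subgrp_G])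
  then obtain k where k: "k \<in> G" "pm k = id" "sec k x = h * inverse (sec (a 0 ^ j) x)"
    by (rule fractal[OF _ assms(2)])
  have "pm (k * a 0 ^ j) x = y" using k a_0_power[OF assms(2) j(1)] j(2) by (simp add: pm_mult)
  moreover have "sec (k * a 0 ^ j) x = h" using k by (simp add: sec_mult group_simps)
  ultimately show thesis using that[of "k * a 0 ^ j"] k(1) b subgrp_mult[OF subgrp_G] by blast
qed

subsection \<open>The derived subgroup\<close>

definition D :: "taut set" where
  "D = commut_subgrp G G"

lemma normal_D: "normal_in D G"
  unfolding D_def by (intro normal_in_commut_subgrp normal_in_self subgrp_G)

lemma subgrp_D: "subgrp D" and D_G: "D \<subseteq> G"
  using normal_inD[OF normal_D] by auto

lemma normal_level1: "normal_in {g \<in> G. pm g = id} G"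
proof (rule normal_inI)
  show "subgrp {g \<in> G. pm g = id}"
    using subgrp_G by (intro subgrpI) (auto simp: subgrp_intros pm_mult pm_inverse)
qed (use subgrp_conjug[OF subgrp_G] in \<open>auto simp: pm_conjug_id\<close>)

lemma pm_D: "d \<in> D \<Longrightarrow> pm d = id"
proof -
  have "pm (commut (a i) (a j)) = id" if "i < s" "j < s" for i j
  proof (cases "i = 0 \<and> j = 0")
    case False
    then consider k where "i = Suc k" | k where "j = Suc k" by (cases i; cases j) auto
    then show ?thesis
    proof cases
      case 1
      then have "a i \<in> {g \<in> G. pm g = id}" using that a_in_G by (simp add: pm_a_Suc)
      then show ?thesis using normal_in_commut(1)[OF normal_level1 subgrp_G _ a_in_G[OF that(2)]] by auto
    next
      case 2
      then have "a j \<in> {g \<in> G. pm g = id}" using that a_in_G by (simp add: pm_a_Suc)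
      then show ?thesis using normal_in_commut(2)[OF normal_level1 subgrp_G _ a_in_G[OF that(1)]] by auto
    qed
  qed simp
  then have "D \<subseteq> {g \<in> G. pm g = id}"
    unfolding D_def using a_in_G
    by (intro commut_subgrp_gen_by[OF normal_level1 G_def]) (auto intro!: subgrp_commut[OF subgrp_G])
  then show "d \<in> D \<Longrightarrow> pm d = id" by auto
qed

text \<open>
  An element of \<open>G\<close> with section \<open>g\<close> at \<open>x\<close> and trivial action on the first level conjugates
  \<open>emb x n\<close> to \<open>emb x (conjug n g)\<close>.
\<close>

lemma normal_emb_preimage:
  assumes B: "normal_in B G" and x: "x < m"
  shows "normal_in {g \<in> G. emb x g \<in> B} G"
proof (rule normal_inI)
  note nB = normal_inD[OF B]
  show "subgrp {g \<in> G. emb x g \<in> B}"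
    using subgrp_G nB(1) by (intro subgrpI) (auto simp: subgrp_intros emb_mult emb_inverse)
  fix n g assume n: "n \<in> {g \<in> G. emb x g \<in> B}" and g: "g \<in> G"
  obtain k where k: "k \<in> G" "pm k = id" "sec k x = g" by (rule fractal[OF g x])
  have "emb x (conjug n g) = conjug (emb x n) k" using k by (simp add: conjug_emb)
  then show "conjug n g \<in> {g \<in> G. emb x g \<in> B}"
    using n g k nB(3) subgrp_conjug[OF subgrp_G] by auto
qed auto

text \<open>Of two different generators at least one is not \<open>a\<^sub>s\<^sub>-\<^sub>1\<close>, so it sits below each vertex
  of the first level as an element of \<open>G\<close>. Hence so do all commutators of generators.\<close>

lemma emb_D: "d \<in> D \<Longrightarrow> x < m \<Longrightarrow> emb x d \<in> D"
proof -
  assume d: "d \<in> D" and x: "x < m"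
  have "emb x (commut (a i) (a j)) \<in> D" if ij: "i < s" "j < s" for i j
  proof -
    consider "i = j" | "i < s - 1" | "j < s - 1" using ij by linarith
    then show ?thesis
    proof cases
      case 1
      then show ?thesis by (simp add: subgrp_one[OF subgrp_D])
    next
      case 2
      obtain k where k: "k \<in> G" "pm k = id" "sec k x = a j" by (rule fractal[OF a_in_G[OF ij(2)] x])
      have "emb x (commut (a i) (a j)) = commut (emb x (a i)) k"
        using k by (simp add: commut_emb_left)
      then show ?thesis
        using k(1) emb_a_in_G[OF 2 x] by (simp add: D_def commut_subgrp_base)
    next
      case 3
      obtain k where k: "k \<in> G" "pm k = id" "sec k x = a i" by (rule fractal[OF a_in_G[OF ij(1)] x])
      have "emb x (commut (a i) (a j)) = commut k (emb x (a j))"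
        using k by (simp add: commut_emb_right)
      then show ?thesis
        using k(1) emb_a_in_G[OF 3 x] by (simp add: D_def commut_subgrp_base)
    qed
  qed
  then have "D \<subseteq> {g \<in> G. emb x g \<in> D}"
    unfolding D_def
    by (intro commut_subgrp_gen_by[OF normal_emb_preimage[OF normal_D[unfolded D_def] x] G_def])
       (auto intro!: subgrp_commut[OF subgrp_G] a_in_G)
  then show "emb x d \<in> D" using d by auto
qed

definition D' :: "taut set" where
  "D' = commut_subgrp D D"

lemma normal_D': "normal_in D' G"
  unfolding D'_def by (intro normal_in_commut_subgrp normal_D subgrp_G)

lemma D'_D: "D' \<subseteq> D"
  unfolding D'_def by (intro commut_subgrp_least[OF subgrp_D] subgrp_commut[OF subgrp_D])

lemma emb_D': "d \<in> D' \<Longrightarrow> x < m \<Longrightarrow> emb x d \<in> D'"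
proof -
  assume d: "d \<in> D'" and x: "x < m"
  have "commut_subgrp D D \<subseteq> {g \<in> G. emb x g \<in> D'}"
    using D_G emb_D[OF _ x]
    by (intro commut_subgrp_least normal_inD(1)[OF normal_emb_preimage[OF normal_D' x]])
       (auto simp: emb_commut D'_def intro!: subgrp_commut[OF subgrp_G] commut_subgrp_base)
  then show "emb x d \<in> D'" using d by (auto simp: D'_def)
qed


subsection \<open>Direct powers of normal subgroups on the first level\<close>

text \<open>
  The direct power of \<open>Q\<close> that acts below the first level, one factor below each vertex.
\<close>

definition powX :: "taut set \<Rightarrow> taut set" where
  "powX Q = {z. pm z = id \<and> (\<forall>x<m. sec z x \<in> Q) \<and> (\<forall>x\<ge>m. sec z x = 1)}"

lemma powXD: "z \<in> powX Q \<Longrightarrow> pm z = id" "z \<in> powX Q \<Longrightarrow> x < m \<Longrightarrow> sec z x \<in> Q"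
  "z \<in> powX Q \<Longrightarrow> x \<ge> m \<Longrightarrow> sec z x = 1"
  by (auto simp: powX_def)

lemma powX_mono: "Q \<subseteq> R \<Longrightarrow> powX Q \<subseteq> powX R"
  by (auto simp: powX_def)

lemma emb_in_powX: "1 \<in> Q \<Longrightarrow> q \<in> Q \<Longrightarrow> x < m \<Longrightarrow> emb x q \<in> powX Q"
  by (auto simp: powX_def sec_emb)

lemma pm_prod_list_emb: "pm (prod_list (map (\<lambda>x. emb x (F x)) xs)) = id"
  by (induction xs) (simp_all add: pm_mult)

lemma sec_prod_list_emb:
  "distinct xs \<Longrightarrow> sec (prod_list (map (\<lambda>x. emb x (F x)) xs)) y = (if y \<in> set xs then F y else 1)"
  by (induction xs) (simp_all add: sec_mult sec_emb)

lemma powX_subset: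
  assumes H: "subgrp H" and "\<And>x q. x < m \<Longrightarrow> q \<in> Q \<Longrightarrow> emb x q \<in> H"
  shows "powX Q \<subseteq> H"
proof
  fix z assume z: "z \<in> powX Q"
  have "z = prod_list (map (\<lambda>x. emb x (sec z x)) [0..<m])"
    by (rule taut_eqI)
      (simp_all add: powXD(1,3)[OF z] pm_prod_list_emb sec_prod_list_emb del: upt_Suc)
  also have "\<dots> \<in> H" using assms(2) powXD(2)[OF z] by (intro subgrp_prod_list[OF H]) auto
  finally show "z \<in> H" .
qed

lemma subgrp_powX: "subgrp Q \<Longrightarrow> subgrp (powX Q)"
  by (intro subgrpI)
    (auto simp: powX_def subgrp_intros pm_mult sec_mult pm_inverse sec_inverse_fixed inverse_of_one)

lemma powX_D: "Q \<subseteq> D \<Longrightarrow> powX Q \<subseteq> D"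
  using emb_D by (intro powX_subset subgrp_D) auto

lemma powX_G: "Q \<subseteq> D \<Longrightarrow> powX Q \<subseteq> G"
  using powX_D D_G by blast

lemma pm_preimage_less: "k \<in> G \<Longrightarrow> pm k x < m \<longleftrightarrow> x < m"
  using pm_less outside(1) by (metis leI)

lemma sec_conjug_powX:
  assumes "z \<in> powX Q"
  shows "sec (conjug z k) (pm k x) = conjug (sec z x) (sec k x)"
  by (rule sec_conjug) (simp add: powXD(1)[OF assms])

lemma normal_powX:
  assumes Q: "normal_in Q G" and QD: "Q \<subseteq> D"
  shows "normal_in (powX Q) G"
proof (rule normal_inI)
  show "subgrp (powX Q)" by (rule subgrp_powX[OF normal_inD(1)[OF Q]])
  show "powX Q \<subseteq> G" by (rule powX_G[OF QD])
  fix z k assume z: "z \<in> powX Q" and k: "k \<in> G"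
  have *: "sec (conjug z k) y = conjug (sec z (pm (inverse k) y)) (sec k (pm (inverse k) y))"
    and less: "pm (inverse k) y < m \<longleftrightarrow> y < m" for y
    using sec_conjug_powX[OF z, of k "pm (inverse k) y"]
      pm_preimage_less[OF subgrp_inverse[OF subgrp_G k]] by auto
  show "conjug z k \<in> powX Q"
    unfolding powX_def
  proof (intro CollectI conjI allI impI)
    show "pm (conjug z k) = id" by (simp add: pm_conjug_id powXD(1)[OF z])
    show "sec (conjug z k) y \<in> Q" if "y < m" for y
      unfolding * using that less sec_in_G[OF k] powXD(2)[OF z]
      by (intro normal_inD(3)[OF Q]) auto
    show "sec (conjug z k) y = 1" if "y \<ge> m" for y
      unfolding * using that less powXD(3)[OF z] by (simp add: not_less[symmetric])
  qed
qed

lemma powX_nontrivial: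
  assumes "1 \<in> Q" "q \<in> Q" "q \<noteq> 1"
  shows "\<exists>z\<in>powX Q. z \<noteq> 1"
  using assms m emb_in_powX[OF assms(1,2), of 0] emb_eq_1_iff[of 0 q] by auto

lemma powX_eqD:
  assumes "powX Q = powX R" "1 \<in> Q" "1 \<in> R"
  shows "Q = R"
proof -
  have "q \<in> R" if "powX Q \<subseteq> powX R" "1 \<in> Q" "q \<in> Q" for q Q R
    using that emb_in_powX[of Q q 0] powXD(2)[of "emb 0 q" R 0] m by (auto simp: sec_emb)
  from this[of Q R] this[of R Q] show ?thesis using assms by auto
qed

subsection \<open>Nontrivial commutators\<close>

lemma commut_emb_moved:
  assumes "pm k x \<noteq> x" "g \<noteq> 1"
  shows "commut (emb x g) k \<noteq> 1"
proof
  assume "commut (emb x g) k = 1"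
  then have "emb x g = conjug (emb x g) k" by (simp add: conjug_as_commut)
  then have "sec (emb x g) x = sec (emb (pm k x) (conjug g (sec k x))) x" by (simp add: conjug_emb)
  then show False using assms by (auto simp: sec_emb)
qed

lemma pm_a_0_moves: "x < m \<Longrightarrow> pm (a 0) x \<noteq> x"
  using m by (auto simp: pm_a_0 rot_def mod_if)

lemma pm_inverse_a_0_moves: "x < m \<Longrightarrow> pm (inverse (a 0)) x \<noteq> x"
  using pm_a_0_moves[of x] by (metis pm_inverse_pm(2))

lemma a_0_neq_1: "a 0 \<noteq> 1"
  using pm_a_0_moves[of 0] m by auto

lemma sec_commut_a_1_a_0: "sec (commut (a 1) (a 0)) t = inverse (a 0)"
proof -
  have "commut (a 1) (a 0) = inverse (emb t (a 0)) * conjug (emb t (a 0)) (a 0)"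
    using a_Suc[of 0] by (simp add: commut_def conjug_def group_simps)
  then show ?thesis
    using pm_a_0_moves[OF t] by (simp add: conjug_emb emb_inverse[symmetric] sec_mult sec_emb)
qed

lemma commut_a_1_a_0_D: "commut (a 1) (a 0) \<in> D"
  unfolding D_def using a_in_G s by (intro commut_subgrp_base) auto

lemma D_nontrivial: "\<exists>d\<in>D. d \<noteq> 1"
proof
  show "commut (a 1) (a 0) \<noteq> 1"
    using sec_commut_a_1_a_0 a_0_neq_1 by (metis inverse_eq_1_iff sec_one)
qed (rule commut_a_1_a_0_D)

lemma D'_nontrivial: "\<exists>d\<in>D'. d \<noteq> 1"
proof -
  obtain d where d: "d \<in> D" "d \<noteq> 1" using D_nontrivial by auto
  have z: "emb 0 d \<in> D" using d m by (intro emb_D) auto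
  have "commut (commut (a 1) (a 0)) (emb t (emb 0 d)) = emb t (commut (inverse (a 0)) (emb 0 d))"
    by (simp only: commut_emb_right[OF pm_D[OF commut_a_1_a_0_D]] sec_commut_a_1_a_0)
  moreover have "commut (inverse (a 0)) (emb 0 d) \<noteq> 1"
    using commut_emb_moved[OF pm_inverse_a_0_moves d(2), of 0] m
    by (metis inverse_commut inverse_eq_1_iff not_numeral_le_zero zero_less_iff_neq_zero)
  ultimately show ?thesis
    using commut_subgrp_base[OF commut_a_1_a_0_D emb_D[OF z t]] emb_eq_1_iff unfolding D'_def by metis
qed

lemma powX_D_neq_D: "powX D \<noteq> D"
proof
  assume "powX D = D"
  then have "inverse (a 0) \<in> D"
    using powXD(2)[of "commut (a 1) (a 0)" D t] t commut_a_1_a_0_D sec_commut_a_1_a_0 by auto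
  then show False using pm_D pm_inverse_a_0_moves[of 0] m by fastforce
qed

subsection \<open>Nontrivial normal subgroups\<close>

lemma embw_one: "embw w 1 = 1"
  and embw_mult: "embw w (g * h) = embw w g * embw w h"
  and embw_inverse: "embw w (inverse g) = inverse (embw w g)"
  by (induction w) (simp_all add: emb_mult emb_inverse)

lemma embw_D: "d \<in> D \<Longrightarrow> w \<in> lists {..<m} \<Longrightarrow> embw w d \<in> D"
  by (induction w) (auto intro: emb_D)

text \<open>
  Take for \<open>w\<close> a vertex that is moved by \<open>k\<close> while its parent is fixed.
\<close>

lemma ex_commut_commut_embw:
  assumes "k \<in> G" "k \<noteq> 1"
  shows "\<exists>w\<in>lists {..<m}. \<forall>g h. commut (commut k (embw w g)) (embw w h) = embw w (commut g h)"
proof -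
  obtain u where "portrait k u \<noteq> id" using assms(2) taut_eqI_portrait portrait_one by metis
  then show ?thesis using assms(1)
  proof (induction u arbitrary: k)
    case Nil
    then obtain x where x: "pm k x \<noteq> x" by (auto simp: portrait_Nil fun_eq_iff)
    then have "x < m" using outside(1)[OF Nil(2)] by (metis leI)
    then show ?case using commut_commut_moved[OF x] by (intro bexI[of _ "[x]"]) auto
  next
    case (Cons y u)
    show ?case
    proof (cases "pm k = id")
      case False
      then obtain x where x: "pm k x \<noteq> x" by (auto simp: fun_eq_iff)
      then have "x < m" using outside(1)[OF Cons.prems(2)] by (metis leI)
      then show ?thesis using commut_commut_moved[OF x] by (intro bexI[of _ "[x]"]) auto
    next
      case True
      have "portrait (sec k y) u \<noteq> id" using Cons.prems(1) unfolding portrait_Cons .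
      moreover from this have y: "y < m"
        using outside(2)[OF Cons.prems(2)] portrait_one by (metis leI)
      ultimately obtain w where "w \<in> lists {..<m}"
        "\<And>g h. commut (commut (sec k y) (embw w g)) (embw w h) = embw w (commut g h)"
        using Cons.IH[of "sec k y"] sec_in_G[OF Cons.prems(2)] by blast
      then show ?thesis
        using y by (intro bexI[of _ "y # w"]) (auto simp: True commut_emb_right emb_commut[symmetric])
    qed
  qed
qed

text \<open>
  The level of \<open>w\<close> is a single orbit of \<open>G\<close>, so a normal subgroup that contains the copy of \<open>Z\<close> below \<open>w\<close>
  contains all copies on this level.
\<close>

lemma powX_funpow_subset:
  assumes "Z \<subseteq> D"
  shows "w \<in> lists {..<m} \<Longrightarrow> normal_in K G \<Longrightarrow> embw w ` Z \<subseteq> K \<Longrightarrow> (powX ^^ length w) Z \<subseteq> K"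
proof (induction w arbitrary: K)
  case (Cons x w)
  then have x: "x < m" and w: "w \<in> lists {..<m}" by auto
  have "embw w ` Z \<subseteq> {g \<in> G. emb x g \<in> K}"
    using Cons.prems(3) embw_D[OF _ w] assms D_G by auto
  then have *: "(powX ^^ length w) Z \<subseteq> {g \<in> G. emb x g \<in> K}"
    by (rule Cons.IH[OF w normal_emb_preimage[OF Cons.prems(2) x]])
  have "powX ((powX ^^ length w) Z) \<subseteq> K"
  proof (rule powX_subset[OF normal_inD(1)[OF Cons.prems(2)]])
    fix y z assume y: "y < m" and z: "z \<in> (powX ^^ length w) Z"
    obtain k where k: "k \<in> G" "pm k x = y" "sec k x = 1"
      by (rule fractal_transitive[OF subgrp_one[OF subgrp_G] x y])
    have "conjug (emb x z) k \<in> K" using * z k normal_inD(3)[OF Cons.prems(2)] by auto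
    then show "emb y z \<in> K" using k by (simp add: conjug_emb)
  qed
  then show ?case by simp
qed auto

theorem normal_contains_powX_D':
  assumes K: "normal_in K G" and k: "k \<in> K" "k \<noteq> 1"
  shows "\<exists>n. (powX ^^ n) D' \<subseteq> K"
proof -
  note nK = normal_inD[OF K]
  obtain w where w: "w \<in> lists {..<m}"
    "\<And>g h. commut (commut k (embw w g)) (embw w h) = embw w (commut g h)"
    using ex_commut_commut_embw[of k] k nK(2) by blast
  have "subgrp {g. embw w g \<in> K}"
    using nK(1) by (intro subgrpI) (auto simp: embw_one embw_mult embw_inverse subgrp_intros)
  moreover have "embw w (commut g h) \<in> K" if "g \<in> D" "h \<in> D" for g h
  proof -
    have c: "commut k (embw w g) \<in> K"
      using embw_D[OF that(1) w(1)] D_G k by (intro normal_in_commut(1)[OF K subgrp_G]) auto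
    have "commut (commut k (embw w g)) (embw w h) \<in> K"
      using embw_D[OF that(2) w(1)] D_G by (intro normal_in_commut(1)[OF K subgrp_G c]) auto
    then show ?thesis by (simp add: w(2))
  qed
  ultimately have "D' \<subseteq> {g. embw w g \<in> K}"
    unfolding D'_def by (intro commut_subgrp_least) auto
  then have "(powX ^^ length w) D' \<subseteq> K" by (intro powX_funpow_subset[OF D'_D w(1) K]) auto
  then show ?thesis by blast
qed

lemma one_in_powX_funpow: "1 \<in> (powX ^^ n) D'"
  and powX_funpow_D'_nontrivial: "\<exists>q\<in>(powX ^^ n) D'. q \<noteq> 1"
  and powX_funpow_D'_D: "(powX ^^ n) D' \<subseteq> D"
proof (induction n)
  case 0
  show "1 \<in> (powX ^^ 0) D'" using subgrp_one[OF normal_inD(1)[OF normal_D']] by simp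
  show "\<exists>q\<in>(powX ^^ 0) D'. q \<noteq> 1" using D'_nontrivial by simp
  show "(powX ^^ 0) D' \<subseteq> D" using D'_D by simp
next
  case (Suc n)
  show "1 \<in> (powX ^^ Suc n) D'" using Suc(1) emb_in_powX[OF Suc(1,1), of 0] m by simp
  show "\<exists>q\<in>(powX ^^ Suc n) D'. q \<noteq> 1" using Suc(1,2) powX_nontrivial by auto
  show "(powX ^^ Suc n) D' \<subseteq> D" using powX_D[OF Suc(3)] by simp
qed

lemma normal_Int_D_nontrivial:
  assumes "normal_in K G" "k \<in> K" "k \<noteq> 1"
  shows "\<exists>z\<in>K \<inter> D. z \<noteq> 1"
  using normal_contains_powX_D'[OF assms] powX_funpow_D'_nontrivial powX_funpow_D'_D by blast

lemma powX_funpow_mono: "Q \<subseteq> R \<Longrightarrow> (powX ^^ n) Q \<subseteq> (powX ^^ n) R"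
  by (induction n) (auto intro: powX_mono[THEN subsetD])

lemma powX_D': "powX D' \<subseteq> D'"
  using emb_D' by (intro powX_subset normal_inD(1)[OF normal_D']) auto

lemma powX_funpow_D'_antimono: "(powX ^^ (n + k)) D' \<subseteq> (powX ^^ n) D'"
proof (induction k)
  case (Suc k)
  have "(powX ^^ (n + Suc k)) D' = (powX ^^ (n + k)) (powX D')" by (simp add: funpow_swap1)
  also have "\<dots> \<subseteq> (powX ^^ (n + k)) D'" by (rule powX_funpow_mono[OF powX_D'])
  finally show ?case using Suc by simp
qed simp

text \<open>
  Conjugation by \<open>z\<close> moves the copy of a nontrivial element below a vertex if it moves the vertex.
\<close>

lemma centralizer_powX_funpow:
  "z \<in> G \<Longrightarrow> (\<And>q. q \<in> (powX ^^ n) D' \<Longrightarrow> commut q z = 1) \<Longrightarrow> length u < n \<Longrightarrow> portrait z u = id"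
proof (induction n arbitrary: z u)
  case (Suc n)
  have e: "emb x q \<in> (powX ^^ Suc n) D'" if "q \<in> (powX ^^ n) D'" "x < m" for x q
    using emb_in_powX[OF one_in_powX_funpow that] by simp
  obtain q where q: "q \<in> (powX ^^ n) D'" "q \<noteq> 1" using powX_funpow_D'_nontrivial by auto
  have "pm z x = x" if "x < m" for x
    using commut_emb_moved[of z x q] Suc.prems(2)[OF e[OF q(1) that]] q(2) by auto
  then have z: "pm z = id" using pm_id_of_fixed[OF Suc.prems(1), of 0] m by auto
  show ?case
  proof (cases u)
    case Nil
    then show ?thesis by (simp add: portrait_Nil z)
  next
    case (Cons x v)
    show ?thesis
    proof (cases "x < m")
      case True
      have "commut q (sec z x) = 1" if "q \<in> (powX ^^ n) D'" for q
        using Suc.prems(2)[OF e[OF that True]] by (simp add: commut_emb_left z emb_eq_1_iff)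
      then have "portrait (sec z x) v = id"
        using Suc.prems(3) Cons by (intro Suc.IH sec_in_G[OF Suc.prems(1) True]) auto
      then show ?thesis by (simp add: Cons portrait_Cons)
    next
      case False
      then show ?thesis using outside(2)[OF Suc.prems(1), of x] by (simp add: Cons portrait_Cons portrait_one)
    qed
  qed
qed simp

lemma centralizer_trivial:
  assumes J: "normal_in J G" "j \<in> J" "j \<noteq> 1" and z: "z \<in> G" "\<And>q. q \<in> J \<Longrightarrow> commut q z = 1"
  shows "z = 1"
proof (rule taut_eqI_portrait)
  fix u
  obtain n where n: "(powX ^^ n) D' \<subseteq> J" using normal_contains_powX_D'[OF J] by auto
  have "portrait z u = id"
    using n powX_funpow_D'_antimono[of n "Suc (length u)"] z
    by (intro centralizer_powX_funpow[where n = "n + Suc (length u)"]) auto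
  then show "portrait z u = portrait 1 u" by (simp add: portrait_one)
qed


subsection \<open>Proper quotients\<close>

definition \<gamma>3 :: "taut set" where
  "\<gamma>3 = commut_subgrp D G"

text \<open>
  The copies of \<open>a\<^sub>i\<close> below two vertices \<open>x\<close> and \<open>x'\<close> are conjugate in \<open>G\<close>, so their quotient \<open>y\<close> is in
  \<open>D\<close>. Its section at \<open>x\<close> is \<open>a\<^sub>i\<close>, whence \<open>[y, emb x g]\<close> is \<open>[a\<^sub>i, g]\<close> placed below \<open>x\<close>.
\<close>

lemma emb_commut_a_D:
  assumes i: "i < s - 1" and g: "g \<in> D" and x: "x < m"
  shows "emb x (commut (a i) g) \<in> D'"
proof -
  define x' where "x' = pm (a 0) x"
  have x': "x' < m" "x' \<noteq> x"
    using pm_a_0_moves[OF x] pm_less[OF a_in_G x, of 0] s by (auto simp: x'_def)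
  obtain k where k: "k \<in> G" "pm k x = x'" "sec k x = 1"
    by (rule fractal_transitive[OF subgrp_one[OF subgrp_G] x x'(1)])
  define y where "y = commut k (emb x (a i))"
  have "y = inverse (conjug (emb x (a i)) k) * emb x (a i)"
    by (simp add: y_def conjug_def commut_def group_simps)
  then have "sec y x = a i"
    using x' k by (simp add: conjug_emb emb_inverse[symmetric] sec_mult sec_emb)
  moreover have yD: "y \<in> D"
    unfolding y_def D_def by (intro commut_subgrp_base k(1) emb_a_in_G[OF i x])
  ultimately have "emb x (commut (a i) g) = commut y (emb x g)"
    by (simp only: commut_emb_right[OF pm_D[OF yD]])
  then show ?thesis using yD emb_D[OF g x] by (simp add: D'_def commut_subgrp_base)
qed

text \<open>
  Let \<open>B\<close> consist of the elements whose copy below \<open>x\<close> is in \<open>D'\<close>. The claim is that \<open>D\<close> is central modulo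
  \<open>B\<close>, and it has to be checked for the commutators of the generators. Modulo \<open>B\<close>, the generators
  other than \<open>b = a\<^sub>s\<^sub>-\<^sub>1\<close> centralize \<open>D\<close> by the preceding lemma, so it remains to see that \<open>b\<close> commutes with
  these commutators. For \<open>[a\<^sub>i, a\<^sub>j]\<close> with \<open>i, j < s - 1\<close> this follows from the Hall-Witt identity. For
  \<open>[a\<^sub>i, b]\<close> it comes from relations of \<open>G\<close>: if \<open>i > 0\<close>, then \<open>a\<^sub>i\<close> commutes with the conjugate \<open>bd\<close> of \<open>b\<close> by
  \<open>a\<^sub>0\<close>, where \<open>d = [b, a\<^sub>0] \<in> D\<close>. This gives \<open>[a\<^sub>i, b] \<in> B\<close> for \<open>0 < i < s - 1\<close>, and \<open>[b, d] = 1\<close> for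
  \<open>i = s - 1\<close>, which settles \<open>[a\<^sub>0, b] = d\<^sup>-\<^sup>1\<close>.
\<close>

lemma emb_\<gamma>3: 
  assumes z: "z \<in> \<gamma>3" and x: "x < m"
  shows "emb x z \<in> D'"
proof -
  define B where "B = {z \<in> G. emb x z \<in> D'}"
  have B: "normal_in B G" unfolding B_def by (rule normal_emb_preimage[OF normal_D' x])
  note nB = normal_inD[OF B]
  have D'B: "D' \<subseteq> B" using emb_D'[OF _ x] D'_D D_G by (auto simp: B_def)
  \<comment> \<open>the centralizer of \<open>D\<close> modulo \<open>B\<close>\<close>
  define C where "C = {h \<in> G. \<forall>g\<in>D. commut h g \<in> B}"
  have C_eq: "C = G \<inter> (\<Inter>g\<in>D. {h \<in> G. commut h g \<in> B})" by (auto simp: C_def)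
  have "subgrp (\<Inter>g\<in>D. {h \<in> G. commut h g \<in> B})"
    using subgrp_commut_left[OF B subgrp_G] D_G by (auto simp: subgrp_def)
  then have C: "subgrp C" unfolding C_eq by (rule subgrp_Int[OF subgrp_G])
  have aC: "a i \<in> C" if "i < s - 1" for i
    using emb_commut_a_D[OF that _ x] that a_in_G[of i] subgrp_commut[OF subgrp_G] D_G
    by (auto simp: C_def B_def)
  have DG: "commut d g \<in> B" "commut g d \<in> B" if "g \<in> C" "d \<in> D" for g d
  proof -
    show "commut g d \<in> B" using that by (simp add: C_def)
    then show "commut d g \<in> B" using subgrp_inverse[OF nB(1)] inverse_commut by metis
  qed
  have DDB: "commut d e \<in> B" if "d \<in> D" "e \<in> D" for d e
    using commut_subgrp_base[OF that] D'B by (auto simp: D'_def)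
  \<comment> \<open>by the Hall-Witt identity, commutators of elements of \<open>C\<close> are central modulo \<open>B\<close>\<close>
  have CC: "commut (commut x y) z \<in> B" if "x \<in> C" "y \<in> C" "z \<in> G" for x y z
  proof -
    define w where "w = inverse y"
    have y: "y = inverse w" by (simp add: w_def group_simps)
    have w: "w \<in> C" "w \<in> G" and xG: "x \<in> G"
      using that subgrp_inverse[OF C] by (auto simp: w_def C_def)
    have "commut w (inverse z) \<in> D" "commut z (inverse x) \<in> D"
      unfolding D_def using w(2) that(3) xG subgrp_inverse[OF subgrp_G]
      by (auto intro!: commut_subgrp_base)
    then have "commut (commut w (inverse z)) x \<in> B" "commut (commut z (inverse x)) w \<in> B"
      using DG(1) that(1) w(1) by auto
    then have "conjug (commut (commut w (inverse z)) x) z \<in> B"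
      "conjug (commut (commut z (inverse x)) w) x \<in> B"
      using nB(3) that(3) xG by auto
    moreover have "conjug (commut (commut x (inverse w)) z) w
      * (conjug (commut (commut w (inverse z)) x) z * conjug (commut (commut z (inverse x)) w) x) = 1"
      using Hall_Witt[of x w z] by (simp add: mult.assoc)
    ultimately have "conjug (commut (commut x (inverse w)) z) w \<in> B"
      using subgrp_mult_right_iff[OF nB(1)] subgrp_mult[OF nB(1)] subgrp_one[OF nB(1)] by metis
    then have "conjug (conjug (commut (commut x (inverse w)) z) w) (inverse w) \<in> B"
      using nB(3) subgrp_inverse[OF subgrp_G w(2)] by blast
    then show ?thesis by (simp add: y)
  qed
  let ?b = "a (s - 1)"
  define d where "d = commut ?b (a 0)"
  have s1: "s - 1 < s" "0 < s" using s by auto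
  have dD: "d \<in> D" unfolding d_def D_def by (intro commut_subgrp_base a_in_G s1)
  \<comment> \<open>\<open>a\<^sub>i\<close> and the conjugate of \<open>a\<^sub>s\<^sub>-\<^sub>1\<close> by \<open>a\<^sub>0\<close> live below different vertices\<close>
  have rel: "commut (a i) (?b * d) = 1" if "i > 0" for i
  proof -
    have "s - 1 > 0" using s by simp
    then obtain j k where jk: "i = Suc j" "s - 1 = Suc k"
      using \<open>i > 0\<close> gr0_implies_Suc by blast
    have "?b * d = conjug ?b (a 0)" by (simp add: d_def conjug_as_commut)
    also have "\<dots> = emb (pm (a 0) t) (conjug (a k) (sec (a 0) t))"
      by (simp only: jk(2) a_Suc conjug_emb)
    finally have "?b * d = emb (pm (a 0) t) (conjug (a k) (sec (a 0) t))" .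
    then show ?thesis
      using pm_a_0_moves[OF t] emb_commute[of t "pm (a 0) t"] by (simp add: jk(1) a_Suc commut_eq_1_iff)
  qed
  have cb: "commut (commut (a i) ?b) ?b \<in> B" if i: "i < s - 1" for i
  proof (cases "i = 0")
    case True
    have "commut ?b d = 1" using rel[of "s - 1"] s by (simp add: commut_mult_right)
    then have "commut d ?b = 1" using inverse_commut[of ?b d] by (simp add: inverse_of_one)
    then have "commut (inverse d) ?b = 1" by (simp add: commut_inverse_left inverse_of_one)
    moreover have "inverse d = commut (a 0) ?b" by (simp add: d_def inverse_commut)
    ultimately show ?thesis using True subgrp_one[OF nB(1)] by simp
  next
    case False
    have dG: "d \<in> G" using dD D_G by auto
    have "commut (a i) d * conjug (commut (a i) ?b) d \<in> B"
      using rel[of i] False subgrp_one[OF nB(1)] by (simp add: commut_mult_right)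
    then have "conjug (commut (a i) ?b) d \<in> B"
      using DG(2)[OF aC[OF i] dD] subgrp_mult_left_iff[OF nB(1)] by blast
    then have "conjug (conjug (commut (a i) ?b) d) (inverse d) \<in> B"
      using nB(3) subgrp_inverse[OF subgrp_G dG] by blast
    then have "commut (a i) ?b \<in> B" by simp
    then show ?thesis by (rule normal_in_commut(1)[OF B subgrp_G _ a_in_G[OF s1(1)]])
  qed
  define E where "E = {g \<in> G. \<forall>h\<in>G. commut g h \<in> B}"
  have E: "normal_in E G"
  proof (rule normal_inI)
    have E_eq: "E = G \<inter> (\<Inter>h\<in>G. {g \<in> G. commut g h \<in> B})" by (auto simp: E_def)
    have "subgrp (\<Inter>h\<in>G. {g \<in> G. commut g h \<in> B})"
      using subgrp_commut_left[OF B subgrp_G] by (auto simp: subgrp_def)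
    then show "subgrp E" unfolding E_eq by (rule subgrp_Int[OF subgrp_G])
    fix n g assume n: "n \<in> E" and g: "g \<in> G"
    have "commut (conjug n g) h \<in> B" if h: "h \<in> G" for h
    proof -
      have "commut (conjug n g) h = conjug (commut n (conjug h (inverse g))) g"
        by (simp add: conjug_commut)
      moreover have "conjug h (inverse g) \<in> G"
        by (intro subgrp_conjug[OF subgrp_G h] subgrp_inverse[OF subgrp_G g])
      ultimately show ?thesis using n g nB(3) by (simp add: E_def)
    qed
    then show "conjug n g \<in> E" using n g subgrp_conjug[OF subgrp_G] by (simp add: E_def)
  qed (auto simp: E_def)
  have comm_E: "commut (a i) (a j) \<in> E" if ij: "i < s" "j < s" for i j
  proof -
    let ?c = "commut (a i) (a j)"
    have cD: "?c \<in> D" unfolding D_def by (intro commut_subgrp_base a_in_G ij)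
    have "commut ?c (a l) \<in> B" if l: "l < s" for l
    proof (cases "l = s - 1")
      case False
      then show ?thesis using l by (intro DG(1)[OF aC cD]) auto
    next
      case True
      consider "i < s - 1" "j < s - 1" | "i < s - 1" "j = s - 1" | "i = s - 1" "j < s - 1"
        | "i = j" using ij by linarith
      then show ?thesis
      proof cases
        case 1
        then show ?thesis using l by (intro CC aC a_in_G)
      next
        case 2
        then show ?thesis using cb True by simp
      next
        case 3
        let ?e = "commut (a j) ?b"
        have "commut ?e ?b \<in> B" by (rule cb[OF 3(2)])
        moreover have "?e \<in> G" "?b \<in> G"
          using ij by (auto intro!: subgrp_commut[OF subgrp_G] a_in_G)
        ultimately have "commut (inverse ?e) ?b \<in> B"
          unfolding commut_inverse_left using nB(3) subgrp_inverse[OF nB(1)] subgrp_inverse[OF subgrp_G]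
          by blast
        then show ?thesis using 3 True by (simp add: inverse_commut)
      qed (simp add: subgrp_one[OF nB(1)])
    qed
    moreover have cG: "?c \<in> G" using cD D_G by auto
    ultimately have "G \<subseteq> {h \<in> G. commut ?c h \<in> B}"
      unfolding G_def using subgrp_commut_right[OF B subgrp_G cG] a_in_G
      by (intro gen_by_subset) (auto simp: G_def)
    then show ?thesis using cG by (auto simp: E_def)
  qed
  have "D \<subseteq> E"
    unfolding D_def using comm_E by (intro commut_subgrp_gen_by[OF E G_def]) auto
  then have "\<gamma>3 \<subseteq> B"
    unfolding \<gamma>3_def using nB(1) by (intro commut_subgrp_least) (auto simp: E_def)
  then show ?thesis using z by (auto simp: B_def)
qed

lemma powX_\<gamma>3: "powX \<gamma>3 \<subseteq> D'"
  using emb_\<gamma>3 by (intro powX_subset normal_inD(1)[OF normal_D']) auto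

primrec level_stab :: "nat \<Rightarrow> taut set" where
  "level_stab 0 = G"
| "level_stab (Suc n) = {g \<in> G. pm g = id \<and> (\<forall>x<m. sec g x \<in> level_stab n)}"

lemma normal_level_stab: "normal_in (level_stab n) G"
proof (induction n)
  case (Suc n)
  note nS = normal_inD[OF Suc]
  show ?case
  proof (rule normal_inI)
    show "subgrp (level_stab (Suc n))"
      using subgrp_G nS(1)
      by (intro subgrpI) (auto simp: subgrp_intros pm_mult sec_mult pm_inverse sec_inverse_fixed)
    fix g k assume g: "g \<in> level_stab (Suc n)" and k: "k \<in> G"
    have "sec (conjug g k) y \<in> level_stab n" if "y < m" for y
    proof -
      let ?x = "pm (inverse k) y"
      have x: "?x < m" using pm_less[OF subgrp_inverse[OF subgrp_G k] that] .
      have "sec (conjug g k) (pm k ?x) = conjug (sec g ?x) (sec k ?x)"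
        using g by (intro sec_conjug) simp
      then show ?thesis using g x nS(3) sec_in_G[OF k x] by simp
    qed
    then show "conjug g k \<in> level_stab (Suc n)"
      using g k subgrp_conjug[OF subgrp_G] by (simp add: pm_conjug_id)
  qed auto
qed (simp add: normal_in_self subgrp_G)

text \<open>
  A coset of the stabilizer of level \<open>n + 1\<close> is determined by the action on the first level and by the
  cosets of the sections with respect to the stabilizer of level \<open>n\<close>.
\<close>

lemma finite_index_level_stab: "finite_index (level_stab n) G"
proof (induction n)
  case 0
  show ?case using subgrp_G
    by (intro finite_indexI[where f = "\<lambda>_. ()"]) (auto intro!: subgrp_mult subgrp_inverse)
next
  case (Suc n)
  let ?S = "level_stab n"
  let ?f = "\<lambda>g. (map (pm g) [0..<m], map (\<lambda>x. right_coset ?S (sec g x)) [0..<m])"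
  have sS: "subgrp ?S" by (rule normal_inD(1)[OF normal_level_stab])
  have "?f ` G \<subseteq> {xs. set xs \<subseteq> {..<m} \<and> length xs = m} \<times>
      {xs. set xs \<subseteq> right_coset ?S ` G \<and> length xs = m}"
    using pm_less sec_in_G by auto
  moreover have "finite \<dots>"
    using Suc by (intro finite_cartesian_product finite_lists_length_eq) (auto simp: finite_index_def)
  ultimately have "finite (?f ` G)" by (rule finite_subset)
  moreover have "g * inverse h \<in> level_stab (Suc n)" if gh: "g \<in> G" "h \<in> G" "?f g = ?f h" for g h
  proof -
    have p: "pm g x = pm h x" and q: "sec g x * inverse (sec h x) \<in> ?S" if "x < m" for x
      using gh(3) that right_coset_eq_iff[OF sS] by auto
    have fixed: "pm (g * inverse h) x = x" if "x < m" for x using p[OF that] by (simp add: pm_mult)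
    have gG: "g * inverse h \<in> G" using gh subgrp_mult[OF subgrp_G] subgrp_inverse[OF subgrp_G] by auto
    have "sec (g * inverse h) x \<in> ?S" if "x < m" for x
      using q[OF that] p[OF that] sec_inverse[of h x] by (simp add: sec_mult)
    then show ?thesis using pm_id_of_fixed[OF gG, of 0] fixed m gG by auto
  qed
  ultimately show ?case by (intro finite_indexI[OF normal_inD(1)[OF normal_level_stab]])
qed

lemma commut_level_stab:
  "commut_subgrp (level_stab n) (level_stab n) \<subseteq> (powX ^^ n) D"
proof (induction n)
  case (Suc n)
  have D: "subgrp ((powX ^^ k) D)" for k by (induction k) (auto intro: subgrp_D subgrp_powX)
  show ?case
  proof (rule commut_subgrp_least[OF D])
    fix g h assume gh: "g \<in> level_stab (Suc n)" "h \<in> level_stab (Suc n)"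
    have "sec (commut g h) x \<in> (powX ^^ n) D" if "x < m" for x
      using gh that Suc commut_subgrp_base[of "sec g x" "level_stab n" "sec h x"]
      by (auto simp: sec_commut)
    then show "commut g h \<in> (powX ^^ Suc n) D"
      using gh outside(2) by (auto simp: powX_def sec_commut pm_commut_id)
  qed
qed (simp add: D_def)

lemma commut_powX_level_stab:
  "commut_subgrp ((powX ^^ n) D) (level_stab n) \<subseteq> (powX ^^ n) \<gamma>3"
proof (induction n)
  case (Suc n)
  have \<gamma>3: "subgrp ((powX ^^ k) \<gamma>3)" for k
    by (induction k) (auto simp: \<gamma>3_def intro: subgrp_commut_subgrp subgrp_powX)
  show ?case
  proof (rule commut_subgrp_least[OF \<gamma>3])
    fix g h assume gh: "g \<in> (powX ^^ Suc n) D" "h \<in> level_stab (Suc n)"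
    then have g: "pm g = id" "\<And>x. x < m \<Longrightarrow> sec g x \<in> (powX ^^ n) D" "\<And>x. x \<ge> m \<Longrightarrow> sec g x = 1"
      by (auto dest: powXD)
    have "sec (commut g h) x \<in> (powX ^^ n) \<gamma>3" if "x < m" for x
      using g gh(2) that Suc commut_subgrp_base[of "sec g x" "(powX ^^ n) D" "sec h x" "level_stab n"]
      by (auto simp: sec_commut)
    then show "commut g h \<in> (powX ^^ Suc n) \<gamma>3"
      using g gh(2) by (auto simp: powX_def sec_commut pm_commut_id)
  qed
qed (simp add: \<gamma>3_def)

text \<open>
  If \<open>M\<close> contains \<open>K\<close>, then it contains the copies of \<open>D'\<close> on some level \<open>n\<close>, hence those of \<open>\<gamma>3\<close> on level
  \<open>n + 1\<close>. Together they generate a group that contains the third term of the lower central series of the stabilizer of level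
  \<open>n + 1\<close>.
\<close>

theorem maximal_infinite_index_core_free:
  assumes M: "maximal_in M G" and inf: "\<not> finite_index M G"
    and K: "normal_in K G" "K \<subseteq> M" and k: "k \<in> K"
  shows "k = 1"
proof (rule ccontr)
  assume "k \<noteq> 1"
  then obtain n where n: "(powX ^^ n) D' \<subseteq> K" using normal_contains_powX_D'[OF K(1) k] by auto
  let ?S = "level_stab (Suc n)"
  have "commut_subgrp (commut_subgrp ?S ?S) ?S \<subseteq> commut_subgrp ((powX ^^ Suc n) D) ?S"
    by (intro commut_subgrp_mono commut_level_stab subset_refl)
  also have "\<dots> \<subseteq> (powX ^^ Suc n) \<gamma>3" by (rule commut_powX_level_stab)
  also have "\<dots> = (powX ^^ n) (powX \<gamma>3)" by (simp add: funpow_swap1)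
  also have "\<dots> \<subseteq> (powX ^^ n) D'" by (rule powX_funpow_mono[OF powX_\<gamma>3])
  finally have nil: "commut_subgrp (commut_subgrp ?S ?S) ?S \<subseteq> M" using n K(2) by blast
  have "finite_index M G"
    by (rule maximal_in_virtually_nilpotent[OF _ G_def M normal_level_stab finite_index_level_stab nil])
      simp
  then show False using inf by simp
qed


section \<open>Sections of core-free maximal subgroups\<close>

text \<open>
  For a maximal subgroup, being core-free means \<open>MN = G\<close> for each nontrivial normal subgroup \<open>N\<close> of \<open>G\<close>; it
  is used in this form.
\<close>

definition core_free_maximal :: "taut set \<Rightarrow> bool" where
  "core_free_maximal M \<longleftrightarrow> maximal_in M G \<and> (\<forall>K. normal_in K G \<longrightarrow> K \<subseteq> M \<longrightarrow> K \<subseteq> {1})"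

definition proj :: "taut set \<Rightarrow> nat \<Rightarrow> taut set" where
  "proj M x = {sec g x |g. g \<in> M \<and> pm g = id}"

lemma cfm_maximal: "core_free_maximal M \<Longrightarrow> maximal_in M G"
  and cfm_subgrp: "core_free_maximal M \<Longrightarrow> subgrp M"
  and cfm_G: "core_free_maximal M \<Longrightarrow> M \<subseteq> G"
  by (auto simp: core_free_maximal_def maximal_in_def)

lemma invariant_under_subset: "normal_in K G \<Longrightarrow> M \<subseteq> G \<Longrightarrow> invariant_under K M"
  by (auto simp: normal_in_def invariant_under_def)

lemma cfm_product:
  assumes M: "core_free_maximal M" and K: "normal_in K G" "k \<in> K" "k \<noteq> 1" and g: "g \<in> G"
  shows "\<exists>h\<in>M. \<exists>n\<in>K. g = h * n"
proof -
  have "\<not> K \<subseteq> M" using M K by (auto simp: core_free_maximal_def)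
  then obtain h n where "h \<in> M" "n \<in> K" "g = h * n"
    by (rule maximal_in_product[OF cfm_maximal[OF M] subgrp_G normal_inD(1,2)[OF K(1)]
      invariant_under_subset[OF K(1) cfm_G[OF M]] _ g])
  then show ?thesis by blast
qed

lemma cfm_product_powX:
  assumes M: "core_free_maximal M" and Q: "normal_in Q G" "Q \<subseteq> D" "q \<in> Q" "q \<noteq> 1" and g: "g \<in> G"
  shows "\<exists>h\<in>M. \<exists>n\<in>powX Q. g = h * n"
proof -
  obtain z where "z \<in> powX Q" "z \<noteq> 1"
    using powX_nontrivial[OF subgrp_one[OF normal_inD(1)[OF Q(1)]] Q(3,4)] by auto
  then show ?thesis by (rule cfm_product[OF M normal_powX[OF Q(1,2)] _ _ g])
qed

lemma cfm_transitive:
  assumes M: "core_free_maximal M" and xy: "x < m" "y < m"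
  shows "\<exists>h\<in>M. pm h x = y"
proof -
  obtain g where g: "g \<in> G" "pm g x = y" "sec g x = 1"
    by (rule fractal_transitive[OF subgrp_one[OF subgrp_G] xy])
  obtain d where "d \<in> D" "d \<noteq> 1" using D_nontrivial by auto
  then obtain h n where "h \<in> M" "n \<in> powX D" "g = h * n"
    using cfm_product_powX[OF M normal_D subset_refl _ _ g(1)] by blast
  then show ?thesis using g(2) powXD(1)[of n D] by (intro bexI[of _ h]) (auto simp: pm_mult)
qed

lemma subgrp_proj:
  assumes "subgrp M"
  shows "subgrp (proj M x)"
proof (rule subgrpI)
  show "1 \<in> proj M x" using subgrp_one[OF assms] unfolding proj_def by force
  show "g * h \<in> proj M x" if gh: "g \<in> proj M x" "h \<in> proj M x" for g h
  proof -
    obtain k l where "k \<in> M" "pm k = id" "g = sec k x" "l \<in> M" "pm l = id" "h = sec l x"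
      using gh by (auto simp: proj_def)
    then have "k * l \<in> M" "pm (k * l) = id" "g * h = sec (k * l) x"
      using subgrp_mult[OF assms] by (auto simp: pm_mult sec_mult)
    then show ?thesis unfolding proj_def by blast
  qed
  show "inverse g \<in> proj M x" if g: "g \<in> proj M x" for g
  proof -
    obtain k where "k \<in> M" "pm k = id" "g = sec k x" using g by (auto simp: proj_def)
    then have "inverse k \<in> M" "pm (inverse k) = id" "inverse g = sec (inverse k) x"
      using subgrp_inverse[OF assms] by (auto simp: pm_inverse sec_inverse_fixed)
    then show ?thesis unfolding proj_def by blast
  qed
qed

lemma proj_G: "M \<subseteq> G \<Longrightarrow> x < m \<Longrightarrow> proj M x \<subseteq> G"
  using sec_in_G by (auto simp: proj_def)

lemma projI: "g \<in> M \<Longrightarrow> pm g = id \<Longrightarrow> sec g x \<in> proj M x"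
  by (auto simp: proj_def)

lemma proj_product:
  assumes M: "core_free_maximal M" and Q: "normal_in Q G" "Q \<subseteq> D" "q \<in> Q" "q \<noteq> 1"
    and x: "x < m" and h: "h \<in> G"
  shows "\<exists>p\<in>proj M x. \<exists>r\<in>Q. h = p * r"
proof -
  obtain g where g: "g \<in> G" "pm g = id" "sec g x = h" by (rule fractal[OF h x])
  obtain k n where kn: "k \<in> M" "n \<in> powX Q" "g = k * n"
    using cfm_product_powX[OF M Q g(1)] by blast
  have "pm k = id" using g(2) kn powXD(1)[OF kn(2)] by (simp add: pm_mult)
  then have "h = sec k x * sec n x" using g kn(3) by (auto simp: sec_mult)
  then show ?thesis
    using projI[OF kn(1) \<open>pm k = id\<close>, of x] powXD(2)[OF kn(2) x] by blast
qed

lemma proj_eq_G: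
  assumes M: "core_free_maximal M" and x: "x < m" and D: "D \<subseteq> proj M x"
  shows "proj M x = G"
proof
  obtain d where d: "d \<in> D" "d \<noteq> 1" using D_nontrivial by auto
  show "G \<subseteq> proj M x"
  proof
    fix h assume "h \<in> G"
    then obtain p r where "p \<in> proj M x" "r \<in> D" "h = p * r"
      using proj_product[OF M normal_D subset_refl d x] by blast
    then show "h \<in> proj M x"
      using D subgrp_mult[OF subgrp_proj[OF cfm_subgrp[OF M]]] by blast
  qed
qed (rule proj_G[OF cfm_G[OF M] x])

subsection \<open>Rigid elements\<close>

text \<open>
  The product \<open>A\<close> of the projections \<open>P y\<close> of \<open>M \<inter> powX Q\<close> is normalized by \<open>M\<close>, so either \<open>A \<subseteq> M\<close> or
  \<open>MA = G\<close>. In the first case the projections are trivial by the assumption \<open>no\<close>, hence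
  \<open>M \<inter> powX Q = 1\<close>; but this contradicts \<open>M \<cdot> powX R = G\<close> for the smaller group \<open>R\<close>. In the second case
  \<open>powX Q = A\<close>.
\<close>

lemma full_projection:
  assumes M: "core_free_maximal M"
    and no: "\<And>x d. x < m \<Longrightarrow> d \<in> D \<Longrightarrow> emb x d \<in> M \<Longrightarrow> d = 1"
    and Q: "normal_in Q G" "Q \<subseteq> D"
    and R: "normal_in R G" "R \<subseteq> Q" "R \<noteq> Q" "r \<in> R" "r \<noteq> 1"
    and x: "x < m" and q: "q \<in> Q"
  shows "\<exists>g\<in>M \<inter> powX Q. sec g x = q"
proof -
  note sM = cfm_subgrp[OF M] and MG = cfm_G[OF M]
  have sQ: "subgrp Q" by (rule normal_inD(1)[OF Q(1)])
  have nQ: "normal_in (powX Q) G" by (rule normal_powX[OF Q])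
  have sB: "subgrp (M \<inter> powX Q)" by (rule subgrp_Int[OF sM subgrp_powX[OF sQ]])
  define P where "P y = {sec g y |g. g \<in> M \<inter> powX Q}" for y
  define A where "A = {z \<in> powX Q. \<forall>y<m. sec z y \<in> P y}"
  have P_one: "1 \<in> P y" for y using subgrp_one[OF sB] unfolding P_def by force
  have P_mult: "g * h \<in> P y" if gh: "g \<in> P y" "h \<in> P y" for g h y
  proof -
    obtain k l where "k \<in> M \<inter> powX Q" "g = sec k y" "l \<in> M \<inter> powX Q" "h = sec l y"
      using gh by (auto simp: P_def)
    then have "k * l \<in> M \<inter> powX Q" "g * h = sec (k * l) y"
      using subgrp_mult[OF sB] powXD(1)[of k Q] by (auto simp: sec_mult)
    then show ?thesis unfolding P_def by blast
  qed
  have P_inverse: "inverse g \<in> P y" if g: "g \<in> P y" for g y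
  proof -
    obtain k where k: "k \<in> M \<inter> powX Q" "g = sec k y" using g by (auto simp: P_def)
    then have "inverse k \<in> M \<inter> powX Q" "inverse g = sec (inverse k) y"
      using subgrp_inverse[OF sB] powXD(1)[of k Q] by (auto simp: sec_inverse_fixed)
    then show ?thesis unfolding P_def by blast
  qed
  have sA: "subgrp A"
    using subgrp_powX[OF sQ] P_one P_mult P_inverse
    by (intro subgrpI) (auto simp: A_def subgrp_intros sec_mult sec_inverse_fixed powXD(1))
  have AG: "A \<subseteq> G" using powX_G[OF Q(2)] by (auto simp: A_def)
  have iA: "invariant_under A M"
    unfolding invariant_under_def
  proof (intro ballI)
    fix z k assume z: "z \<in> A" and k: "k \<in> M"
    have kG: "k \<in> G" using k MG by auto
    have "sec (conjug z k) y \<in> P y" if "y < m" for y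
    proof -
      let ?x = "pm (inverse k) y"
      have x': "?x < m" using pm_less[OF subgrp_inverse[OF subgrp_G kG] that] .
      have zX: "z \<in> powX Q" using z by (simp add: A_def)
      obtain g where g: "g \<in> M" "g \<in> powX Q" "sec z ?x = sec g ?x"
        using z x' by (auto simp: A_def P_def)
      have "sec (conjug z k) (pm k ?x) = sec (conjug g k) (pm k ?x)"
        by (simp only: sec_conjug_powX[OF zX] sec_conjug_powX[OF g(2)] g(3))
      moreover have "conjug g k \<in> M \<inter> powX Q"
        using subgrp_conjug[OF sM g(1) k] normal_inD(3)[OF nQ g(2) kG] by simp
      ultimately show ?thesis unfolding P_def by auto
    qed
    then show "conjug z k \<in> A" using z normal_inD(3)[OF nQ _ kG] by (simp add: A_def)
  qed
  have embA: "emb y p \<in> A" if "y < m" "p \<in> P y" "p \<in> Q" for y p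
    using that P_one emb_in_powX[OF subgrp_one[OF sQ]] by (auto simp: A_def sec_emb)
  have "\<not> A \<subseteq> M"
  proof
    assume AM: "A \<subseteq> M"
    have triv: "g = 1" if g: "g \<in> M \<inter> powX Q" for g
    proof -
      have "sec g y = 1" if y: "y < m" for y
      proof -
        have "sec g y \<in> P y" using g by (auto simp: P_def)
        moreover have gQ: "sec g y \<in> Q" using g y powXD(2) by auto
        ultimately have "emb y (sec g y) \<in> M" using embA[OF y] AM by blast
        then show ?thesis using no[OF y] gQ Q(2) by blast
      qed
      then have "sec g y = 1" for y using powXD(3)[of g Q y] g by (cases "y < m") auto
      then show ?thesis by (metis IntD2 g pm_one powXD(1) sec_one taut_eqI)
    qed
    have "p \<in> R" if p: "p \<in> Q" for p
    proof -
      have e: "emb 0 p \<in> powX Q" using emb_in_powX[OF subgrp_one[OF sQ] p] m by simp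
      then obtain h n where hn: "h \<in> M" "n \<in> powX R" "emb 0 p = h * n"
        using cfm_product_powX[OF M R(1) _ R(4,5)] R(2) Q(2) powX_G[OF Q(2)] by blast
      have "n \<in> powX Q" using hn(2) powX_mono[OF R(2)] by auto
      then have "h \<in> powX Q" using subgrp_mult_right_iff[OF subgrp_powX[OF sQ], of n h] hn(3) e by simp
      then have "h = 1" using triv hn(1) by simp
      then have "emb 0 p \<in> powX R" using hn by simp
      then show ?thesis using powXD(2)[of "emb 0 p" R 0] m by (simp add: sec_emb)
    qed
    then show False using R(2,3) by auto
  qed
  have e: "emb x q \<in> powX Q" using emb_in_powX[OF subgrp_one[OF sQ] q x] .
  then have eG: "emb x q \<in> G" using powX_G[OF Q(2)] by auto
  obtain h z where hz: "h \<in> M" "z \<in> A" "emb x q = h * z"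
    by (rule maximal_in_product[OF cfm_maximal[OF M] subgrp_G sA AG iA \<open>\<not> A \<subseteq> M\<close> eG])
  have zX: "z \<in> powX Q" using hz(2) by (simp add: A_def)
  have hX: "h \<in> powX Q" using subgrp_mult_right_iff[OF subgrp_powX[OF sQ] zX, of h] hz(3) e by simp
  obtain g where g: "g \<in> M \<inter> powX Q" "sec z x = sec g x" using hz(2) x by (auto simp: A_def P_def)
  have "h * g \<in> M \<inter> powX Q" using g hz(1) hX by (intro subgrp_mult[OF sB]) auto
  moreover have "sec (h * g) x = q"
  proof -
    have "sec (h * g) x = sec (h * z) x" using g powXD(1)[OF hX] by (simp add: sec_mult)
    then show ?thesis unfolding hz(3)[symmetric] by (simp add: sec_emb)
  qed
  ultimately show ?thesis by blast
qed

text \<open>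
  Otherwise \<open>M \<inter> powX Q\<close> projects onto \<open>Q\<close> in each coordinate, for \<open>Q = D\<close> and for \<open>Q = N = powX D\<close>, and no
  nontrivial element of \<open>M \<inter> N\<close> lives in a single coordinate. Take a minimal set \<open>U\<close> of coordinates that
  supports a nontrivial element of \<open>M \<inter> N\<close>, and \<open>v \<noteq> v'\<close> in \<open>U\<close>. If \<open>g \<in> M \<inter> N\<close> is trivial at \<open>v\<close>, then
  commutators of \<open>g\<close> with elements supported on \<open>U\<close> vanish by minimality, so the section of \<open>g\<close> at \<open>v'\<close>
  centralizes a nontrivial normal subgroup and is trivial. So the sections at \<open>v\<close> and \<open>v'\<close> determine each
  other. As \<open>M \<inter> powX N\<close> projects onto \<open>N\<close>, it follows that one of the two is in \<open>N\<close> only if the other one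
  is. But \<open>M \<cdot> powX N = G\<close> contains elements that violate this.
\<close>

theorem rigid_nontrivial:
  assumes M: "core_free_maximal M"
  shows "\<exists>x<m. \<exists>d\<in>D. d \<noteq> 1 \<and> emb x d \<in> M"
proof (rule ccontr)
  assume "\<not> ?thesis"
  then have no: "d = 1" if "x < m" "d \<in> D" "emb x d \<in> M" for x d using that by blast
  note sM = cfm_subgrp[OF M] and MG = cfm_G[OF M]
  let ?N = "powX D"
  have nN: "normal_in ?N G" by (intro normal_powX normal_D) simp
  have ND: "?N \<subseteq> D" by (rule powX_D) simp
  have nNN: "normal_in (powX ?N) G" by (rule normal_powX[OF nN ND])
  have sN: "subgrp ?N" by (rule normal_inD(1)[OF nN])
  obtain d where d: "d \<in> D" "d \<noteq> 1" using D_nontrivial by auto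
  obtain e where e: "e \<in> ?N" "e \<noteq> 1" using powX_nontrivial[OF subgrp_one[OF subgrp_D] d] by auto
  obtain f where f: "f \<in> powX ?N" "f \<noteq> 1" using powX_nontrivial[OF subgrp_one[OF sN] e] by auto
  have full_D: "\<exists>g\<in>M \<inter> ?N. sec g x = q" if "x < m" "q \<in> D" for x q
    by (rule full_projection[OF M no normal_D subset_refl nN ND powX_D_neq_D e that])
  have full_N: "\<exists>g\<in>M \<inter> powX ?N. sec g x = q" if "x < m" "q \<in> ?N" for x q
  proof (rule full_projection[OF M no nN ND nNN powX_mono[OF ND] _ f that])
    show "powX ?N \<noteq> ?N"
      using powX_eqD[of ?N D] subgrp_one[OF sN] subgrp_one[OF subgrp_D] powX_D_neq_D by auto
  qed
  have sMN: "subgrp (M \<inter> ?N)" by (rule subgrp_Int[OF sM sN])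
  have projG: "proj M x = G" if x: "x < m" for x
  proof (rule proj_eq_G[OF M x], rule subsetI)
    fix q assume "q \<in> D"
    then obtain g where "g \<in> M" "g \<in> ?N" "sec g x = q" using full_D[OF x] by blast
    then show "q \<in> proj M x" using projI[of g M x] powXD(1) by auto
  qed
  \<comment> \<open>a nonempty set of coordinates, minimal among those supporting an element of \<open>M\<close>\<close>
  define S where "S U \<longleftrightarrow> U \<subseteq> {..<m} \<and> (\<exists>k\<in>M \<inter> ?N. k \<noteq> 1 \<and> (\<forall>x. x \<notin> U \<longrightarrow> sec k x = 1))" for U
  have "S {..<m}"
  proof -
    obtain g where "g \<in> M \<inter> ?N" "sec g 0 = d" using full_D[of 0 d] d(1) m by auto
    then show ?thesis unfolding S_def using d(2) powXD(3) by (auto intro!: bexI[of _ g])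
  qed
  then obtain U where U: "S U" "\<And>V. S V \<Longrightarrow> card U \<le> card V"
    using ex_has_least_nat[of S "{..<m}" card] by blast
  have fU: "finite U" "U \<subseteq> {..<m}" using U(1) finite_subset by (auto simp: S_def)
  have minimal: "j = 1" if "j \<in> M \<inter> ?N" "w \<in> U" "\<And>x. x \<notin> U - {w} \<Longrightarrow> sec j x = 1" for j w
  proof (rule ccontr)
    assume "j \<noteq> 1"
    then have "S (U - {w})" using that fU(2) unfolding S_def by blast
    then have "card U \<le> card (U - {w})" by (rule U(2))
    then show False using that(2) fU(1) by (metis card_Diff1_less not_less)
  qed
  obtain k where k: "k \<in> M \<inter> ?N" "k \<noteq> 1" "\<And>x. x \<notin> U \<Longrightarrow> sec k x = 1" using U(1) by (auto simp: S_def)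
  have pk: "pm k = id" using k(1) powXD(1) by auto
  then obtain v where v: "sec k v \<noteq> 1"
    using k(2) by (metis pm_one sec_one taut_eqI)
  then have vU: "v \<in> U" and vm: "v < m" using k(3) fU(2) by blast+
  have "U \<noteq> {v}"
  proof
    assume "U = {v}"
    have "k = emb v (sec k v)"
      by (rule taut_eqI) (use k(3) pk \<open>U = {v}\<close> in \<open>auto simp: sec_emb\<close>)
    then have "sec k v = 1" using no[OF vm] k(1) vm powXD(2) by auto
    then show False using v by simp
  qed
  then obtain v' where v': "v' \<in> U" "v' \<noteq> v" using vU by blast
  then have vm': "v' < m" using fU(2) by blast
  define J where "J = {k \<in> M \<inter> ?N. \<forall>x. x \<notin> U \<longrightarrow> sec k x = 1}"
  have sJ: "subgrp J"
    using sM sN by (intro subgrpI)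
      (auto simp: J_def subgrp_intros sec_mult sec_inverse_fixed powXD(1) inverse_of_one)
  define J' where "J' = {sec k v' |k. k \<in> J}"
  have nJ': "normal_in J' G"
  proof (rule normal_inI)
    have "J' = proj J v'" using powXD(1) by (auto simp: J'_def proj_def J_def)
    then show "subgrp J'" using subgrp_proj[OF sJ] by simp
    show "J' \<subseteq> G" using MG sec_in_G[OF _ vm'] by (auto simp: J'_def J_def)
    fix n g assume n: "n \<in> J'" and "g \<in> G"
    then obtain h where h: "h \<in> M" "pm h = id" "g = sec h v'"
      using projG[OF vm'] by (auto simp: proj_def)
    obtain k where k: "k \<in> J" "n = sec k v'" using n by (auto simp: J'_def)
    then have kN: "k \<in> M" "k \<in> ?N" "\<And>x. x \<notin> U \<Longrightarrow> sec k x = 1" by (auto simp: J_def)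
    have sc: "sec (conjug k h) x = conjug (sec k x) (sec h x)" for x
      using sec_conjug_powX[OF kN(2), of h x] h(2) by simp
    have "conjug k h \<in> J"
      unfolding J_def using kN h sc subgrp_conjug[OF sM kN(1) h(1)] normal_inD(3)[OF nN kN(2)] MG by auto
    moreover have "conjug n g = sec (conjug k h) v'" using sc[of v'] k(2) h(3) by simp
    ultimately show "conjug n g \<in> J'" unfolding J'_def by blast
  qed
  have k': "sec k v' \<in> J'" "sec k v' \<noteq> 1"
  proof -
    show "sec k v' \<in> J'" using k(1,3) by (auto simp: J'_def J_def)
    show "sec k v' \<noteq> 1" using minimal[OF k(1) v'(1)] k(2,3) by blast
  qed
  have link: "sec g v' = 1" if g: "g \<in> M \<inter> ?N" "sec g v = 1" for g
  proof (rule centralizer_trivial[OF nJ' k'])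
    show "sec g v' \<in> G" using g MG sec_in_G[OF _ vm'] by auto
    fix q assume "q \<in> J'"
    then obtain k where kq: "k \<in> J" "q = sec k v'" by (auto simp: J'_def)
    then have kN: "k \<in> M \<inter> ?N" "\<And>x. x \<notin> U \<Longrightarrow> sec k x = 1" by (auto simp: J_def)
    have sc: "sec (commut k g) x = commut (sec k x) (sec g x)" for x
      using kN g powXD(1) by (intro sec_commut) auto
    have "commut k g = 1"
      using kN(2) g(2) by (intro minimal[OF subgrp_commut[OF sMN kN(1) g(1)] vU]) (auto simp: sc)
    then show "commut q (sec g v') = 1" using sc[of v'] kq(2) by simp
  qed
  \<comment> \<open>the linked coordinates contradict \<open>M \<cdot> powX (powX D) = G\<close>\<close>
  obtain x0 where x0: "x0 \<in> D" "x0 \<notin> ?N" using powX_D_neq_D ND by auto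
  have eN: "emb v' x0 \<in> ?N" using emb_in_powX[OF subgrp_one[OF subgrp_D] x0(1) vm'] .
  then have "emb v' x0 \<in> G" using normal_inD(2)[OF nN] by auto
  then obtain g q where gq: "g \<in> M" "q \<in> powX ?N" "emb v' x0 = g * q"
    using cfm_product_powX[OF M nN ND e] by blast
  have qN: "q \<in> ?N" using gq(2) powX_mono[OF ND] by auto
  have gN: "g \<in> ?N" using subgrp_mult_right_iff[OF sN qN, of g] gq(3) eN by simp
  have sg: "sec g x * sec q x = sec (emb v' x0) x" for x
    using gq(3) powXD(1)[OF gN] by (simp add: sec_mult)
  have "sec g v \<in> ?N"
    using sg[of v] v'(2) subgrp_mult_right_iff[OF sN powXD(2)[OF gq(2) vm], of "sec g v"] subgrp_one[OF sN]
    by (simp add: sec_emb)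
  then obtain h where h: "h \<in> M" "h \<in> powX ?N" "sec h v = sec g v" using full_N[OF vm] by blast
  have hN: "h \<in> ?N" using h(2) powX_mono[OF ND] by auto
  have "g * inverse h \<in> M \<inter> ?N"
    using gq(1) gN h(1) hN by (intro subgrp_mult[OF sMN] subgrp_inverse[OF sMN]) auto
  moreover have sgh: "sec (g * inverse h) x = sec g x * inverse (sec h x)" for x
    using powXD(1)[OF gN] powXD(1)[OF hN] by (simp add: sec_mult sec_inverse_fixed)
  ultimately have "sec g v' * inverse (sec h v') = 1"
    using link[of "g * inverse h"] h(3) by (simp add: inverse_mult_right)
  then have "sec g v' = sec h v'" by (simp add: mult_inverse_eq_1_iff)
  then have "sec g v' \<in> ?N" using powXD(2)[OF h(2) vm'] by simp
  then have "sec g v' * sec q v' \<in> ?N" using powXD(2)[OF gq(2) vm'] by (rule subgrp_mult[OF sN])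
  then show False using sg[of v'] x0(2) by (simp add: sec_emb)
qed

subsection \<open>Sections of core-free maximal subgroups are core-free maximal\<close>

text \<open>
  If \<open>proj M x = G\<close>, then the \<open>d \<in> D\<close> with \<open>emb x d \<in> M\<close> form a normal subgroup \<open>K\<close> of \<open>G\<close>. As \<open>M\<close> is transitive
  on the first level, \<open>powX K \<subseteq> M\<close>, so \<open>K\<close> is trivial because \<open>M\<close> is core-free.
\<close>

lemma proj_neq_G:
  assumes M: "core_free_maximal M" and x: "x < m"
  shows "proj M x \<noteq> G"
proof
  assume pG: "proj M x = G"
  note sM = cfm_subgrp[OF M] and MG = cfm_G[OF M]
  define K where "K = {d \<in> D. emb x d \<in> M}"
  have "K = D \<inter> {d. emb x d \<in> M}" by (auto simp: K_def)
  moreover have "subgrp {d. emb x d \<in> M}"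
    using sM by (intro subgrpI) (auto simp: emb_mult emb_inverse subgrp_intros)
  ultimately have sK: "subgrp K" using subgrp_Int[OF subgrp_D] by simp
  have nK: "normal_in K G"
  proof (rule normal_inI[OF sK])
    fix n g assume n: "n \<in> K" and g: "g \<in> G"
    obtain h where h: "h \<in> M" "pm h = id" "g = sec h x" using g pG by (auto simp: proj_def)
    have "conjug (emb x n) h \<in> M" using n h(1) by (intro subgrp_conjug[OF sM]) (auto simp: K_def)
    then show "conjug n g \<in> K"
      using n normal_inD(3)[OF normal_D _ g] h by (simp add: K_def conjug_emb)
  qed (use D_G in \<open>auto simp: K_def\<close>)
  have move: "emb y (conjug d (sec h z)) \<in> M" if "emb z d \<in> M" "h \<in> M" "pm h z = y" for y z d h
    using subgrp_conjug[OF sM that(1,2)] that(3) by (simp add: conjug_emb)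
  obtain y d where yd: "y < m" "d \<in> D" "d \<noteq> 1" "emb y d \<in> M" using rigid_nontrivial[OF M] by auto
  obtain h where h: "h \<in> M" "pm h y = x" using cfm_transitive[OF M yd(1) x] by auto
  have hG: "sec h y \<in> G" using sec_in_G[OF _ yd(1)] h(1) MG by auto
  have k: "conjug d (sec h y) \<in> K" "conjug d (sec h y) \<noteq> 1"
    using move[OF yd(4) h] normal_inD(3)[OF normal_D yd(2) hG] yd(3) by (auto simp: K_def conjug_eq_1_iff)
  have "powX K \<subseteq> M"
  proof (rule powX_subset[OF sM])
    fix z q assume z: "z < m" and q: "q \<in> K"
    obtain l where l: "l \<in> M" "pm l x = z" using cfm_transitive[OF M x z] by auto
    have "conjug q (inverse (sec l x)) \<in> K"
      using q sec_in_G[OF _ x] l(1) MG subgrp_inverse[OF subgrp_G] by (intro normal_inD(3)[OF nK]) auto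
    then show "emb z q \<in> M" using move[OF _ l, of "conjug q (inverse (sec l x))"] by (simp add: K_def)
  qed
  moreover have "normal_in (powX K) G" by (rule normal_powX[OF nK]) (auto simp: K_def)
  moreover obtain z where "z \<in> powX K" "z \<noteq> 1" using powX_nontrivial[OF subgrp_one[OF sK] k] by auto
  ultimately show False using M by (auto simp: core_free_maximal_def)
qed

text \<open>
  The group \<open>A\<close> defined in the proof is normalized by \<open>M\<close>, and it contains \<open>emb x d\<close> for \<open>d \<in> H \<inter> D\<close>. If
  \<open>A \<subseteq> M\<close>, then \<open>H \<inter> D \<subseteq> proj M x\<close> and \<open>H\<close> is not larger than \<open>proj M x\<close>, since \<open>G = proj M x \<cdot> D\<close>. If \<open>MA = G\<close>,
  then \<open>D \<subseteq> H\<close>, hence \<open>H = G\<close>.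
\<close>

lemma proj_maximal:
  assumes M: "core_free_maximal M" and x: "x < m"
    and H: "subgrp H" "proj M x \<subseteq> H" "H \<subseteq> G"
  shows "H = proj M x \<or> H = G"
proof -
  note sM = cfm_subgrp[OF M] and MG = cfm_G[OF M]
  have sP: "subgrp (proj M x)" by (rule subgrp_proj[OF sM])
  obtain d0 where d0: "d0 \<in> D" "d0 \<noteq> 1" using D_nontrivial by auto
  have nN: "normal_in (powX D) G" by (intro normal_powX normal_D) simp
  have sN: "subgrp (powX D)" by (rule normal_inD(1)[OF nN])
  \<comment> \<open>the elements of \<open>powX D\<close> all of whose \<open>M\<close>-conjugates have their section at \<open>x\<close> in \<open>H\<close>\<close>
  define A where "A = {z \<in> powX D. \<forall>h\<in>M. sec (conjug z h) x \<in> H}"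
  have cX: "pm (conjug z h) = id" if "z \<in> powX D" for z h using powXD(1)[OF that] by (simp add: pm_conjug_id)
  have sA: "subgrp A"
    using sN H(1) cX
    by (intro subgrpI) (auto simp: A_def subgrp_intros conjug_mult conjug_inverse sec_mult sec_inverse_fixed)
  have AG: "A \<subseteq> G" using powX_G[OF subset_refl] by (auto simp: A_def)
  have iA: "invariant_under A M"
    unfolding invariant_under_def
  proof (intro ballI)
    fix z k assume z: "z \<in> A" and k: "k \<in> M"
    then have "conjug z k \<in> powX D" using normal_inD(3)[OF nN] MG by (auto simp: A_def)
    then show "conjug z k \<in> A" using z k subgrp_mult[OF sM] by (auto simp: A_def conjug_conjug)
  qed
  show ?thesis
  proof (cases "A \<subseteq> M")
    case True
    have HD: "d \<in> proj M x" if d: "d \<in> H" "d \<in> D" for d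
    proof -
      have "sec (conjug (emb x d) h) x \<in> H" if h: "h \<in> M" for h
      proof (cases "pm h x = x")
        case True
        have hG: "h \<in> G" using h MG by auto
        have "sec h x \<in> H" using projI[OF h pm_id_of_fixed[OF hG x True], of x] H(2) by auto
        then show ?thesis using d(1) True subgrp_conjug[OF H(1)] by (simp add: conjug_emb sec_emb)
      next
        case False
        then show ?thesis using subgrp_one[OF H(1)] by (simp add: conjug_emb sec_emb)
      qed
      then have "emb x d \<in> A" using emb_in_powX[OF subgrp_one[OF subgrp_D] d(2) x] by (simp add: A_def)
      then have "emb x d \<in> M" using True by auto
      then show ?thesis using projI[of "emb x d" M x] by (simp add: sec_emb)
    qed
    have "H \<subseteq> proj M x"
    proof
      fix h assume h: "h \<in> H"
      then obtain p d where pd: "p \<in> proj M x" "d \<in> D" "h = p * d"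
        using proj_product[OF M normal_D subset_refl d0 x, of h] H(3) by auto
      then have "d \<in> H" using subgrp_mult_left_iff[OF H(1), of p d] h H(2) by auto
      then show "h \<in> proj M x" unfolding pd(3) using HD pd by (intro subgrp_mult[OF sP]) auto
    qed
    then show ?thesis using H(2) by auto
  next
    case False
    have DH: "D \<subseteq> H"
    proof
      fix d assume d: "d \<in> D"
      have e: "emb x d \<in> powX D" by (rule emb_in_powX[OF subgrp_one[OF subgrp_D] d x])
      then have "emb x d \<in> G" using powX_G[OF subset_refl] by auto
      then obtain h z where hz: "h \<in> M" "z \<in> A" "emb x d = h * z"
        by (rule maximal_in_product[OF cfm_maximal[OF M] subgrp_G sA AG iA False])
      have zX: "z \<in> powX D" using hz(2) by (simp add: A_def)
      have "h \<in> powX D" using subgrp_mult_right_iff[OF sN zX, of h] hz(3) e by simp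
      then have ph: "pm h = id" by (rule powXD(1))
      then have "sec h x \<in> H" using projI[OF hz(1)] H(2) by blast
      moreover have "sec z x \<in> H" using hz(2) subgrp_one[OF sM] unfolding A_def by force
      moreover have "d = sec h x * sec z x"
        using arg_cong[OF hz(3), of "\<lambda>g. sec g x"] ph by (simp add: sec_mult sec_emb)
      ultimately show "d \<in> H" using subgrp_mult[OF H(1)] by simp
    qed
    have "G \<subseteq> H"
    proof
      fix h assume "h \<in> G"
      then obtain p d where pd: "p \<in> proj M x" "d \<in> D" "h = p * d"
        using proj_product[OF M normal_D subset_refl d0 x, of h] by auto
      then show "h \<in> H" using DH H(2) subgrp_mult[OF H(1)] by auto
    qed
    then show ?thesis using H(3) by auto
  qed
qed

theorem core_free_maximal_proj:
  assumes M: "core_free_maximal M" and x: "x < m"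
  shows "core_free_maximal (proj M x)"
  unfolding core_free_maximal_def maximal_in_def
proof (intro conjI allI impI)
  show "subgrp (proj M x)" by (rule subgrp_proj[OF cfm_subgrp[OF M]])
  show "proj M x \<subset> G" using proj_G[OF cfm_G[OF M] x] proj_neq_G[OF M x] by auto
  show "H = proj M x \<or> H = G" if "subgrp H" "proj M x \<subseteq> H" "H \<subseteq> G" for H
    by (rule proj_maximal[OF M x that])
  fix K assume K: "normal_in K G" "K \<subseteq> proj M x"
  show "K \<subseteq> {1}"
  proof
    fix k assume k: "k \<in> K"
    show "k \<in> {1}"
    proof (rule ccontr)
      assume "k \<notin> {1}"
      then obtain z where z: "z \<in> K \<inter> D" "z \<noteq> 1" using normal_Int_D_nontrivial[OF K(1) k] by auto
      have "D \<subseteq> proj M x"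
      proof
        fix d assume "d \<in> D"
        then have "d \<in> G" using D_G by auto
        then obtain p r where pr: "p \<in> proj M x" "r \<in> K \<inter> D" "d = p * r"
          using proj_product[OF M normal_in_Int[OF K(1) normal_D] _ z x, of d] by auto
        then show "d \<in> proj M x" using K(2) subgrp_mult[OF subgrp_proj[OF cfm_subgrp[OF M]]] by blast
      qed
      then show False using proj_eq_G[OF M x] proj_neq_G[OF M x] by simp
    qed
  qed
qed

end

section \<open>Words and their sections\<close>

lemma split_adjacent:
  assumes "\<exists>x\<in>set U. P x" "\<exists>y\<in>set V. Q y"
  shows "\<exists>A p B q C. U @ V = A @ p # B @ q # C \<and> P p \<and> Q q \<and> (\<forall>b\<in>set B. \<not> P b \<and> \<not> Q b)"
proof -
  obtain V1 q V2 where V: "V = V1 @ q # V2" "Q q" using assms(2) split_list by metis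
  have "\<exists>x\<in>set (U @ V1). P x" using assms(1) by auto
  then obtain A p B where A: "U @ V1 = A @ p # B" "P p" "\<forall>b\<in>set B. \<not> P b"
    using split_list_last_prop[of "U @ V1" P] by metis
  have "\<exists>x\<in>set (B @ [q]). Q x" using V by auto
  then obtain B' q' C where B: "B @ [q] = B' @ q' # C" "Q q'" "\<forall>b\<in>set B'. \<not> Q b"
    using split_list_first_prop[of "B @ [q]" Q] by metis
  have "set B' \<subseteq> set B" using B(1) by (cases C rule: rev_cases) auto
  moreover have "U @ V = A @ p # B' @ q' # (C @ V2)"
  proof -
    have "U @ V = A @ p # (B @ [q]) @ V2" using V A by simp
    then show ?thesis by (simp only: B(1)) simp
  qed
  ultimately show ?thesis using A(2,3) B(2,3) by blast
qed

lemma power_mult_swap: "(p * q) ^ k = p * (q * p) ^ k * inverse (p :: 'a::group_mult)"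
proof (induction k)
  case (Suc k)
  have "(p * q) ^ Suc k = (p * q) * (p * (q * p) ^ k * inverse p)" by (simp add: Suc)
  also have "\<dots> = p * (q * p) ^ Suc k * inverse p" by (simp add: mult.assoc)
  finally show ?case .
qed (simp add: group_simps)

lemma inverse_power: "inverse (g :: 'a::group_mult) ^ k = inverse (g ^ k)"
proof (induction k)
  case (Suc k)
  have "inverse g ^ Suc k = inverse g ^ k * inverse g" by (rule power_Suc2)
  then show ?case by (simp add: Suc inverse_of_mult)
qed (simp add: inverse_of_one)

text \<open>A letter \<open>(i, b)\<close> stands for the generator \<open>a\<^sub>i\<close> or, if \<open>b\<close> is false, for its inverse.\<close>

type_synonym letter = "nat \<times> bool"

definition inv_word :: "letter list \<Rightarrow> letter list" where
  "inv_word w = rev (map (\<lambda>(i, b). (i, \<not> b)) w)"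

definition expsum :: "nat \<Rightarrow> letter list \<Rightarrow> int" where
  "expsum i w = sum_list (map (\<lambda>(j, b). if j = i then (if b then 1 else - 1) else 0) w)"

lemma expsum_simps [simp]:
  "expsum i [] = 0" "expsum i (l # w) = (if fst l = i then (if snd l then 1 else - 1) else 0) + expsum i w"
  "expsum i (v @ w) = expsum i v + expsum i w"
  by (simp_all add: expsum_def split: prod.split)

lemma expsum_inv_word [simp]: "expsum i (inv_word w) = - expsum i w"
  by (induction w) (auto simp: inv_word_def)

lemma inv_word_append: "inv_word (u @ v) = inv_word v @ inv_word u"
  and inv_word_Cons: "inv_word ((i, b) # v) = inv_word v @ [(i, \<not> b)]"
  by (simp_all add: inv_word_def)

lemma map_fst_inv_word: "map fst (inv_word w) = rev (map fst w)"
  by (simp add: inv_word_def rev_map split_def comp_def)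

lemma expsum_notin: "i \<notin> fst ` set w \<Longrightarrow> expsum i w = 0"
  by (induction w) auto

lemma expsum_distinct: "distinct (map fst w) \<Longrightarrow> (i, b) \<in> set w \<Longrightarrow> expsum i w = (if b then 1 else - 1)"
proof -
  assume d: "distinct (map fst w)" and i: "(i, b) \<in> set w"
  obtain u v where w: "w = u @ (i, b) # v" using split_list[OF i] by auto
  have "i \<notin> fst ` set u" "i \<notin> fst ` set v" using d w by auto
  then show ?thesis by (simp add: w expsum_notin)
qed

lemma expsum_one_sign:
  assumes "(i, \<not> b) \<notin> set w"
  shows "expsum i w = (if b then 1 else - 1) * int (count_list (map fst w) i)"
  using assms by (induction w) auto

context kneading
begin

definition val :: "letter \<Rightarrow> taut" where
  "val l = (if snd l then a (fst l) else inverse (a (fst l)))"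

definition ev :: "letter list \<Rightarrow> taut" where
  "ev w = prod_list (map val w)"

definition sh :: "nat \<Rightarrow> nat" where
  "sh i = (if i = 0 then s - 1 else i - 1)"

definition unsh :: "nat \<Rightarrow> nat" where
  "unsh i = (if i = s - 1 then 0 else Suc i)"

definition shl :: "letter \<Rightarrow> letter" where
  "shl l = (sh (fst l), snd l)"

definition is_word :: "letter list \<Rightarrow> bool" where
  "is_word w \<longleftrightarrow> fst ` set w \<subseteq> {..<s}"

definition zero_free :: "letter list \<Rightarrow> bool" where
  "zero_free w \<longleftrightarrow> 0 \<notin> fst ` set w"

lemma sh_less: "i < s \<Longrightarrow> sh i < s"
  and unsh_less: "i < s \<Longrightarrow> unsh i < s"
  and unsh_sh: "i < s \<Longrightarrow> unsh (sh i) = i"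
  and sh_unsh: "i < s \<Longrightarrow> sh (unsh i) = i"
  using s by (auto simp: sh_def unsh_def)

lemma sh_eq_iff: "i < s \<Longrightarrow> j < s \<Longrightarrow> sh i = j \<longleftrightarrow> i = unsh j"
  using unsh_sh sh_unsh by metis

lemma ev_simps [simp]: "ev [] = 1" "ev (l # w) = val l * ev w" "ev (v @ w) = ev v * ev w"
  by (simp_all add: ev_def)

lemma ev_inv_word: "ev (inv_word w) = inverse (ev w)"
proof (induction w)
  case (Cons l w)
  obtain i b where l: "l = (i, b)" by (cases l)
  have "val (i, \<not> b) = inverse (val (i, b))" by (simp add: val_def inverse_of_inverse)
  then show ?case using Cons by (simp add: l inv_word_Cons inverse_of_mult)
qed (simp add: inv_word_def inverse_of_one)

lemma is_word_simps [simp]: "is_word []" "is_word (l # w) \<longleftrightarrow> fst l < s \<and> is_word w"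
  "is_word (v @ w) \<longleftrightarrow> is_word v \<and> is_word w"
  by (auto simp: is_word_def)

lemma zero_free_simps [simp]: "zero_free []" "zero_free (l # w) \<longleftrightarrow> fst l \<noteq> 0 \<and> zero_free w"
  "zero_free (v @ w) \<longleftrightarrow> zero_free v \<and> zero_free w"
  by (auto simp: zero_free_def)

lemma is_word_inv_word [simp]: "is_word (inv_word w) \<longleftrightarrow> is_word w"
  by (force simp: is_word_def inv_word_def)

lemma is_word_map_shl: "is_word w \<Longrightarrow> is_word (map shl w)"
  using sh_less by (auto simp: is_word_def shl_def)

lemma val_in_G: "fst l < s \<Longrightarrow> val l \<in> G"
  using a_in_G subgrp_inverse[OF subgrp_G] by (simp add: val_def)

lemma ev_in_G: "is_word w \<Longrightarrow> ev w \<in> G"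
  using val_in_G by (induction w) (auto intro: subgrp_one[OF subgrp_G] subgrp_mult[OF subgrp_G])

lemma ex_word: "g \<in> G \<Longrightarrow> \<exists>w. is_word w \<and> ev w = g"
  unfolding G_def
proof (induction rule: gen_by.induct)
  case gen_one
  show ?case by (intro exI[of _ "[]"]) simp
next
  case (gen_base e)
  then obtain i where "i < s" "e = a i" by auto
  then show ?case by (intro exI[of _ "[(i, True)]"]) (simp add: val_def)
next
  case (gen_mult g h)
  then obtain v w where "is_word v" "ev v = g" "is_word w" "ev w = h" by auto
  then show ?case by (intro exI[of _ "v @ w"]) simp
next
  case (gen_inverse g)
  then obtain v where "is_word v" "ev v = g" by auto
  then show ?case by (intro exI[of _ "inv_word v"]) (simp add: ev_inv_word)
qed

lemma ex_word_D: "d \<in> D \<Longrightarrow> \<exists>w. is_word w \<and> ev w = d \<and> (\<forall>i. expsum i w = 0)"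
  unfolding D_def commut_subgrp_def
proof (induction rule: gen_by.induct)
  case gen_one
  show ?case by (intro exI[of _ "[]"]) simp
next
  case (gen_base e)
  then obtain g h where gh: "g \<in> G" "h \<in> G" "e = commut g h" by auto
  obtain v w where "is_word v" "ev v = g" "is_word w" "ev w = h"
    using ex_word[OF gh(1)] ex_word[OF gh(2)] by auto
  then show ?case
    by (intro exI[of _ "inv_word v @ inv_word w @ v @ w"])
      (simp add: gh(3) commut_def ev_inv_word mult.assoc)
next
  case (gen_mult g h)
  then obtain v w where "is_word v" "ev v = g" "is_word w" "ev w = h"
    "\<forall>i. expsum i v = 0" "\<forall>i. expsum i w = 0" by auto
  then show ?case by (intro exI[of _ "v @ w"]) simp
next
  case (gen_inverse g)
  then obtain v where "is_word v" "ev v = g" "\<forall>i. expsum i v = 0" by auto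
  then show ?case by (intro exI[of _ "inv_word v"]) (simp add: ev_inv_word)
qed

subsection \<open>Sections of words\<close>

text \<open>The letter \<open>l\<close> has a nontrivial section at a single vertex of the first level, and there it
  is the letter \<open>shl l\<close>.\<close>

definition spot :: "letter \<Rightarrow> nat" where
  "spot l = (if fst l = 0 then (if snd l then m - 1 else 0) else t)"

fun secw :: "nat \<Rightarrow> letter list \<Rightarrow> letter list" where
  "secw x [] = []"
| "secw x (l # w) = (if x = spot l then [shl l] else []) @ secw (pm (val l) x) w"

lemma spot_less: "spot l < m"
  using m t by (simp add: spot_def)

lemma pm_val_zero: "pm (val (0, b)) (spot (0, b)) = spot (0, \<not> b)"
proof -
  have 1: "pm (a 0) (m - 1) = 0" using m by (simp add: pm_a_0 rot_def)
  then have "pm (inverse (a 0)) 0 = m - 1" by (metis pm_inverse_pm(1))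
  then show ?thesis using 1 by (simp add: val_def spot_def)
qed

lemma val_Suc: "val (Suc i, b) = emb t (val (i, b))"
  by (simp add: val_def a_Suc emb_inverse)

lemma sec_val: 
  assumes "fst l < s" "x < m"
  shows "sec (val l) x = (if x = spot l then val (shl l) else 1)"
proof (cases "fst l")
  case (Suc i)
  then have "val l = emb t (val (i, snd l))" using val_Suc[of i "snd l"] by (metis prod.collapse)
  then show ?thesis using Suc by (simp add: sec_emb spot_def shl_def sh_def)
next
  case 0
  show ?thesis
  proof (cases "snd l")
    case True
    then show ?thesis using 0 by (simp add: val_def sec_a_0 spot_def shl_def sh_def)
  next
    case False
    let ?y = "pm (inverse (a 0)) x"
    have "a 0 \<in> G" using a_in_G s by simp
    then have y: "?y < m" using pm_less[OF subgrp_inverse[OF subgrp_G]] assms(2) by auto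
    have "?y = m - 1 \<longleftrightarrow> x = 0"
      using pm_val_zero[of False] pm_inj[of "inverse (a 0)" x 0] by (auto simp: val_def spot_def)
    then have "sec (inverse (a 0)) (pm (a 0) ?y) = inverse (if x = 0 then a (s - 1) else 1)"
      unfolding sec_inverse by (simp add: sec_a_0)
    then show ?thesis using 0 False by (simp add: val_def spot_def shl_def sh_def inverse_of_one)
  qed
qed

lemma sec_ev: "is_word w \<Longrightarrow> x < m \<Longrightarrow> sec (ev w) x = ev (secw x w)"
proof (induction w arbitrary: x)
  case (Cons l w)
  have "pm (val l) x < m" using Cons.prems by (intro pm_less val_in_G) auto
  then show ?case using Cons by (simp add: sec_mult sec_val)
qed simp

lemma is_word_secw: "is_word w \<Longrightarrow> is_word (secw x w)"
  by (induction w arbitrary: x) (auto simp: shl_def sh_less)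

lemma secw_append: "secw x (v @ w) = secw x v @ secw (pm (ev v) x) w"
  by (induction v arbitrary: x) (simp_all add: pm_mult)

lemma bij_betw_pm: "g \<in> G \<Longrightarrow> bij_betw (pm g) {..<m} {..<m}"
proof -
  assume g: "g \<in> G"
  have "inj_on (pm g) {..<m}" by (simp add: inj_on_def pm_inj)
  moreover have "pm g ` {..<m} \<subseteq> {..<m}" using pm_less[OF g] by auto
  ultimately show ?thesis by (simp add: bij_betw_def endo_inj_surj)
qed

text \<open>Each letter of a word contributes exactly one letter to exactly one of its sections.\<close>

lemma sum_secw:
  fixes f :: "letter \<Rightarrow> 'b::comm_monoid_add"
  assumes "is_word w"
  shows "(\<Sum>x<m. sum_list (map f (secw x w))) = sum_list (map f (map shl w))"
  using assms
proof (induction w)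
  case (Cons l w)
  have "(\<Sum>x<m. sum_list (map f (secw x (l # w))))
    = (\<Sum>x<m. (if x = spot l then f (shl l) else 0)) + (\<Sum>x<m. sum_list (map f (secw (pm (val l) x) w)))"
    unfolding sum.distrib[symmetric] by (intro sum.cong) simp_all
  also have "(\<Sum>x<m. (if x = spot l then f (shl l) else 0)) = f (shl l)"
    using spot_less by (simp add: sum.delta)
  also have "(\<Sum>x<m. sum_list (map f (secw (pm (val l) x) w))) = (\<Sum>x<m. sum_list (map f (secw x w)))"
    using Cons.prems by (intro sum.reindex_bij_betw bij_betw_pm val_in_G) simp
  finally show ?case using Cons by simp
qed simp

lemma zero_free_section:
  assumes "is_word w" "zero_free w"
  shows "pm (ev w) = id" "x < m \<Longrightarrow> secw x w = (if x = t then map shl w else [])"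
proof -
  have *: "pm (val l) = id" if "fst l \<noteq> 0" for l
  proof -
    obtain i where "fst l = Suc i" using \<open>fst l \<noteq> 0\<close> by (cases "fst l") auto
    then have "val l = emb t (val (i, snd l))" using val_Suc[of i "snd l"] by (metis prod.collapse)
    then show ?thesis by simp
  qed
  show "pm (ev w) = id" using assms by (induction w) (simp_all add: pm_mult *)
  show "x < m \<Longrightarrow> secw x w = (if x = t then map shl w else [])"
    using assms by (induction w) (simp_all add: * spot_def)
qed

lemma sec_zero_free:
  "is_word w \<Longrightarrow> zero_free w \<Longrightarrow> x < m \<Longrightarrow> sec (ev w) x = (if x = t then ev (map shl w) else 1)"
  by (simp add: sec_ev zero_free_section)

end

lemma pm_power: "pm (g ^ k) = pm g ^^ k"
  by (induction k) (simp_all add: pm_mult funpow_Suc_right del: funpow.simps(2))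

context kneading
begin

subsection \<open>Words running once around the first level\<close>

lemma pm_ev_int:
  assumes "is_word w" "x < m"
  shows "int (pm (ev w) x) = (int x + expsum 0 w) mod int m"
  using assms
proof (induction w arbitrary: x)
  case (Cons l w)
  let ?y = "pm (val l) x" and ?e = "if fst l = 0 then (if snd l then 1 else - 1) else 0 :: int"
  have vG: "val l \<in> G" using Cons.prems by (intro val_in_G) simp
  have y: "?y < m" by (rule pm_less[OF vG Cons.prems(2)])
  have "int ?y = (int x + ?e) mod int m"
  proof (cases "fst l = 0")
    case False
    then have "zero_free [l]" "is_word [l]" using Cons.prems(1) by simp_all
    then have "pm (val l) = id" using zero_free_section(1)[of "[l]"] by simp
    then show ?thesis using False Cons.prems(2) by simp
  next
    case zero: True
    show ?thesis
    proof (cases "snd l")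
      case True
      then show ?thesis using zero Cons.prems(2)
        by (simp add: val_def pm_a_0 rot_def zmod_int add.commute)
    next
      case False
      have "x = (?y + 1) mod m"
        using pm_inverse_pm(2)[of "a 0" x] zero False y by (simp add: val_def pm_a_0 rot_def)
      then have "int x = int ((?y + 1) mod m)" by simp
      also have "\<dots> = (int ?y + 1) mod int m" by (simp add: zmod_int add.commute)
      finally have "int x = (int ?y + 1) mod int m" .
      then have "(int x + ?e) mod int m = (int ?y + 1 - 1) mod int m"
        using zero False by (simp add: mod_diff_left_eq)
      then show ?thesis using y by simp
    qed
  qed
  then have "(int ?y + expsum 0 w) mod int m = (int x + expsum 0 (l # w)) mod int m"
    by (simp only: expsum_simps mod_add_left_eq add.assoc)
  then show ?case using Cons.IH[OF _ y] Cons.prems by (simp add: pm_mult)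
qed simp

lemma funpow_pm_int:
  assumes "is_word w" "x < m"
  shows "(pm (ev w) ^^ k) x < m \<and> int ((pm (ev w) ^^ k) x) = (int x + int k * expsum 0 w) mod int m"
proof (induction k)
  case (Suc k)
  let ?y = "(pm (ev w) ^^ k) x"
  have "int (pm (ev w) ?y) = (int ?y + expsum 0 w) mod int m"
    using pm_ev_int[OF assms(1)] Suc by simp
  also have "\<dots> = (int x + int k * expsum 0 w + expsum 0 w) mod int m"
    using Suc by (simp only: mod_add_left_eq)
  also have "int x + int k * expsum 0 w + expsum 0 w = int x + int (Suc k) * expsum 0 w"
    by (simp add: algebra_simps)
  finally show ?case using Suc pm_less[OF ev_in_G[OF assms(1)]] by simp
qed (use assms(2) in simp)

lemma bij_betw_orbit:
  assumes w: "is_word w" "\<bar>expsum 0 w\<bar> = 1"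
  shows "bij_betw (\<lambda>k. (pm (ev w) ^^ k) t) {..<m} {..<m}"
proof -
  let ?f = "\<lambda>k. (pm (ev w) ^^ k) t"
  have "k = l" if kl: "k < m" "l < m" "?f k = ?f l" for k l
  proof -
    have "(int t + int k * expsum 0 w) mod int m = (int t + int l * expsum 0 w) mod int m"
      using funpow_pm_int[OF w(1) t] kl(3) by metis
    then have "int m dvd (int k - int l) * expsum 0 w"
      by (simp add: mod_eq_dvd_iff left_diff_distrib)
    then have "int m dvd int k - int l"
      using w(2) by (metis abs_eq_iff' abs_mult dvd_abs_iff mult.right_neutral)
    then have "int k - int l = 0"
      using kl zdvd_imp_le[of "int m" "\<bar>int k - int l\<bar>"] by (cases "int k = int l") auto
    then show "k = l" by simp
  qed
  then have inj: "inj_on ?f {..<m}" by (auto simp: inj_on_def)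
  moreover have "?f ` {..<m} \<subseteq> {..<m}" using funpow_pm_int[OF w(1) t] by auto
  ultimately show ?thesis by (simp add: bij_betw_def endo_inj_surj)
qed

lemma pm_ev_power_m:
  assumes w: "is_word w"
  shows "pm (ev w ^ m) = id"
proof (rule pm_id_of_fixed[OF _ t])
  show "ev w ^ m \<in> G" by (rule subgrp_power[OF subgrp_G ev_in_G[OF w]])
  have "int ((pm (ev w) ^^ m) t) = int t" using funpow_pm_int[OF w t, of m] t by simp
  then show "pm (ev w ^ m) t = t" by (simp add: pm_power)
qed

text \<open>
  A word for the section at \<open>t\<close> of the \<open>m\<close>-th power of \<open>ev w\<close>: it collects the sections of \<open>w\<close> along the
  orbit of \<open>t\<close>.
\<close>

definition loop :: "letter list \<Rightarrow> letter list" where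
  "loop w = concat (map (\<lambda>k. secw ((pm (ev w) ^^ k) t) w) [0..<m])"

lemma ev_loop:
  assumes w: "is_word w"
  shows "ev (loop w) = sec (ev w ^ m) t"
proof -
  have "sec (ev w ^ k) t = ev (concat (map (\<lambda>k. secw ((pm (ev w) ^^ k) t) w) [0..<k]))" for k
  proof (induction k)
    case (Suc k)
    have "sec (ev w ^ Suc k) t = sec (ev w ^ k) t * sec (ev w) ((pm (ev w) ^^ k) t)"
      by (simp only: power_Suc2 sec_mult pm_power)
    then show ?case using Suc sec_ev[OF w] funpow_pm_int[OF w t, of k] by simp
  qed simp
  then show ?thesis by (simp add: loop_def)
qed

lemma is_word_loop: "is_word w \<Longrightarrow> is_word (loop w)"
proof -
  have "is_word (concat (map Y ks))" if "\<And>k. is_word (Y k)" for Y :: "nat \<Rightarrow> letter list" and ks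
    using that by (induction ks) auto
  then show "is_word w \<Longrightarrow> is_word (loop w)" using is_word_secw by (simp add: loop_def)
qed

lemma sum_loop:
  fixes f :: "letter \<Rightarrow> 'b::comm_monoid_add"
  assumes w: "is_word w" "\<bar>expsum 0 w\<bar> = 1"
  shows "sum_list (map f (loop w)) = sum_list (map f (map shl w))"
proof -
  have "sum_list (map f (concat (map Y [0..<k]))) = (\<Sum>j<k. sum_list (map f (Y j)))"
    for Y :: "nat \<Rightarrow> letter list" and k
    by (induction k) simp_all
  then have "sum_list (map f (loop w)) = (\<Sum>k<m. sum_list (map f (secw ((pm (ev w) ^^ k) t) w)))"
    by (simp add: loop_def)
  also have "\<dots> = (\<Sum>x<m. sum_list (map f (secw x w)))"
    by (rule sum.reindex_bij_betw[OF bij_betw_orbit[OF w]])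
  finally show ?thesis using sum_secw[OF w(1)] by simp
qed

lemma concat_map_upt_split:
  "k < n \<Longrightarrow> concat (map Y [0..<n]) = concat (map Y [0..<k]) @ Y k @ concat (map Y [Suc k..<n])"
proof -
  assume "k < n"
  then have "[0..<n] = [0..<k] @ k # [Suc k..<n]" by (metis le_add_same_cancel1 less_imp_le upt_add_eq_append upt_conv_Cons zero_le le_add_diff_inverse)
  then show ?thesis by simp
qed

text \<open>
  Let \<open>c\<close> be the direction in which \<open>a\<^sub>0\<close> or its inverse leaves a vertex of the first level with
  nontrivial section and arrives at a vertex other than \<open>t\<close>. Nothing happens at the latter vertex
  until \<open>a\<^sub>0\<close> is applied again. So if this next time the direction is opposite, then the two letters
  cancel in the section. Cyclically there is such a place in each word in which \<open>a\<^sub>0\<close> occurs with both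
  signs; if it extends over the end of the word, then it is seen in \<open>loop w\<close> between two passages
  through \<open>w\<close>, because \<open>loop w\<close> starts and ends at \<open>t\<close>.
\<close>

lemma loop_cancels:
  assumes w: "is_word w" "\<bar>expsum 0 w\<bar> = 1" and both: "(0, True) \<in> set w" "(0, False) \<in> set w"
  shows "\<exists>u c v. loop w = u @ [(s - 1, c), (s - 1, \<not> c)] @ v"
proof -
  define c where "c \<longleftrightarrow> t = m - 1"
  let ?o = "spot (0, \<not> c)" and ?g = "ev w" and ?Y = "\<lambda>k. secw ((pm (ev w) ^^ k) t) w"
  have o: "?o \<noteq> t" "?o < m" using m t by (auto simp: c_def spot_def)
  have shl0: "shl (0, b) = (s - 1, b)" for b by (simp add: shl_def sh_def)
  have pass: "secw x (A @ (0, c) # B) = secw x A @ (s - 1, c) # secw ?o B" "pm (ev (A @ [(0, c)])) x = ?o"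
    if "pm (ev A) x = spot (0, c)" for A B x
    using that by (simp_all add: secw_append pm_val_zero shl0 pm_mult)
  have silent: "secw ?o (B @ (0, \<not> c) # C) = (s - 1, \<not> c) # secw (pm (val (0, \<not> c)) ?o) C"
    if "is_word B" "zero_free B" for B C
    using that o by (simp add: secw_append zero_free_section shl0)
  have start: "\<exists>k<m. pm (ev A) ((pm ?g ^^ k) t) = spot (0, c)" if A: "is_word A" for A
  proof -
    have "spot (0, c) \<in> pm (ev A) ` {..<m}"
      using bij_betw_imp_surj_on[OF bij_betw_pm[OF ev_in_G[OF A]]] spot_less by simp
    then obtain x where x: "x < m" "pm (ev A) x = spot (0, c)" by auto
    have "x \<in> (\<lambda>k. (pm ?g ^^ k) t) ` {..<m}"
      using bij_betw_imp_surj_on[OF bij_betw_orbit[OF w]] x(1) by simp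
    then show ?thesis using x(2) by auto
  qed
  have inside: ?thesis if ABC: "w = A @ (0, c) # B @ (0, \<not> c) # C" "zero_free B" for A B C
  proof -
    have "is_word A" "is_word B" using w(1) by (auto simp: ABC)
    then obtain k where k: "k < m" "pm (ev A) ((pm ?g ^^ k) t) = spot (0, c)" using start by blast
    have "?Y k = secw ((pm ?g ^^ k) t) A @ [(s - 1, c), (s - 1, \<not> c)] @ secw (pm (val (0, \<not> c)) ?o) C"
      using pass(1)[OF k(2), of "B @ (0, \<not> c) # C"] silent[OF \<open>is_word B\<close> ABC(2)] by (simp add: ABC(1))
    then show ?thesis
      unfolding loop_def concat_map_upt_split[OF k(1)] by (metis append.assoc)
  qed
  obtain B1 l1 C where 1: "w = B1 @ l1 # C" "fst l1 = 0" "\<forall>b\<in>set B1. fst b \<noteq> 0"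
    using split_list_first_prop[of w "\<lambda>l. fst l = 0"] both by fastforce
  obtain A l2 B2 where 2: "w = A @ l2 # B2" "fst l2 = 0" "\<forall>b\<in>set B2. fst b \<noteq> 0"
    using split_list_last_prop[of w "\<lambda>l. fst l = 0"] both by fastforce
  have zf: "zero_free B1" "zero_free B2" using 1(3) 2(3) by (force simp: zero_free_def)+
  have bothc: "(0, c) \<in> set w" "(0, \<not> c) \<in> set w" using both by (cases c; simp)+
  have adjacent: ?thesis if UV: "w = U @ V" "(0, c) \<in> set U" "(0, \<not> c) \<in> set V" for U V
  proof -
    obtain A p B q C where
      *: "U @ V = A @ p # B @ q # C" "p = (0, c)" "q = (0, \<not> c)" "\<forall>b\<in>set B. b \<noteq> (0, c) \<and> b \<noteq> (0, \<not> c)"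
      using split_adjacent[of U "\<lambda>l. l = (0, c)" V "\<lambda>l. l = (0, \<not> c)"] UV by blast
    have "b = (0, c) \<or> b = (0, \<not> c)" if "fst b = 0" for b :: letter
      using that by (cases b) auto
    then have "zero_free B" using *(4) by (force simp: zero_free_def)
    then show ?thesis using inside[of A B C] * UV(1) by simp
  qed
  show ?thesis
  proof (cases "l1 = (0, c) \<or> l2 = (0, \<not> c)")
    case True
    then show ?thesis
    proof
      assume l1: "l1 = (0, c)"
      then have "(0, \<not> c) \<in> set C" using bothc(2) 1 by force
      then show ?thesis using l1 1(1) by (intro adjacent[of "B1 @ [l1]" C]) auto
    next
      assume l2: "l2 = (0, \<not> c)"
      then have "(0, c) \<in> set A" using bothc(1) 2 by force
      then show ?thesis using l2 2(1) by (intro adjacent[of A "l2 # B2"]) auto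
    qed
  next
    case False
    then have l: "l1 = (0, \<not> c)" "l2 = (0, c)" using 1(2) 2(2) by (cases l1, auto, cases l2, auto)
    have words: "is_word A" "is_word B1" "is_word B2" using w(1) 1(1) 2(1) by (metis is_word_simps(2,3))+
    obtain k where k: "k < m" "pm (ev A) ((pm ?g ^^ k) t) = spot (0, c)" using start[OF words(1)] by blast
    have Yk: "?Y k = secw ((pm ?g ^^ k) t) A @ [(s - 1, c)]"
      using pass(1)[OF k(2), of B2] o zero_free_section(2)[OF words(3) zf(2) o(2)] by (simp add: 2(1) l)
    have "?g = ev (A @ [(0, c)]) * ev B2" by (simp add: 2(1) l mult.assoc)
    then have next_o: "(pm ?g ^^ Suc k) t = ?o"
      using pass(2)[OF k(2)] zero_free_section(1)[OF words(3) zf(2)] by (simp add: pm_mult)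
    have "Suc k \<noteq> m" using next_o o(1) pm_ev_power_m[OF w(1)] by (metis id_apply pm_power)
    then have k1: "Suc k < m" using k(1) by simp
    have "?Y (Suc k) = (s - 1, \<not> c) # secw (pm (val (0, \<not> c)) ?o) C"
      unfolding next_o using silent[OF words(2) zf(1), of C] 1(1) l by simp
    then have "concat (map ?Y [Suc k..<m]) = (s - 1, \<not> c) # secw (pm (val (0, \<not> c)) ?o) C @ concat (map ?Y [Suc (Suc k)..<m])"
      using k1 by (simp add: upt_conv_Cons)
    then show ?thesis
      unfolding loop_def concat_map_upt_split[OF k(1)] Yk
      by (intro exI[of _ "concat (map ?Y [0..<k]) @ secw ((pm ?g ^^ k) t) A"]) auto
  qed
qed

lemma expsum_map_shl:
  assumes "is_word w" "i < s"
  shows "expsum i (map shl w) = expsum (unsh i) w"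
  using assms by (induction w) (auto simp: shl_def sh_eq_iff)

lemma count_map_shl:
  assumes "is_word w" "i < s"
  shows "count_list (map fst (map shl w)) i = count_list (map fst w) (unsh i)"
  using assms by (induction w) (auto simp: shl_def sh_eq_iff)

lemma count_list_as_sum: "count_list (map fst w) i = sum_list (map (\<lambda>l. if fst l = i then 1 else 0) w)"
  by (induction w) auto

lemma expsum_as_sum: "expsum i w = sum_list (map (\<lambda>l. if fst l = i then (if snd l then 1 else - 1) else 0) w)"
  by (induction w) auto

text \<open>One step of the reduction of a word: if \<open>a\<^sub>0\<close> occurs more than once, then it occurs with both
  signs and the word becomes shorter.\<close>

lemma reduce_word:
  assumes w: "is_word w" "\<bar>expsum 0 w\<bar> = 1"
  shows "\<exists>z. is_word z \<and> ev z = sec (ev w ^ m) t \<and> (\<forall>i<s. expsum i z = expsum (unsh i) w) \<and>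
    (length z < length w \<or> length z = length w \<and> count_list (map fst w) 0 \<le> 1 \<and>
      (\<forall>i<s. count_list (map fst z) i = count_list (map fst w) (unsh i)))"
proof -
  have len: "length (loop w) = length w"
    using sum_loop[OF w, of "\<lambda>_. 1 :: nat"] by (simp add: sum_list_triv comp_def)
  have exps: "expsum i (loop w) = expsum (unsh i) w" if "i < s" for i
    using expsum_map_shl[OF w(1) that] unfolding expsum_as_sum by (simp only: sum_loop[OF w])
  have cnt: "count_list (map fst (loop w)) i = count_list (map fst w) (unsh i)" if "i < s" for i
    using count_map_shl[OF w(1) that] unfolding count_list_as_sum by (simp only: sum_loop[OF w])
  show ?thesis
  proof (cases "(0, True) \<in> set w \<and> (0, False) \<in> set w")
    case True
    then obtain u c v where z: "loop w = u @ [(s - 1, c), (s - 1, \<not> c)] @ v"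
      using loop_cancels[OF w] by blast
    have "val (s - 1, c) * val (s - 1, \<not> c) = 1"
      by (simp add: val_def inverse_mult_left inverse_mult_right)
    then have "ev (u @ v) = ev (loop w)" by (simp add: z mult.assoc[symmetric])
    moreover have "expsum i (u @ v) = expsum i (loop w)" for i by (simp add: z)
    moreover have "length (u @ v) < length w" using len by (simp add: z)
    moreover have "is_word (u @ v)" using is_word_loop[OF w(1)] by (simp add: z)
    ultimately show ?thesis using exps ev_loop[OF w(1)] by (intro exI[of _ "u @ v"]) simp
  next
    case False
    then obtain b where "(0, \<not> b) \<notin> set w" by (cases "(0, True) \<in> set w") (auto intro: that[of True] that[of False])
    then have "count_list (map fst w) 0 \<le> 1" using expsum_one_sign[of 0 b w] w(2) by (simp split: if_splits)
    then show ?thesis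
      using is_word_loop[OF w(1)] ev_loop[OF w(1)] exps cnt len by (intro exI[of _ "loop w"]) simp
  qed
qed


section \<open>Simple words in core-free maximal subgroups\<close>

definition simple :: "letter list \<Rightarrow> bool" where
  "simple w \<longleftrightarrow> is_word w \<and> distinct (map fst w)"

definition simple_in :: "taut set \<Rightarrow> letter list set" where
  "simple_in M = {w. simple w \<and> ev w \<in> M}"

lemma finite_simple: "finite {w. simple w}"
proof (rule finite_subset)
  show "{w. simple w} \<subseteq> {w. set w \<subseteq> {..<s} \<times> UNIV \<and> length w \<le> s}"
  proof
    fix w assume "w \<in> {w. simple w}"
    then have w: "set (map fst w) \<subseteq> {..<s}" "distinct (map fst w)"
      by (auto simp: simple_def is_word_def)
    have "length w \<le> s" using card_mono[OF _ w(1)] distinct_card[OF w(2)] by simp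
    then show "w \<in> {w. set w \<subseteq> {..<s} \<times> UNIV \<and> length w \<le> s}" using w(1) by force
  qed
qed (intro finite_lists_length_le, simp)

lemma finite_simple_in: "finite (simple_in M)"
  by (rule finite_subset[OF _ finite_simple]) (auto simp: simple_in_def)

lemma simple_append: "simple (u @ v) \<Longrightarrow> simple u \<and> simple v"
  by (auto simp: simple_def)

lemma simple_inv_word: "simple w \<Longrightarrow> simple (inv_word w)"
  by (simp add: simple_def map_fst_inv_word)

lemma simple_zero_split: "simple (u @ (0, b) # v) \<Longrightarrow> zero_free u \<and> zero_free v \<and> is_word u \<and> is_word v"
  by (auto simp: simple_def zero_free_def)

lemma inj_on_sh: "inj_on sh {..<s}"
  by (rule inj_on_inverseI[of _ unsh]) (simp add: unsh_sh)

lemma simple_map_shl: "simple w \<Longrightarrow> simple (map shl w)"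
proof -
  assume w: "simple w"
  have "map fst (map shl w) = map sh (map fst w)" by (simp add: shl_def)
  moreover have "distinct (map sh (map fst w))"
    using w inj_on_subset[OF inj_on_sh, of "set (map fst w)"]
    unfolding distinct_map[of sh "map fst w"] by (auto simp: simple_def is_word_def)
  ultimately have "distinct (map fst (map shl w))" by (simp only:)
  then show ?thesis using w is_word_map_shl unfolding simple_def by blast
qed

lemma inj_on_map_shl: "inj_on (map shl) {w. is_word w}"
proof (rule inj_on_inverseI)
  define unshl where "unshl l = (unsh (fst l), snd l)" for l :: letter
  show "map unshl (map shl w) = w" if "w \<in> {w. is_word w}" for w
    using that by (induction w) (auto simp: unshl_def shl_def unsh_sh)
qed

lemma val_zero_power:
  assumes x: "x < m"
  shows "0 < k \<Longrightarrow> k < m \<Longrightarrow> pm (val (0, b) ^ k) x \<noteq> x"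
    "pm (val (0, b) ^ m) = id" "sec (val (0, b) ^ m) x = val (s - 1, b)"
proof -
  have "(x + k) mod m \<noteq> x" if "0 < k" "k < m" using that x by (auto simp: mod_if)
  then have 1: "pm (a 0 ^ k) x \<noteq> x" if "0 < k" "k < m" using a_0_power[OF x] that by simp
  have 2: "pm (inverse (a 0) ^ k) x \<noteq> x" if "0 < k" "k < m"
  proof
    assume "pm (inverse (a 0) ^ k) x = x"
    then have "pm (inverse (a 0 ^ k)) x = x" by (simp only: inverse_power)
    then have "pm (a 0 ^ k) x = x" using pm_inverse_pm(2)[of "a 0 ^ k" x] by (simp only:)
    then show False using 1[OF that] by simp
  qed
  show "0 < k \<Longrightarrow> k < m \<Longrightarrow> pm (val (0, b) ^ k) x \<noteq> x" using 1 2 by (simp add: val_def)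
  have 3: "pm (inverse (a 0) ^ m) = id" by (simp add: inverse_power pm_inverse pm_a_0_power_m)
  then show "pm (val (0, b) ^ m) = id" by (simp add: val_def pm_a_0_power_m)
  show "sec (val (0, b) ^ m) x = val (s - 1, b)"
    using sec_a_0_power_m[OF x] pm_a_0_power_m
    by (simp add: val_def inverse_power sec_inverse_fixed)
qed

text \<open>
  In a simple word every letter survives along the vertex \<open>t\<close>: if the word does not involve
  \<open>a\<^sub>0\<close>, then it fixes \<open>t\<close> and its section there is the shifted word; otherwise it permutes the
  first level cyclically, and the section of its \<open>m\<close>-th power at \<open>t\<close> is the shifted word.
\<close>

lemma simple_shift_in_proj:
  assumes M: "subgrp M" and w: "simple w" "ev w \<in> M"
  shows "ev (map shl w) \<in> proj M t"
proof (cases "zero_free w")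
  case True
  have "is_word w" using w(1) by (simp add: simple_def)
  then show ?thesis
    using projI[OF w(2) zero_free_section(1)[OF _ True], of t] sec_zero_free[OF _ True t] by simp
next
  case False
  then obtain l where "l \<in> set w" "fst l = 0" by (auto simp: zero_free_def)
  then obtain u b v where uv: "w = u @ (0, b) # v" by (metis prod.collapse split_list)
  have zf: "zero_free u" "zero_free v" "is_word u" "is_word v" using simple_zero_split w(1) uv by auto
  define \<alpha> h where "\<alpha> = val (0, b)" and "h = ev v * ev u"
  have ph: "pm h = id" and sh: "\<And>x. x < m \<Longrightarrow> sec h x = (if x = t then ev (map shl v) * ev (map shl u) else 1)"
    using zero_free_section(1)[OF zf(4,2)] zero_free_section(1)[OF zf(3,1)]
      sec_zero_free[OF zf(4,2)] sec_zero_free[OF zf(3,1)] by (simp_all add: h_def pm_mult sec_mult)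
  have \<alpha>G: "\<alpha> ^ k \<in> G" for k unfolding \<alpha>_def using s by (intro subgrp_power[OF subgrp_G val_in_G]) simp
  have pk: "pm ((\<alpha> * h) ^ k) = pm (\<alpha> ^ k)" for k
    by (induction k) (simp_all add: pm_mult ph)
  have step: "sec ((\<alpha> * h) ^ Suc k) t
      = sec ((\<alpha> * h) ^ k) t * sec \<alpha> (pm (\<alpha> ^ k) t) * sec h (pm (\<alpha> ^ Suc k) t)" for k
  proof -
    have "sec ((\<alpha> * h) ^ Suc k) t = sec ((\<alpha> * h) ^ k) t * sec (\<alpha> * h) (pm (\<alpha> ^ k) t)"
      by (simp only: power_Suc2 sec_mult pk)
    then show ?thesis by (simp only: sec_mult power_Suc2 pm_mult comp_apply mult.assoc)
  qed
  have pow: "sec (\<alpha> ^ Suc k) t = sec (\<alpha> ^ k) t * sec \<alpha> (pm (\<alpha> ^ k) t)" for k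
    by (simp only: power_Suc2 sec_mult)
  have small: "sec ((\<alpha> * h) ^ k) t = sec (\<alpha> ^ k) t" if "k < m" for k
    using that
  proof (induction k)
    case (Suc k)
    have "pm (\<alpha> ^ Suc k) t \<noteq> t" using val_zero_power(1)[OF t, of "Suc k" b] Suc.prems by (simp add: \<alpha>_def)
    then have "sec h (pm (\<alpha> ^ Suc k) t) = 1"
      using sh[OF pm_less[OF \<alpha>G t]] by (simp del: power_Suc)
    then show ?case using step[of k] pow[of k] Suc by simp
  qed simp
  obtain k where k: "m = Suc k" using m by (cases m) auto
  have "sec ((\<alpha> * h) ^ m) t = sec (\<alpha> ^ k) t * sec \<alpha> (pm (\<alpha> ^ k) t) * sec h (pm (\<alpha> ^ m) t)"
    using step[of k] small[of k] by (simp only: k lessI)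
  also have "\<dots> = sec (\<alpha> ^ m) t * sec h t"
    using pow[of k] val_zero_power(2)[OF t, of b] by (simp only: k \<alpha>_def id_apply)
  finally have loop: "sec ((\<alpha> * h) ^ m) t = val (s - 1, b) * (ev (map shl v) * ev (map shl u))"
    using val_zero_power(3)[OF t, of b] sh[OF t] by (simp add: \<alpha>_def)
  have "ev w = ev u * (\<alpha> * ev v)" by (simp add: uv \<alpha>_def)
  then have "ev w ^ m = ev u * (\<alpha> * h) ^ m * inverse (ev u)"
    using power_mult_swap[of "ev u" "\<alpha> * ev v" m] by (simp add: h_def mult.assoc)
  moreover have pm_m: "pm ((\<alpha> * h) ^ m) = id" using pk[of m] val_zero_power(2)[OF t, of b] by (simp add: \<alpha>_def)
  ultimately have "pm (ev w ^ m) = id" "sec (ev w ^ m) t = ev (map shl w)"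
    using zero_free_section(1)[OF zf(3,1)] sec_zero_free[OF zf(3,1) t] loop
    by (simp_all add: pm_mult pm_inverse sec_mult sec_inverse_fixed uv shl_def sh_def group_simps)
  then show ?thesis using projI[OF subgrp_power[OF M w(2), of m], of t] by simp
qed

text \<open>
  From \<open>M\<close> to \<open>proj M t\<close> the number of simple words cannot decrease. So if it is as large as possible, then the
  simple words in \<open>proj M t\<close> are exactly the shifted simple words in \<open>M\<close>.
\<close>

definition rich :: "taut set \<Rightarrow> bool" where
  "rich M \<longleftrightarrow> core_free_maximal M \<and>
    (\<forall>M'. core_free_maximal M' \<longrightarrow> card (simple_in M') \<le> card (simple_in M))"

lemma simple_in_proj:
  assumes "rich M"
  shows "simple_in (proj M t) = map shl ` simple_in M" "rich (proj M t)"
proof -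
  have M: "core_free_maximal M" "core_free_maximal (proj M t)"
    using assms core_free_maximal_proj[OF _ t] by (auto simp: rich_def)
  have sub: "map shl ` simple_in M \<subseteq> simple_in (proj M t)"
    using simple_shift_in_proj[OF cfm_subgrp[OF M(1)]] simple_map_shl by (auto simp: simple_in_def)
  have "inj_on (map shl) (simple_in M)"
    by (rule inj_on_subset[OF inj_on_map_shl]) (auto simp: simple_in_def simple_def)
  then have card: "card (map shl ` simple_in M) = card (simple_in M)" by (rule card_image)
  moreover have "card (simple_in (proj M t)) \<le> card (simple_in M)"
    using assms M(2) by (simp add: rich_def)
  ultimately show eq: "simple_in (proj M t) = map shl ` simple_in M"
    using card_seteq[OF finite_simple_in sub] by simp
  show "rich (proj M t)" using assms M(2) card unfolding rich_def eq by simp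
qed

lemma rich_subgrp: "rich M \<Longrightarrow> subgrp M"
  by (simp add: rich_def cfm_subgrp)

lemma simple_shift_iff:
  assumes M: "rich M" and w: "simple w"
  shows "ev (map shl w) \<in> proj M t \<longleftrightarrow> ev w \<in> M"
proof
  assume "ev (map shl w) \<in> proj M t"
  then have "map shl w \<in> map shl ` simple_in M"
    using simple_in_proj(1)[OF M] simple_map_shl[OF w] by (auto simp: simple_in_def)
  then obtain v where v: "v \<in> simple_in M" "map shl w = map shl v" by auto
  then have "w = v" using inj_onD[OF inj_on_map_shl v(2)] w by (simp add: simple_in_def simple_def)
  then show "ev w \<in> M" using v(1) by (simp add: simple_in_def)
qed (rule simple_shift_in_proj[OF rich_subgrp[OF M] w])

text \<open>
  Think of a simple word in \<open>M\<close> as a closed path at a base point in the coset graph of \<open>M\<close>. If two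
  such paths contain the same letter, then just before it both of them are at the base point or none
  is. For \<open>i = 0\<close> this is seen from the section at \<open>t\<close> of the quotient of the two elements: what stands
  between the two occurrences of \<open>a\<^sub>0\<close> acts trivially below the vertex that is reached from \<open>t\<close>, so it
  disappears. For larger \<open>i\<close> pass to the sections \<open>i\<close> times, which leaves all simple words intact.
\<close>

lemma prefix_in_iff:
  assumes "rich M" "u @ (i, b) # v \<in> simple_in M" "u' @ (i, b) # v' \<in> simple_in M"
  shows "ev u \<in> M \<longleftrightarrow> ev u' \<in> M"
  using assms
proof (induction i arbitrary: M u v u' v')
  case 0
  note sM = rich_subgrp[OF 0(1)]
  have sP: "subgrp (proj M t)" by (rule subgrp_proj[OF sM])
  have zf: "zero_free u" "zero_free v" "is_word u" "is_word v"
    "zero_free u'" "zero_free v'" "is_word u'" "is_word v'"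
    using simple_zero_split 0(2,3) by (auto simp: simple_in_def)
  define \<alpha> h where "\<alpha> = val (0, b)" and "h = ev v * inverse (ev v')"
  define g where "g = ev u * (\<alpha> * h * inverse \<alpha>) * inverse (ev u')"
  have "g = ev (u @ (0, b) # v) * inverse (ev (u' @ (0, b) # v'))"
    by (simp add: g_def \<alpha>_def h_def inverse_of_mult mult.assoc)
  then have gM: "g \<in> M"
    using 0(2,3) by (auto simp: simple_in_def intro!: subgrp_mult[OF sM] subgrp_inverse[OF sM])
  have ph: "pm h = id" and sh: "\<And>x. x < m \<Longrightarrow> x \<noteq> t \<Longrightarrow> sec h x = 1"
    using zero_free_section(1)[OF zf(4,2)] zero_free_section(1)[OF zf(8,6)]
      sec_zero_free[OF zf(4,2)] sec_zero_free[OF zf(8,6)]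
    by (simp_all add: h_def pm_mult pm_inverse sec_mult sec_inverse_fixed inverse_of_one)
  have \<alpha>G: "\<alpha> \<in> G" unfolding \<alpha>_def using s by (intro val_in_G) simp
  have \<alpha>t: "pm \<alpha> t \<noteq> t" using val_zero_power(1)[OF t, of 1 b] m by (simp add: \<alpha>_def)
  have p: "pm (\<alpha> * h * inverse \<alpha>) = id" by (simp add: pm_mult ph fun_eq_iff)
  have "sec (\<alpha> * h * inverse \<alpha>) t = sec \<alpha> t * sec h (pm \<alpha> t) * sec (inverse \<alpha>) (pm \<alpha> t)"
    by (simp add: sec_mult pm_mult ph)
  also have "\<dots> = 1" using sh[OF pm_less[OF \<alpha>G t] \<alpha>t] by (simp add: sec_inverse inverse_mult_right)
  finally have q: "sec (\<alpha> * h * inverse \<alpha>) t = 1" .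
  have "pm g = id" "sec g t = ev (map shl u) * inverse (ev (map shl u'))"
    unfolding g_def sec_mult[of "ev u * (\<alpha> * h * inverse \<alpha>)"] sec_mult[of "ev u"] pm_mult[of "ev u * (\<alpha> * h * inverse \<alpha>)"]
      pm_mult[of "ev u"]
    using zero_free_section(1)[OF zf(3,1)] zero_free_section(1)[OF zf(7,5)]
      sec_zero_free[OF zf(3,1) t] sec_zero_free[OF zf(7,5) t] p q
    by (simp_all add: pm_inverse sec_inverse_fixed)
  then have *: "ev (map shl u) * inverse (ev (map shl u')) \<in> proj M t" using projI[OF gM] by metis
  have "ev (map shl u) \<in> proj M t \<longleftrightarrow> ev (map shl u') \<in> proj M t"
    using subgrp_mult_right_iff[OF sP, of "inverse (ev (map shl u'))" "ev (map shl u)"]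
      subgrp_mult_left_iff[OF sP, of "ev (map shl u)" "inverse (ev (map shl u'))"] *
      subgrp_inverse_iff[OF sP, of "ev (map shl u')"] by blast
  moreover have "simple u" "simple u'"
    using 0(2,3) simple_append unfolding simple_in_def by blast+
  ultimately show ?case using simple_shift_iff[OF 0(1)] by simp
next
  case (Suc i)
  have shl: "map shl (u @ (Suc i, b) # v) = map shl u @ (i, b) # map shl v" for u v
    by (simp add: shl_def sh_def)
  have "ev (map shl u) \<in> proj M t \<longleftrightarrow> ev (map shl u') \<in> proj M t"
    by (rule Suc.IH[of "proj M t" _ "map shl v" _ "map shl v'"], rule simple_in_proj(2)[OF Suc.prems(1)])
      (unfold simple_in_proj(1)[OF Suc.prems(1)] shl[symmetric], (rule imageI, rule Suc.prems)+)
  moreover have "simple u" "simple u'"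
    using Suc.prems(2,3) simple_append unfolding simple_in_def by blast+
  ultimately show ?case using simple_shift_iff[OF Suc.prems(1)] by simp
qed

lemma simple_in_inv_word: "subgrp M \<Longrightarrow> w \<in> simple_in M \<Longrightarrow> inv_word w \<in> simple_in M"
  by (simp add: simple_in_def simple_inv_word ev_inv_word subgrp_inverse)

lemma suffix_in_iff:
  assumes M: "subgrp M" and w: "u @ l # v \<in> simple_in M"
  shows "ev (inv_word v) \<in> M \<longleftrightarrow> ev (u @ [l]) \<in> M"
proof -
  have "ev (u @ [l]) * ev v \<in> M" using w by (simp add: simple_in_def mult.assoc)
  moreover have "ev (u @ [l]) * ev v \<in> M \<Longrightarrow> ev v \<in> M \<longleftrightarrow> ev (u @ [l]) \<in> M"
    using subgrp_mult_right_iff[OF M] subgrp_mult_left_iff[OF M] by blast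
  ultimately show ?thesis using subgrp_inverse_iff[OF M] by (simp add: ev_inv_word)
qed

text \<open>
  Reading words backwards extends this to the other endpoint of the edge with label \<open>i\<close> and to paths
  that use the edge in opposite directions.
\<close>

lemma edge_ends:
  assumes M: "rich M" and W: "u @ (i, b) # v \<in> simple_in M" and V: "u' @ (i, b') # v' \<in> simple_in M"
  shows "b = b' \<Longrightarrow> (ev u \<in> M \<longleftrightarrow> ev u' \<in> M) \<and> (ev (u @ [(i, b)]) \<in> M \<longleftrightarrow> ev (u' @ [(i, b')]) \<in> M)"
    "b \<noteq> b' \<Longrightarrow> (ev u \<in> M \<longleftrightarrow> ev (u' @ [(i, b')]) \<in> M) \<and> (ev (u @ [(i, b)]) \<in> M \<longleftrightarrow> ev u' \<in> M)"
proof -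
  note sM = rich_subgrp[OF M]
  have iW: "inv_word v @ (i, \<not> b) # inv_word u \<in> simple_in M"
    using simple_in_inv_word[OF sM W] by (simp add: inv_word_append inv_word_Cons)
  have iV: "inv_word v' @ (i, \<not> b') # inv_word u' \<in> simple_in M"
    using simple_in_inv_word[OF sM V] by (simp add: inv_word_append inv_word_Cons)
  note sW = suffix_in_iff[OF sM W] and sV = suffix_in_iff[OF sM V]
  show "(ev u \<in> M \<longleftrightarrow> ev u' \<in> M) \<and> (ev (u @ [(i, b)]) \<in> M \<longleftrightarrow> ev (u' @ [(i, b')]) \<in> M)" if "b = b'"
    using prefix_in_iff[OF M W V[folded that]] prefix_in_iff[OF M iW iV[folded that]] sW sV that by simp
  show "(ev u \<in> M \<longleftrightarrow> ev (u' @ [(i, b')]) \<in> M) \<and> (ev (u @ [(i, b)]) \<in> M \<longleftrightarrow> ev u' \<in> M)" if "b \<noteq> b'"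
  proof -
    have b': "(\<not> b') = b" "b' = (\<not> b)" using that by auto
    show ?thesis
      using prefix_in_iff[OF M W, of "inv_word v'" "inv_word u'"] iV
        prefix_in_iff[OF M iW, of u' v'] V sW sV b' by simp
  qed
qed

subsection \<open>Simple words with prescribed signs\<close>

definition full :: "(nat \<Rightarrow> bool) \<Rightarrow> letter list \<Rightarrow> bool" where
  "full \<delta> w \<longleftrightarrow> simple w \<and> set w = (\<lambda>i. (i, \<delta> i)) ` {..<s}"

lemma full_of_counts:
  assumes w: "is_word w" "\<And>i. i < s \<Longrightarrow> expsum i w = (if \<delta> i then 1 else - 1)"
    and c: "\<And>i. i < s \<Longrightarrow> count_list (map fst w) i \<le> 1"
  shows "full \<delta> w"
proof -
  have "count_list (map fst w) i \<le> 1" for i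
  proof (cases "i < s")
    case False
    then have "i \<notin> set (map fst w)" using w(1) by (auto simp: is_word_def)
    then have "count_list (map fst w) i = 0" by (simp only: count_list_0_iff not_False_eq_True)
    then show ?thesis by simp
  qed (rule c)
  then have d: "distinct (map fst w)" 
  proof (induction w)
    case (Cons l w)
    have "count_list (map fst w) i \<le> 1" for i using Cons.prems[of i] by (auto split: if_splits)
    moreover have "fst l \<notin> set (map fst w)"
      using Cons.prems[of "fst l"] count_list_0_iff[of "map fst w" "fst l"] by auto
    ultimately show ?case using Cons.IH by simp
  qed simp
  have sgn: "b = \<delta> i" if "(i, b) \<in> set w" for i b
  proof -
    have "i < s" using that w(1) by (force simp: is_word_def)
    then show ?thesis using expsum_distinct[OF d that] w(2)[of i] by (auto split: if_splits)
  qed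
  have "(i, \<delta> i) \<in> set w" if i: "i < s" for i
  proof -
    have "i \<in> fst ` set w" using expsum_notin[of i w] w(2)[OF i] by (auto split: if_splits)
    then show ?thesis using sgn by force
  qed
  moreover have "l \<in> (\<lambda>i. (i, \<delta> i)) ` {..<s}" if "l \<in> set w" for l
    using that sgn[of "fst l" "snd l"] w(1) by (auto simp: is_word_def image_iff intro!: prod_eqI bexI[of _ "fst l"])
  ultimately show ?thesis using d w(1) by (auto simp: full_def simple_def)
qed

lemma full_unshift:
  assumes "full (\<delta> \<circ> unsh) (map shl w)" "simple w"
  shows "full \<delta> w"
proof -
  have w: "fst l < s" if "l \<in> set w" for l using assms(2) that by (auto simp: simple_def is_word_def)
  have "l \<in> (\<lambda>i. (i, \<delta> i)) ` {..<s}" if l: "l \<in> set w" for l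
  proof -
    have "shl l \<in> (\<lambda>i. (i, (\<delta> \<circ> unsh) i)) ` {..<s}" using assms(1) l by (auto simp: full_def)
    then have "snd l = \<delta> (fst l)" using unsh_sh[OF w[OF l]] by (auto simp: shl_def)
    then show ?thesis using w[OF l] by (intro image_eqI[of _ _ "fst l"]) (auto intro: prod_eqI)
  qed
  moreover have "(i, \<delta> i) \<in> set w" if i: "i < s" for i
  proof -
    have "(sh i, \<delta> i) \<in> set (map shl w)"
      using assms(1) sh_less[OF i] unsh_sh[OF i] by (force simp: full_def)
    then obtain l where l: "l \<in> set w" "shl l = (sh i, \<delta> i)" by auto
    then have "fst l = i" using inj_onD[OF inj_on_sh, of "fst l" i] w[OF l(1)] i by (simp add: shl_def)
    then have "l = (i, \<delta> i)" using l(2) by (auto simp: shl_def intro: prod_eqI)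
    then show ?thesis using l(1) by simp
  qed
  ultimately show ?thesis using assms(2) by (auto simp: full_def)
qed

text \<open>
  Induction on the length and then on an index \<open>j\<close> that occurs more than once. Passing to the section at
  \<open>t\<close> lowers the index by one, unless the word becomes shorter; for \<open>j = 0\<close> it does become shorter. A
  simple word found in \<open>proj M t\<close> is pulled back to \<open>M\<close>.
\<close>

lemma ex_full_of_word:
  assumes "rich M" "is_word w" "ev w \<in> M"
    "\<And>i. i < s \<Longrightarrow> expsum i w = (if \<delta> i then 1 else - 1)"
  shows "\<exists>V\<in>simple_in M. full \<delta> V"
  using assms
proof (induction "length w" arbitrary: M w \<delta> rule: less_induct)
  case less
  note outer = less.hyps
  have step: "\<exists>z. is_word z \<and> ev z \<in> proj M t \<and> (\<forall>i<s. expsum i z = (if (\<delta> \<circ> unsh) i then 1 else - 1)) \<and>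
    (length z < length w \<or> length z = length w \<and> count_list (map fst w) 0 \<le> 1 \<and>
      (\<forall>i<s. count_list (map fst z) i = count_list (map fst w) (unsh i)))"
    if M: "rich M" and w: "is_word w" "ev w \<in> M" "\<And>i. i < s \<Longrightarrow> expsum i w = (if \<delta> i then 1 else - 1)"
    for M w \<delta>
  proof -
    have e: "\<bar>expsum 0 w\<bar> = 1" using w(3)[of 0] s by simp
    have "sec (ev w ^ m) t \<in> proj M t"
      by (rule projI[OF subgrp_power[OF rich_subgrp[OF M] w(2)] pm_ev_power_m[OF w(1)]])
    moreover obtain z where "is_word z" "ev z = sec (ev w ^ m) t" "\<forall>i<s. expsum i z = expsum (unsh i) w"
      "length z < length w \<or> length z = length w \<and> count_list (map fst w) 0 \<le> 1 \<and>
        (\<forall>i<s. count_list (map fst z) i = count_list (map fst w) (unsh i))"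
      using reduce_word[OF w(1) e] by blast
    ultimately show ?thesis using w(3)[OF unsh_less] by (intro exI[of _ z]) simp
  qed
  have pull_back: "\<exists>V\<in>simple_in M. full \<delta> V"
    if M: "rich M" and V: "V \<in> simple_in (proj M t)" "full (\<delta> \<circ> unsh) V" for M V \<delta>
  proof -
    obtain v where v: "v \<in> simple_in M" "V = map shl v" using V(1) simple_in_proj(1)[OF M] by auto
    have "full \<delta> v"
      by (rule full_unshift) (use V(2) v in \<open>simp_all add: simple_in_def\<close>)
    then show ?thesis using v(1) by blast
  qed
  have inner: "\<exists>V\<in>simple_in M. full \<delta> V"
    if "j < s" "count_list (map fst w') j > 1" "length w' = length w" "rich M" "is_word w'" "ev w' \<in> M"
      "\<And>i. i < s \<Longrightarrow> expsum i w' = (if \<delta> i then 1 else - 1)" for j M w' \<delta>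
    using that
  proof (induction j arbitrary: M w' \<delta>)
    case (0 M w' \<delta>)
    obtain z where z: "is_word z" "ev z \<in> proj M t" "\<forall>i<s. expsum i z = (if (\<delta> \<circ> unsh) i then 1 else - 1)"
      "length z < length w"
      using step[OF 0(4-7)] 0(2,3) by auto
    then have "\<exists>V\<in>simple_in (proj M t). full (\<delta> \<circ> unsh) V"
      using simple_in_proj(2)[OF 0(4)] by (intro outer[OF z(4)]) auto
    then show ?case using pull_back[OF 0(4)] by blast
  next
    case (Suc j M w' \<delta>)
    obtain z where z: "is_word z" "ev z \<in> proj M t" "\<forall>i<s. expsum i z = (if (\<delta> \<circ> unsh) i then 1 else - 1)"
      "length z < length w \<or> length z = length w \<and> (\<forall>i<s. count_list (map fst z) i = count_list (map fst w') (unsh i))"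
      using step[OF Suc.prems(4-7)] Suc.prems(3) by auto
    have rich: "rich (proj M t)" by (rule simple_in_proj(2)[OF Suc.prems(4)])
    have "\<exists>V\<in>simple_in (proj M t). full (\<delta> \<circ> unsh) V"
    proof (cases "length z < length w")
      case True
      then show ?thesis using z(1-3) rich by (intro outer) auto
    next
      case False
      have "unsh j = Suc j" using Suc.prems(1) by (simp add: unsh_def)
      then have "count_list (map fst z) j > 1" using z(4) False Suc.prems(1,2) by auto
      then show ?thesis using z False Suc.prems(1) rich by (intro Suc.IH) auto
    qed
    then show ?case using pull_back[OF Suc.prems(4)] by blast
  qed
  show ?case
  proof (cases "\<exists>j<s. count_list (map fst w) j > 1")
    case True
    then show ?thesis using inner less.prems by blast
  next
    case False
    then have c: "count_list (map fst w) i \<le> 1" if "i < s" for i using that by (meson not_less)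
    have "full \<delta> w" by (rule full_of_counts[OF less.prems(2,4) c])
    then show ?thesis using less.prems(3) by (auto simp: simple_in_def full_def)
  qed
qed

lemma ex_full:
  assumes M: "rich M"
  shows "\<exists>V\<in>simple_in M. full \<delta> V"
proof -
  define c where "c = map (\<lambda>i. (i, \<delta> i)) [0..<s]"
  have c: "is_word c" "\<And>i. i < s \<Longrightarrow> expsum i c = (if \<delta> i then 1 else - 1)"
  proof -
    show "is_word c" by (auto simp: c_def is_word_def)
    show "expsum i c = (if \<delta> i then 1 else - 1)" if "i < s" for i
      using that by (intro expsum_distinct) (auto simp: c_def comp_def)
  qed
  have cf: "core_free_maximal M" using M by (simp add: rich_def)
  obtain d0 where "d0 \<in> D" "d0 \<noteq> 1" using D_nontrivial by auto
  then obtain h d where hd: "h \<in> M" "d \<in> D" "ev c = h * d"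
    using cfm_product[OF cf normal_D _ _ ev_in_G[OF c(1)]] by blast
  obtain w where w: "is_word w" "ev w = inverse d" "\<forall>i. expsum i w = 0"
    using ex_word_D[OF subgrp_inverse[OF subgrp_D hd(2)]] by auto
  have "ev (c @ w) \<in> M" using hd by (simp add: w(2) group_simps)
  then show ?thesis using c w by (intro ex_full_of_word[OF M, of "c @ w"]) auto
qed

subsection \<open>Closed paths through all edges\<close>

text \<open>
  For every choice \<open>\<delta>\<close> of signs there is a closed path that uses each of the \<open>s\<close> edges once, in the
  direction given by \<open>\<delta>\<close>. It leaves the base point as often as it enters it. Reversing a single
  edge keeps this balance only if the edge is a loop or avoids the base point. So a path that starts
  at the base point never leaves it, and \<open>M\<close> contains all generators. In the proof, \<open>\<tau> i\<close> is 1 if edge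
  \<open>i\<close> only starts at the base point, \<open>-1\<close> if it only ends there, and 0 otherwise.
\<close>

theorem not_rich: "\<not> rich M"
proof
  assume M: "rich M"
  note sM = rich_subgrp[OF M]
  define P where "P V r = (of_bool (ev (take r V) \<in> M) :: int)" for V r
  obtain c where c: "c \<in> simple_in M" "full (\<lambda>_. True) c" using ex_full[OF M] by blast
  have len: "length V = s" and bij: "bij_betw (\<lambda>r. fst (V ! r)) {..<s} {..<s}" if "full \<delta> V" for V \<delta>
  proof -
    have d: "distinct (map fst V)" "set (map fst V) = {..<s}"
      using that by (auto simp: full_def simple_def image_image)
    then show l: "length V = s" using distinct_card[OF d(1)] by simp
    have "bij_betw ((!) (map fst V)) {..<s} {..<s}"
      using bij_betw_nth[OF d(1) _ d(2)[symmetric], of "{..<s}"] l by simp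
    then show "bij_betw (\<lambda>r. fst (V ! r)) {..<s} {..<s}"
      using l by (subst bij_betw_cong[of _ _ "(!) (map fst V)"]) auto
  qed
  define pos where "pos i = inv_into {..<s} (\<lambda>r. fst (c ! r)) i" for i
  have pos: "pos i < s" "fst (c ! pos i) = i" if "i < s" for i
  proof -
    have "i \<in> (\<lambda>r. fst (c ! r)) ` {..<s}" using bij_betw_imp_surj_on[OF bij[OF c(2)]] that by simp
    then show "pos i < s" "fst (c ! pos i) = i"
      unfolding pos_def using inv_into_into[of i "\<lambda>r. fst (c ! r)" "{..<s}"]
      by (simp_all add: f_inv_into_f[of i "\<lambda>r. fst (c ! r)"])
  qed
  define \<tau> where "\<tau> i = P c (pos i) - P c (Suc (pos i))" for i
  have letter: "V ! r = (fst (V ! r), \<delta> (fst (V ! r)))" if "full \<delta> V" "r < s" for V \<delta> r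
    using that len[OF that(1)] nth_mem[of r V] by (auto simp: full_def)
  have split: "V = take r V @ V ! r # drop (Suc r) V" "take (Suc r) V = take r V @ [V ! r]"
    if "full \<delta> V" "r < s" for V \<delta> r
    using that len[OF that(1)] by (simp_all add: id_take_nth_drop take_Suc_conv_app_nth)
  have sign: "P V r - P V (Suc r) = (if \<delta> (fst (V ! r)) then 1 else - 1) * \<tau> (fst (V ! r))"
    if V: "V \<in> simple_in M" "full \<delta> V" and r: "r < s" for V \<delta> r
  proof -
    let ?i = "fst (V ! r)"
    have i: "?i < s" using bij_betw_apply[OF bij[OF V(2)], of r] r by simp
    let ?q = "pos ?i"
    have Vr: "V ! r = (?i, \<delta> ?i)" by (rule letter[OF V(2) r])
    have cq: "c ! ?q = (?i, True)" using letter[OF c(2) pos(1)[OF i]] pos(2)[OF i] by simp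
    have V': "take r V @ (?i, \<delta> ?i) # drop (Suc r) V \<in> simple_in M"
      using split(1)[OF V(2) r] Vr V(1) by metis
    have c': "take ?q c @ (?i, True) # drop (Suc ?q) c \<in> simple_in M"
      using split(1)[OF c(2) pos(1)[OF i]] cq c(1) by metis
    have S: "take (Suc r) V = take r V @ [(?i, \<delta> ?i)]" "take (Suc ?q) c = take ?q c @ [(?i, True)]"
      using split(2)[OF V(2) r] split(2)[OF c(2) pos(1)[OF i]] Vr cq by metis+
    show ?thesis
    proof (cases "\<delta> ?i")
      case True
      then show ?thesis using edge_ends(1)[OF M V' c'] unfolding \<tau>_def P_def S by simp
    next
      case False
      then show ?thesis using edge_ends(2)[OF M V' c'] unfolding \<tau>_def P_def S by simp
    qed
  qed
  have balance: "(\<Sum>i<s. (if \<delta> i then 1 else - 1) * \<tau> i) = 0" for \<delta>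
  proof -
    obtain V where V: "V \<in> simple_in M" "full \<delta> V" using ex_full[OF M] by blast
    have "(\<Sum>i<s. (if \<delta> i then 1 else - 1) * \<tau> i) = (\<Sum>r<s. P V r - P V (Suc r))"
      using sum.reindex_bij_betw[OF bij[OF V(2)], of "\<lambda>i. (if \<delta> i then 1 else - 1) * \<tau> i"]
        sign[OF V] by simp
    also have "\<dots> = P V 0 - P V s" by (rule sum_lessThan_telescope')
    also have "\<dots> = 0"
      using V(1) len[OF V(2)] subgrp_one[OF sM] by (simp add: P_def simple_in_def)
    finally show ?thesis .
  qed
  have "\<tau> j = 0" if j: "j < s" for j
  proof -
    have "(\<Sum>i<s. (if i \<noteq> j then 1 else - 1) * \<tau> i) = (\<Sum>i<s. \<tau> i) - (\<Sum>i<s. if i = j then 2 * \<tau> j else 0)"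
      unfolding sum_subtractf[symmetric] by (intro sum.cong) auto
    then show ?thesis using balance[of "\<lambda>_. True"] balance[of "\<lambda>i. i \<noteq> j"] j by simp
  qed
  then have "P c r = P c (Suc r)" if "r < s" for r
    using sign[OF c that] bij_betw_apply[OF bij[OF c(2)], of r] that by simp
  moreover have "P c 0 = 1" using subgrp_one[OF sM] by (simp add: P_def)
  ultimately have "P c r = 1" if "r \<le> s" for r
    using that by (induction r) auto
  then have pre: "ev (take r c) \<in> M" if "r \<le> s" for r using that by (auto simp: P_def split: if_splits)
  have "a i \<in> M" if i: "i < s" for i
  proof -
    have "ev (take (pos i) c) * a i = ev (take (Suc (pos i)) c)"
      using split(2)[OF c(2) pos(1)[OF i]] letter[OF c(2) pos(1)[OF i]] pos(2)[OF i] by (simp add: val_def)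
    then show ?thesis
      using pre[of "pos i"] pre[of "Suc (pos i)"] pos(1)[OF i] subgrp_mult_left_iff[OF sM] by (metis Suc_leI less_imp_le)
  qed
  then have "G \<subseteq> M" unfolding G_def by (intro gen_by_subset[OF sM]) auto
  moreover have "maximal_in M G" using M by (simp add: rich_def core_free_maximal_def)
  ultimately show False using maximal_inD(2,3) by blast
qed

theorem maximal_finite_index:
  assumes M: "maximal_in M G"
  shows "finite_index M G"
proof (rule ccontr)
  assume inf: "\<not> finite_index M G"
  then have "core_free_maximal M"
    using M maximal_infinite_index_core_free[OF M inf] by (auto simp: core_free_maximal_def)
  moreover have "card (simple_in M') < Suc (card {w. simple w})" for M'
  proof -
    have "simple_in M' \<subseteq> {w. simple w}" by (auto simp: simple_in_def)
    then show ?thesis using card_mono[OF finite_simple] by (simp add: less_Suc_eq_le)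
  qed
  ultimately obtain M' where "core_free_maximal M'"
    "\<And>M''. core_free_maximal M'' \<Longrightarrow> card (simple_in M'') \<le> card (simple_in M')"
    using ex_has_greatest_nat[of core_free_maximal M "\<lambda>M. card (simple_in M)" "Suc (card {w. simple w})"]
    by (metis less_imp_le)
  then show False using not_rich[of M'] by (auto simp: rich_def)
qed

end

section \<open>The group of restrictions to the \<open>m\<close>-adic tree\<close>

fun app :: "taut \<Rightarrow> nat list \<Rightarrow> nat list" where
  "app g [] = []"
| "app g (x # w) = pm g x # app (sec g x) w"

lemma app_mult: "app (g * h) w = app h (app g w)"
  by (induction w arbitrary: g h) (simp_all add: pm_mult sec_mult)

lemma app_one: "app 1 w = w"
  by (induction w) simp_all

context kneading
begin

abbreviation v :: "nat list" where
  "v \<equiv> replicate (s - 1) t"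

abbreviation K :: "(nat list \<Rightarrow> nat list) monoid" where
  "K \<equiv> KGroup m v"

text \<open>
  Restriction to the \<open>m\<close>-adic tree, in the representation of automorphisms by extensional functions.
\<close>

definition \<rho> :: "taut \<Rightarrow> nat list \<Rightarrow> nat list" where
  "\<rho> g = (\<lambda>w\<in>tree_words m. app g w)"

lemma app_words: "g \<in> G \<Longrightarrow> w \<in> tree_words m \<Longrightarrow> app g w \<in> tree_words m"
  by (induction w arbitrary: g) (auto simp: pm_less sec_in_G)

lemma \<rho>_mult: "g \<in> G \<Longrightarrow> \<rho> (g * h) = \<rho> g \<otimes>\<^bsub>AutT m\<^esub> \<rho> h"
  by (auto simp: \<rho>_def AutT_def compose_def app_mult app_words fun_eq_iff)

lemma \<rho>_one: "\<rho> 1 = \<one>\<^bsub>AutT m\<^esub>"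
  by (simp add: \<rho>_def AutT_def app_one)

lemma app_a: "w \<in> tree_words m \<Longrightarrow> i < s \<Longrightarrow> app (a i) w = kact m v i w"
proof (induction w arbitrary: i)
  case (Cons x w)
  then have x: "x < m" and w: "w \<in> tree_words m" by auto
  show ?case
  proof (cases i)
    case 0
    then show ?thesis using Cons.IH[OF w, of "s - 1"] x s
      by (auto simp: pm_a_0 sec_a_0 rot_def app_one)
  next
    case (Suc j)
    then show ?thesis using Cons.IH[OF w, of j] Cons.prems(2)
      by (auto simp: pm_a_Suc sec_a_Suc app_one)
  qed
qed simp

lemma \<rho>_a: "i < s \<Longrightarrow> \<rho> (a i) = kgen m v i"
  by (auto simp: \<rho>_def kgen_def app_a)

lemma \<rho>_inverse:
  assumes g: "g \<in> G" "\<rho> g \<in> carrier (AutT m)"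
  shows "\<rho> (inverse g) = inv\<^bsub>AutT m\<^esub> \<rho> g"
proof
  interpret A: group "AutT m" by (rule group_AutT)
  let ?h = "inv\<^bsub>AutT m\<^esub> \<rho> g"
  have h: "?h \<in> carrier (AutT m)" using g(2) by simp
  have ext: "?h \<in> extensional (tree_words m)" by (rule AutT_D(2)[OF h])
  fix y
  show "\<rho> (inverse g) y = ?h y"
  proof (cases "y \<in> tree_words m")
    case True
    then have "y \<in> \<rho> g ` tree_words m" using AutT_D(1)[OF g(2)] by (simp add: bij_betw_def)
    then obtain w where w: "w \<in> tree_words m" "\<rho> g w = y" by blast
    have "(f \<otimes>\<^bsub>AutT m\<^esub> h) w = h (f w)" "\<one>\<^bsub>AutT m\<^esub> w = w" for f h
      using w(1) by (simp_all add: AutT_def compose_def)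
    then have "?h y = w" using A.r_inv[OF g(2)] w(2) by metis
    moreover have "app (inverse g) (app g w) = w"
      by (simp add: app_mult[symmetric] inverse_mult_right app_one)
    ultimately show ?thesis using w True by (auto simp: \<rho>_def)
  next
    case False
    then show ?thesis using ext by (simp add: \<rho>_def extensional_def)
  qed
qed

lemma carrier_K: "carrier K = \<rho> ` G"
proof
  interpret A: group "AutT m" by (rule group_AutT)
  let ?E = "kgen m v ` {0..length v}"
  have E: "?E = \<rho> ` a ` {..<s}" using s by (auto simp: \<rho>_a image_iff intro!: bexI)
  have EA: "?E \<subseteq> carrier (AutT m)" using kgen_in_AutT by auto
  have K: "carrier K = generate (AutT m) ?E" by (simp add: KGroup_def)
  note genA = A.generate_in_carrier[OF EA]
  have "\<rho> g \<in> generate (AutT m) ?E" if "g \<in> G" for g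
    using that unfolding G_def
  proof (induction rule: gen_by.induct)
    case gen_one
    show ?case unfolding \<rho>_one by (rule generate.one)
  next
    case (gen_base e)
    then show ?case unfolding E by (intro generate.incl) auto
  next
    case (gen_mult g h)
    then show ?case using \<rho>_mult[of g h] generate.eng by (auto simp: G_def)
  next
    case (gen_inverse g)
    then have "\<rho> (inverse g) = inv\<^bsub>AutT m\<^esub> \<rho> g"
      using genA by (intro \<rho>_inverse) (auto simp: G_def)
    then show ?case using A.generate_m_inv_closed[OF EA gen_inverse.IH] by simp
  qed
  then show "\<rho> ` G \<subseteq> carrier K" unfolding K by auto
  have "f \<in> \<rho> ` G" if "f \<in> generate (AutT m) ?E" for f
    using that
  proof (induction rule: generate.induct)
    case one
    show ?case using subgrp_one[OF subgrp_G] \<rho>_one by (metis imageI)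
  next
    case (incl h)
    then show ?case unfolding E using a_in_G by auto
  next
    case (inv h)
    then obtain i where i: "i < s" "h = \<rho> (a i)" using E by auto
    have "\<rho> (inverse (a i)) = inv\<^bsub>AutT m\<^esub> h"
      unfolding i(2) using inv EA i by (intro \<rho>_inverse a_in_G) auto
    then show ?case using subgrp_inverse[OF subgrp_G a_in_G[OF i(1)]] by (metis imageI)
  next
    case (eng h1 h2)
    then obtain g1 g2 where "g1 \<in> G" "h1 = \<rho> g1" "g2 \<in> G" "h2 = \<rho> g2" by auto
    then show ?case using \<rho>_mult[of g1 g2] subgrp_mult[OF subgrp_G] by (metis imageI)
  qed
  then show "carrier K \<subseteq> \<rho> ` G" unfolding K by auto
qed

text \<open>
  Pull the maximal subgroup back along the homomorphism \<open>\<rho>\<close> of \<open>G\<close> onto \<open>K\<close>.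
\<close>

theorem no_maximal_infinite_index:
  assumes M: "maximal_subgroup M K"
  shows "\<not> infinite_index M K"
proof -
  interpret K: group K by (rule group_KGroup)
  have mult: "\<rho> (g * h) = \<rho> g \<otimes>\<^bsub>K\<^esub> \<rho> h" if "g \<in> G" for g h
    using \<rho>_mult[OF that] by (simp add: KGroup_def)
  have one: "\<rho> 1 = \<one>\<^bsub>K\<^esub>" by (simp add: \<rho>_one KGroup_def)
  have inG: "\<rho> g \<in> carrier K" if "g \<in> G" for g using that carrier_K by auto
  have inverse: "\<rho> (inverse g) = inv\<^bsub>K\<^esub> \<rho> g" if g: "g \<in> G" for g
  proof -
    have "inverse g \<in> G" by (rule subgrp_inverse[OF subgrp_G g])
    then have "\<rho> (inverse g) \<otimes>\<^bsub>K\<^esub> \<rho> g = \<one>\<^bsub>K\<^esub>"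
      using mult[of "inverse g" g] one by (simp add: inverse_mult_left)
    then show ?thesis using K.inv_equality inG \<open>inverse g \<in> G\<close> g by metis
  qed
  have sM: "subgroup M K" and Mne: "M \<noteq> carrier K"
    and Mmax: "\<And>H. subgroup H K \<Longrightarrow> M \<subseteq> H \<Longrightarrow> H = M \<or> H = carrier K"
    using M by (auto simp: maximal_subgroup_def)
  note MK = subgroup.subset[OF sM]
  define L where "L = {g \<in> G. \<rho> g \<in> M}"
  have L: "subgrp L"
    using subgrp_G subgroup.one_closed[OF sM] subgroup.m_closed[OF sM] subgroup.m_inv_closed[OF sM]
    by (intro subgrpI) (auto simp: L_def subgrp_intros one mult inverse)
  have "maximal_in L G"
    unfolding maximal_in_def
  proof (intro conjI allI impI)
    show "subgrp L" by (rule L)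
    obtain k where "k \<in> carrier K" "k \<notin> M" using MK Mne by auto
    then show "L \<subset> G" using carrier_K by (auto simp: L_def)
    fix H assume H: "subgrp H" "L \<subseteq> H" "H \<subseteq> G"
    have "subgroup (\<rho> ` H) K"
    proof (rule K.subgroupI)
      show "\<rho> ` H \<subseteq> carrier K" using H(3) inG by auto
      show "\<rho> ` H \<noteq> {}" using subgrp_one[OF H(1)] by auto
      show "inv\<^bsub>K\<^esub> x \<in> \<rho> ` H" if x: "x \<in> \<rho> ` H" for x
      proof -
        obtain h where h: "h \<in> H" "x = \<rho> h" using x by auto
        then have "inv\<^bsub>K\<^esub> x = \<rho> (inverse h)" using inverse[of h] H(3) by auto
        then show ?thesis using subgrp_inverse[OF H(1) h(1)] by simp
      qed
      show "x \<otimes>\<^bsub>K\<^esub> y \<in> \<rho> ` H" if xy: "x \<in> \<rho> ` H" "y \<in> \<rho> ` H" for x y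
      proof -
        obtain g h where gh: "g \<in> H" "x = \<rho> g" "h \<in> H" "y = \<rho> h" using xy by auto
        then have "x \<otimes>\<^bsub>K\<^esub> y = \<rho> (g * h)" using mult[of g h] H(3) by auto
        then show ?thesis using subgrp_mult[OF H(1) gh(1,3)] by simp
      qed
    qed
    moreover have "M \<subseteq> \<rho> ` H"
    proof
      fix x assume x: "x \<in> M"
      then obtain g where "g \<in> G" "x = \<rho> g" using MK carrier_K by auto
      then show "x \<in> \<rho> ` H" using x H(2) by (auto simp: L_def)
    qed
    ultimately consider "\<rho> ` H = M" | "\<rho> ` H = carrier K" using Mmax by blast
    then show "H = L \<or> H = G"
    proof cases
      case 1
      then show ?thesis using H(2,3) by (auto simp: L_def)
    next
      case 2
      have "g \<in> H" if g: "g \<in> G" for g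
      proof -
        obtain h where h: "h \<in> H" "\<rho> g = \<rho> h" using 2 inG[OF g] by (metis imageE)
        then have hG: "h \<in> G" using H(3) by auto
        have "\<rho> (g * inverse h) = \<one>\<^bsub>K\<^esub>"
          unfolding mult[OF g] inverse[OF hG] h(2) by (rule K.r_inv[OF inG[OF hG]])
        then have "g * inverse h \<in> L"
          using g hG subgroup.one_closed[OF sM]
          by (simp add: L_def subgrp_mult[OF subgrp_G] subgrp_inverse[OF subgrp_G])
        then have "g * inverse h \<in> H" using H(2) by auto
        then have "g * inverse h * h \<in> H" using h(1) by (rule subgrp_mult[OF H(1)])
        then show ?thesis by (simp add: group_simps)
      qed
      then show ?thesis using H(3) by auto
    qed
  qed
  then have "finite_index L G" by (rule maximal_finite_index)
  then obtain R where R: "finite R" "R \<subseteq> G" "\<And>g. g \<in> G \<Longrightarrow> \<exists>r\<in>R. g * inverse r \<in> L"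
    using finite_index_reps[OF L] by blast
  have "rcosets\<^bsub>K\<^esub> M \<subseteq> (\<lambda>r. M #>\<^bsub>K\<^esub> \<rho> r) ` R"
  proof
    fix C assume "C \<in> rcosets\<^bsub>K\<^esub> M"
    then obtain g where g: "g \<in> G" "C = M #>\<^bsub>K\<^esub> \<rho> g" using carrier_K by (auto simp: RCOSETS_def)
    obtain r where r: "r \<in> R" "g * inverse r \<in> L" using R(3)[OF g(1)] by auto
    have rG: "r \<in> G" using r(1) R(2) by auto
    have "\<rho> g = \<rho> (g * inverse r) \<otimes>\<^bsub>K\<^esub> \<rho> r"
      using mult[of "g * inverse r" r] r(2) by (simp add: L_def group_simps)
    then have "\<rho> g \<in> M #>\<^bsub>K\<^esub> \<rho> r" using r(2) by (auto simp: L_def r_coset_def)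
    then have "M #>\<^bsub>K\<^esub> \<rho> r = M #>\<^bsub>K\<^esub> \<rho> g" by (rule K.repr_independence[OF _ inG[OF rG] sM])
    then show "C \<in> (\<lambda>r. M #>\<^bsub>K\<^esub> \<rho> r) ` R" using g(2) r(1) by auto
  qed
  then have "finite (rcosets\<^bsub>K\<^esub> M)" using R(1) finite_surj by blast
  then show ?thesis by (simp add: infinite_index_def)
qed

end

theorem theorem1p2:
  fixes m s t :: nat
  assumes "m \<ge> 2" and "s \<ge> 2" and "t \<in> {0..m - 1}"
  shows "\<not> (\<exists>M. maximal_subgroup M (KGroup m (replicate (s - 1) t)) \<and>
               infinite_index M (KGroup m (replicate (s - 1) t)))"
proof -
  interpret kneading m s t by unfold_locales (use assms in auto)
  show ?thesis using no_maximal_infinite_index by blast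
qed

end
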